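(* Let $K\subset\mathbb{R}^d$ be the invariant set of an iterated function system $\Phi=\{\phi_1,\dots,\phi_N\}$ ($N\ge 2$) of contracting similarities of $\mathbb{R}^d$ with contraction ratios $r_1,\dots,r_N\in(0,1)$ satisfying the strong separation condition. Let $g\colon\mathcal{U}\to\mathbb{R}^d$ be a conformal diffeomorphism on an open domain $\mathcal{U}\supseteq K_{1/2}$ such that $|g'|$ is $\alpha$-H\"older continuous for some $\alpha>0$, and let $F:=g(K)$. Let $\delta$ denote the Minkowski dimension of $K$ (and hence of $F$), let $R_d(K,\cdot)$ be the scaling function of $K$ and let $\mu_\delta:=\mathcal{H}^\delta|_K/\mathcal{H}^\delta(K)$ be the normalised $\delta$-dimensional Hausdorff measure on $K$. Then the following hold. (i) The average Minkowski content $\widetilde{\mathcal{M}}(F)$ of $F$ exists, is positive and is given by $$\widetilde{\mathcal{M}}(F)=-\left(\sum_{i=1}^N r_i^\delta\ln r_i\right)^{-1}\int_0^1\varepsilon^{\delta-d-1}R_d(K,\varepsilon)\,\mathrm{d}\varepsilon\cdot\int_K|g'|^\delta\,\mathrm{d}\mu_\delta.$$ (ii) If $\Phi$ is nonlattice, then the Minkowski content of $F$ exists and coincides with the average Minkowski content, that is, $\mathcal{M}(F)=\widetilde{\mathcal{M}}(F)$.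
   Context: Setting. $\mathbb{R}^d$ carries the Euclidean metric $\rho$ and $\lambda^d$ is $d$-dimensional Lebesgue measure. For a nonempty compact $Y\subset\mathbb{R}^d$ and $\varepsilon>0$, $Y_\varepsilon:=\{x\in\mathbb{R}^d\mid\rho(Y,x)\le\varepsilon\}$ is the $\varepsilon$-parallel neighbourhood of $Y$. The invariant set $K$ of $\Phi$ is the unique nonempty compact set with $K=\bigcup_{i=1}^N\phi_iK$. The strong separation condition means $\phi_iK\cap\phi_jK=\emptyset$ for all $i\ne j$. Conformal means angle preserving: the Jacobian decomposes as $\mathrm{D}g(x)=f(x)\cdot O(x)$ with $O(x)$ an orthogonal matrix and $f(x)$ a scalar; $|g'(x)|:=|f(x)|$ is the length scaling ratio of $g$ at $x$. The diffeomorphism $g$ is understood as a diffeomorphism onto its image. Minkowski dimension. For nonempty compact $Y$, the upper and lower Minkowski dimensions are $\overline{\dim}_M(Y):=d-\liminf_{\varepsilon\searrow0}\frac{\ln\lambda^d(Y_\varepsilon)}{\ln\varepsilon}$ and $\underline{\dim}_M(Y):=d-\limsup_{\varepsilon\searrow0}\frac{\ln\lambda^d(Y_\varepsilon)}{\ln\varepsilon}$; if they coincide the common value is the Minkowski dimension. It is known that the Minkowski dimensions of $K$ and $F$ exist, are equal, and equal the unique $\delta$ with $\sum_{i=1}^N r_i^\delta=1$. $\mathcal{H}^\delta$ is $\delta$-dimensional Hausdorff measure. Minkowski content. Let $Y$ be nonempty compact with Minkowski dimension $\delta$. The average Minkowski content is $\widetilde{\mathcal{M}}(Y):=\lim_{T\searrow0}|\ln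 T|^{-1}\int_T^1\varepsilon^{\delta-d}\lambda^d(Y_\varepsilon)\frac{\mathrm{d}\varepsilon}{\varepsilon}$, provided the limit exists. The Minkowski content is $\mathcal{M}(Y):=\lim_{\varepsilon\searrow0}\varepsilon^{\delta-d}\lambda^d(Y_\varepsilon)$, provided the limit exists. Lattice and scaling function. $\Phi$ is lattice if there exists $a>0$ such that $\ln r_i\in a\mathbb{Z}$ for all $i\in\{1,\dots,N\}$; otherwise $\Phi$ is nonlattice. The scaling function $R_d(K,\cdot)\colon(0,\infty)\to\mathbb{R}$ of $K$ is $R_d(K,\varepsilon):=\lambda^d(K_\varepsilon)-\sum_{i=1}^N\mathbf{1}_{(0,r_i]}(\varepsilon)\,\lambda^d((\phi_iK)_\varepsilon)$. *)

theory Defs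
  imports "HOL-Analysis.Analysis"
begin

subsection \<open>Parallel neighbourhoods, Minkowski dimension and Minkowski content\<close>

definition parallel_nbhd :: "'a::metric_space set \<Rightarrow> real \<Rightarrow> 'a set" where
  "parallel_nbhd Y \<epsilon> = {x. infdist x Y \<le> \<epsilon>}"

definition parallel_volume :: "(real^'d) set \<Rightarrow> real \<Rightarrow> real" where
  "parallel_volume Y \<epsilon> = measure lebesgue (parallel_nbhd Y \<epsilon>)"

definition upper_minkowski_dim :: "(real^'d) set \<Rightarrow> ereal" where
  "upper_minkowski_dim Y =
     ereal (real CARD('d)) - Liminf (at_right 0) (\<lambda>\<epsilon>. ereal (ln (parallel_volume Y \<epsilon>) / ln \<epsilon>))"

definition lower_minkowski_dim :: "(real^'d) set \<Rightarrow> ereal" where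
  "lower_minkowski_dim Y =
     ereal (real CARD('d)) - Limsup (at_right 0) (\<lambda>\<epsilon>. ereal (ln (parallel_volume Y \<epsilon>) / ln \<epsilon>))"

definition has_minkowski_dim :: "(real^'d) set \<Rightarrow> real \<Rightarrow> bool" where
  "has_minkowski_dim Y \<delta> \<longleftrightarrow> upper_minkowski_dim Y = ereal \<delta> \<and> lower_minkowski_dim Y = ereal \<delta>"

definition minkowski_dim :: "(real^'d) set \<Rightarrow> real" where
  "minkowski_dim Y = (THE \<delta>. has_minkowski_dim Y \<delta>)"

text \<open>The two predicates below say that the (average) Minkowski content of \<open>Y\<close> exists and equals
  \<open>M\<close>. The exponent is the Minkowski dimension of \<open>Y\<close> itself, whose existence is part of
  the predicates.\<close>

definition has_minkowski_content :: "(real^'d) set \<Rightarrow> real \<Rightarrow> bool" where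
  "has_minkowski_content Y M \<longleftrightarrow>
     (\<exists>\<delta>. has_minkowski_dim Y \<delta> \<and>
        ((\<lambda>\<epsilon>. \<epsilon> powr (\<delta> - real CARD('d)) * parallel_volume Y \<epsilon>) \<longlongrightarrow> M) (at_right 0))"

definition has_average_minkowski_content :: "(real^'d) set \<Rightarrow> real \<Rightarrow> bool" where
  "has_average_minkowski_content Y M \<longleftrightarrow>
     (\<exists>\<delta>. has_minkowski_dim Y \<delta> \<and>
        ((\<lambda>T. inverse \<bar>ln T\<bar> *
            (LINT \<epsilon>:{T..1}|lborel. \<epsilon> powr (\<delta> - real CARD('d)) * parallel_volume Y \<epsilon> / \<epsilon>))
          \<longlongrightarrow> M) (at_right 0))"


subsection \<open>Hausdorff measure\<close>

text \<open>Contribution of one covering set, with the usual conventions for \<open>s = 0\<close>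
  (\<open>0 powr 0 = 0\<close> in the library, whereas \<open>H\<^sup>0\<close> is counting measure). Only bounded
  sets are used as covering sets, since \<^const>\<open>diameter\<close> is real-valued.\<close>

definition hausdorff_gauge :: "real \<Rightarrow> 'a::metric_space set \<Rightarrow> ennreal" where
  "hausdorff_gauge s A =
     (if A = {} then 0 else if s = 0 then 1 else ennreal (diameter A powr s))"

definition hausdorff_pre :: "real \<Rightarrow> real \<Rightarrow> 'a::metric_space set \<Rightarrow> ennreal" where
  "hausdorff_pre s \<eta> A =
     (INF C \<in> {C :: nat \<Rightarrow> 'a set. A \<subseteq> (\<Union>n. C n) \<and> (\<forall>n. bounded (C n) \<and> diameter (C n) \<le> \<eta>)}.
        \<Sum>n. hausdorff_gauge s (C n))"

definition hausdorff_outer :: "real \<Rightarrow> 'a::metric_space set \<Rightarrow> ennreal" where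
  "hausdorff_outer s A = (SUP \<eta> \<in> {0<..}. hausdorff_pre s \<eta> A)"

text \<open>No dimensional normalising constant is included; it cancels in \<open>normalised_hausdorff\<close>.\<close>

definition hausdorff_measure :: "real \<Rightarrow> 'a::metric_space measure" where
  "hausdorff_measure s = measure_of UNIV (sets borel) (hausdorff_outer s)"

definition normalised_hausdorff :: "real \<Rightarrow> 'a::metric_space set \<Rightarrow> 'a measure" where
  "normalised_hausdorff s K =
     scale_measure (1 / emeasure (hausdorff_measure s) K) (restrict_space (hausdorff_measure s) K)"


subsection \<open>Self-similar sets\<close>

definition contracting_similarity :: "('a::metric_space \<Rightarrow> 'a) \<Rightarrow> real \<Rightarrow> bool" where
  "contracting_similarity f c \<longleftrightarrow> 0 < c \<and> c < 1 \<and> (\<forall>x y. dist (f x) (f y) = c * dist x y)"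

text \<open>For finitely many contractions of a complete space such a set exists and is unique
  (Hutchinson).\<close>

definition invariant_set :: "nat \<Rightarrow> (nat \<Rightarrow> 'a::metric_space \<Rightarrow> 'a) \<Rightarrow> 'a set \<Rightarrow> bool" where
  "invariant_set N \<phi> K \<longleftrightarrow> K \<noteq> {} \<and> compact K \<and> K = (\<Union>i\<in>{1..N}. \<phi> i ` K)"

definition strong_separation :: "nat \<Rightarrow> (nat \<Rightarrow> 'a \<Rightarrow> 'a) \<Rightarrow> 'a set \<Rightarrow> bool" where
  "strong_separation N \<phi> K \<longleftrightarrow>
     (\<forall>i\<in>{1..N}. \<forall>j\<in>{1..N}. i \<noteq> j \<longrightarrow> \<phi> i ` K \<inter> \<phi> j ` K = {})"

definition lattice_ratios :: "nat \<Rightarrow> (nat \<Rightarrow> real) \<Rightarrow> bool" where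
  "lattice_ratios N r \<longleftrightarrow> (\<exists>a>0. \<forall>i\<in>{1..N}. \<exists>k::int. ln (r i) = a * of_int k)"

definition scaling_function ::
  "nat \<Rightarrow> (nat \<Rightarrow> real^'d \<Rightarrow> real^'d) \<Rightarrow> (nat \<Rightarrow> real) \<Rightarrow> (real^'d) set \<Rightarrow> real \<Rightarrow> real" where
  "scaling_function N \<phi> r K \<epsilon> =
     parallel_volume K \<epsilon> - (\<Sum>i=1..N. indicator {0<..r i} \<epsilon> * parallel_volume (\<phi> i ` K) \<epsilon>)"


subsection \<open>Conformal diffeomorphisms\<close>

definition C1_map_on :: "(real^'d \<Rightarrow> real^'d) \<Rightarrow> (real^'d) set \<Rightarrow> bool" where
  "C1_map_on f S \<longleftrightarrow> open S \<and> f differentiable_on S \<and> continuous_on S (\<lambda>x. jacobian f (at x))"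

definition diffeomorphism_onto_image :: "(real^'d \<Rightarrow> real^'d) \<Rightarrow> (real^'d) set \<Rightarrow> bool" where
  "diffeomorphism_onto_image g U \<longleftrightarrow>
     C1_map_on g U \<and> (\<exists>h. (\<forall>x\<in>U. h (g x) = x) \<and> C1_map_on h (g ` U))"

definition conformal_on :: "(real^'d \<Rightarrow> real^'d) \<Rightarrow> (real^'d) set \<Rightarrow> bool" where
  "conformal_on g U \<longleftrightarrow>
     (\<forall>x\<in>U. \<exists>c Q. orthogonal_matrix Q \<and> jacobian g (at x) = c *\<^sub>R Q)"

text \<open>The scalar \<open>c\<close> in the decomposition is determined only up to its sign; its absolute value
  is unique.\<close>

definition scaling_ratio :: "(real^'d \<Rightarrow> real^'d) \<Rightarrow> real^'d \<Rightarrow> real" where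
  "scaling_ratio g x =
     (THE s. \<exists>c Q. orthogonal_matrix Q \<and> jacobian g (at x) = c *\<^sub>R Q \<and> s = \<bar>c\<bar>)"

definition hoelder_on :: "real \<Rightarrow> 'a::metric_space set \<Rightarrow> ('a \<Rightarrow> real) \<Rightarrow> bool" where
  "hoelder_on \<alpha> S f \<longleftrightarrow> (\<exists>C. \<forall>x\<in>S. \<forall>y\<in>S. \<bar>f x - f y\<bar> \<le> C * dist x y powr \<alpha>)"

end

theory Submission
  imports Defs
begin

text \<open>Write \<open>V(\<epsilon>)\<close> for the volume of the \<open>\<epsilon>\<close>-parallel set of \<open>K\<close>, let \<open>s > 0\<close> be the solution of
\<open>\<Sum>i r\<^sub>i\<^sup>s = 1\<close> and put \<open>\<kappa> = s - d\<close>. By strong separation the parallel sets of the pieces \<open>\<phi>\<^sub>i K\<close>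
are disjoint for all small \<open>\<epsilon>\<close>, so that \<open>H(\<epsilon>) = \<epsilon>\<^sup>\<kappa> V(\<epsilon>)\<close> satisfies the renewal equation
\<open>H(\<epsilon>) = \<Sum>i r\<^sub>i\<^sup>s H(\<epsilon> / r\<^sub>i)\<close> \<^emph>\<open>exactly\<close> below some threshold. This makes the renewal theory elementary.
Bounds for \<open>H\<close> on one period persist at all smaller scales (\<open>renewal_lower_bound\<close>); hence \<open>H\<close> is
bounded away from \<open>0\<close> and \<open>\<infinity>\<close>, and \<open>s\<close> is the Minkowski dimension of \<open>K\<close>. The integral of \<open>H\<close> over
\<open>[T, 1]\<close> against \<open>d\<epsilon>/\<epsilon>\<close> solves the same equation up to an additive constant, which is the integral of the
scaling function; subtracting a multiple of \<open>ln T\<close> removes the constant, so the difference stays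
bounded and the averages converge (\<open>renewal_average_limit\<close>). In the nonlattice case, scales where \<open>H\<close>
almost attains its upper limit propagate to an arbitrarily dense set of scales in a full period, and from
there to all smaller scales, so the lower limit equals the upper one (\<open>renewal_limit_exists\<close>).

The passage from \<open>K\<close> to \<open>F = g K\<close> is geometric. On a small cylinder \<open>\<phi>\<^sub>w K\<close> with base point \<open>p\<close> both
\<open>g\<close> and its inverse are Lipschitz with constants close to \<open>|g' p|\<close> and \<open>1 / |g' p|\<close>. The
volume of the parallel set of \<open>g \<phi>\<^sub>w K\<close> therefore lies between two multiples of rescaled copies of \<open>V\<close>
(\<open>parallel_volume_image_bounds\<close>). Summing over all cylinders of one generation encloses the parallel volume
of \<open>F\<close> between two finite sums of rescaled copies of \<open>V\<close>, and the total weights of these sums are, up to a factor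
close to \<open>1\<close>, Riemann sums of \<open>|g'|\<^sup>s\<close> with respect to the masses \<open>r\<^sub>w\<^sup>s\<close> of the cylinders
(\<open>conformal_image_comparable\<close>). Both limits and logarithmic averages are homogeneous under rescaling and so
pass to \<open>F\<close>, multiplied by the integral of \<open>|g'|\<^sup>s\<close>.

The masses of the cylinders come from the normalised Hausdorff measure. For this the Hausdorff outer
measure is shown to be a metric outer measure, hence a measure on the Borel sets, and
\<open>0 < H\<^sup>s(K) < \<infinity>\<close> is derived from the self-similarity (\<open>hausdorff_outer_pos\<close>, \<open>hausdorff_outer_finite\<close>).\<close>

section \<open>Lipschitz images and parallel sets\<close>

text \<open>Cover \<open>S\<close>, up to a null set and inside an open set of almost the same measure, by disjoint balls with
centres in \<open>S\<close> (Vitali). Each piece has its image in a ball whose radius is \<open>L\<close> times as large, and the null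
set has a null image.\<close>

lemma measure_Lipschitz_image_le:
  fixes f :: "'a::euclidean_space \<Rightarrow> 'a"
  assumes S: "S \<in> lmeasurable" and L: "L > 0"
    and lip: "\<And>x y. x \<in> S \<Longrightarrow> y \<in> S \<Longrightarrow> dist (f x) (f y) \<le> L * dist x y"
    and fS: "f ` S \<in> lmeasurable"
  shows "measure lebesgue (f ` S) \<le> L ^ DIM('a) * measure lebesgue S"
proof (rule field_le_epsilon)
  fix e :: real assume "e > 0"
  define e' where "e' = e / L ^ DIM('a)"
  have e': "e' > 0" using L \<open>e > 0\<close> by (simp add: e'_def)
  obtain T where T: "open T" "S \<subseteq> T" "T - S \<in> lmeasurable" "emeasure lebesgue (T - S) < ennreal e'"
    using sets_lebesgue_outer_open[of S e'] S e' by auto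
  have TL: "T \<in> lmeasurable"
    using fmeasurable.Un[OF S T(3)] T(2) by (simp add: Un_absorb1)
  have mT: "measure lebesgue T \<le> measure lebesgue S + e'"
  proof -
    have "measure lebesgue T = measure lebesgue S + measure lebesgue (T - S)"
      using measure_Un2[of S lebesgue T] S TL T(2) by (simp add: Un_absorb1)
    moreover have "measure lebesgue (T - S) \<le> e'"
      using T(3,4) e' by (simp add: emeasure_eq_measure2 ennreal_less_iff)
    ultimately show ?thesis by simp
  qed
  define I where "I = {(x, r). x \<in> S \<and> r > 0 \<and> ball x r \<subseteq> T}"
  have "\<exists>i. i \<in> I \<and> x \<in> ball (fst i) (snd i) \<and> snd i < d" if x: "x \<in> S" "0 < d" for x d
  proof -
    obtain k where k: "k > 0" "ball x k \<subseteq> T" using T x by (meson openE subsetD)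
    have "ball x (min k (d/2)) \<subseteq> T" using k by auto
    then show ?thesis using k x
      by (intro exI[of _ "(x, min k (d/2))"]) (auto simp: I_def)
  qed
  then obtain C where C: "countable C" "C \<subseteq> I"
     "pairwise (\<lambda>i j. disjnt (ball (fst i) (snd i)) (ball (fst j) (snd j))) C"
     "negligible (S - (\<Union>i \<in> C. ball (fst i) (snd i)))"
    using Vitali_covering_theorem_balls[of S I fst snd] by blast
  define n where "n = to_nat_on C"
  define m where "m = from_nat_into C"
  define P where "P = n ` C"
  have inj: "inj_on n C" using C(1) by (simp add: n_def inj_on_to_nat_on)
  have mn: "m (n c) = c" if "c \<in> C" for c using that C(1) by (simp add: m_def n_def)
  define D where "D k = (if k \<in> P then ball (fst (m k)) (snd (m k)) else {})" for k
  define E where "E k = (if k \<in> P then cball (f (fst (m k))) (L * snd (m k)) else {})" for k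
  let ?R = "S - (\<Union>i \<in> C. ball (fst i) (snd i))"
  have neg: "negligible (f ` ?R)"
    by (rule negligible_locally_Lipschitz_image[OF order_refl C(4)])
       (use lip in \<open>force simp: dist_norm intro!: exI[of _ UNIV] exI[of _ L]\<close>)
  have sub: "f ` S \<subseteq> f ` ?R \<union> (\<Union>k. E k)"
  proof
    fix y assume "y \<in> f ` S"
    then obtain x where x: "x \<in> S" "y = f x" by auto
    show "y \<in> f ` ?R \<union> (\<Union>k. E k)"
    proof (cases "x \<in> ?R")
      case False
      then obtain c where c: "c \<in> C" "x \<in> ball (fst c) (snd c)" using x by auto
      have "fst c \<in> S" using c C(2) by (auto simp: I_def)
      then have "dist (f (fst c)) y \<le> L * dist (fst c) x" using x lip by auto
      also have "\<dots> \<le> L * snd c" using c L by (intro mult_left_mono) auto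
      finally have "y \<in> E (n c)" using c by (auto simp: E_def P_def mn)
      then show ?thesis by auto
    qed (use x in auto)
  qed
  have Em: "emeasure lebesgue (E k) = ennreal (L ^ DIM('a)) * emeasure lebesgue (D k)" for k
  proof (cases "k \<in> P")
    case True
    then have pos: "snd (m k) > 0" using C(2) by (auto simp: P_def mn I_def)
    have "emeasure lebesgue (E k) = emeasure lebesgue (ball (f (fst (m k))) (L * snd (m k)))"
      using True by (simp add: E_def emeasure_eq_measure2 content_cball_conv_ball)
    then show ?thesis using True pos L
      by (simp add: D_def emeasure_eq_measure2 content_ball_conv_unit_ball[of "L * snd (m k)"]
          content_ball_conv_unit_ball[of "snd (m k)"] power_mult_distrib ennreal_mult[symmetric]
          mult.assoc)
  qed (auto simp: D_def E_def)
  have disj: "disjoint_family D"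
    unfolding disjoint_family_on_def
  proof (intro ballI impI)
    fix j k :: nat assume jk: "j \<noteq> k"
    show "D j \<inter> D k = {}"
    proof (cases "j \<in> P \<and> k \<in> P")
      case True
      then obtain a b where ab: "a \<in> C" "b \<in> C" "j = n a" "k = n b" by (auto simp: P_def)
      then have "a \<noteq> b" using jk by auto
      then have "disjnt (ball (fst a) (snd a)) (ball (fst b) (snd b))"
        using C(3) ab unfolding pairwise_def by auto
      then show ?thesis using ab by (auto simp: D_def mn disjnt_def)
    qed (auto simp: D_def)
  qed
  have "D k \<subseteq> T" for k
  proof (cases "k \<in> P")
    case True
    then obtain c where c: "c \<in> C" "k = n c" by (auto simp: P_def)
    then have "c \<in> I" using C(2) by blast
    then have "ball (fst c) (snd c) \<subseteq> T" by (simp add: I_def case_prod_unfold)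
    then show ?thesis using True by (simp add: D_def c mn)
  qed (simp add: D_def)
  then have DT: "(\<Union>k. D k) \<subseteq> T" by blast
  have "emeasure lebesgue (f ` S) \<le> emeasure lebesgue (f ` ?R \<union> (\<Union>k. E k))"
    using sub neg by (intro emeasure_mono) (auto simp: E_def negligible_imp_sets)
  also have "\<dots> \<le> emeasure lebesgue (f ` ?R) + emeasure lebesgue (\<Union>k. E k)"
    using neg by (intro emeasure_subadditive) (auto simp: E_def negligible_imp_sets)
  also have "emeasure lebesgue (f ` ?R) = 0"
    using neg by (simp add: negligible_iff_null_sets null_setsD1)
  also have "0 + emeasure lebesgue (\<Union>k. E k) \<le> (\<Sum>k. emeasure lebesgue (E k))"
    by (simp, intro emeasure_subadditive_countably) (auto simp: E_def)
  also have "\<dots> = ennreal (L ^ DIM('a)) * (\<Sum>k. emeasure lebesgue (D k))"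
    by (simp add: Em)
  also have "(\<Sum>k. emeasure lebesgue (D k)) = emeasure lebesgue (\<Union>k. D k)"
    by (rule suminf_emeasure[OF _ disj]) (auto simp: D_def)
  also have "\<dots> \<le> emeasure lebesgue T"
    using DT TL by (intro emeasure_mono) auto
  finally have "ennreal (measure lebesgue (f ` S)) \<le> ennreal (L ^ DIM('a) * measure lebesgue T)"
    using L TL fS by (simp add: emeasure_eq_measure2 ennreal_mult mult_left_mono)
  then have "measure lebesgue (f ` S) \<le> L ^ DIM('a) * measure lebesgue T"
    using L by (subst (asm) ennreal_le_iff) auto
  also have "\<dots> \<le> L ^ DIM('a) * (measure lebesgue S + e')"
    using mT L by (intro mult_left_mono) auto
  also have "\<dots> = L ^ DIM('a) * measure lebesgue S + e"
    using L by (simp add: e'_def field_simps)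
  finally show "measure lebesgue (f ` S) \<le> L ^ DIM('a) * measure lebesgue S + e" .
qed


text \<open>The ratio is only positive so that compositions along words, the identity for the empty word among them, are
covered.\<close>

definition similarity :: "('a::metric_space \<Rightarrow> 'b::metric_space) \<Rightarrow> real \<Rightarrow> bool" where
  "similarity f c \<longleftrightarrow> 0 < c \<and> (\<forall>x y. dist (f x) (f y) = c * dist x y)"

lemma similarity_inj: "similarity f c \<Longrightarrow> inj f"
  unfolding similarity_def inj_def by (metis dist_eq_0_iff mult_eq_0_iff less_irrefl)

lemma similarity_continuous: "similarity f c \<Longrightarrow> continuous_on S f"
  unfolding similarity_def
  by (intro lipschitz_on_continuous_on[of c] lipschitz_onI) auto

lemma similarity_comp: "similarity f c \<Longrightarrow> similarity g d \<Longrightarrow> similarity (f \<circ> g) (c * d)"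
  unfolding similarity_def by auto

text \<open>After translation and rescaling \<open>f\<close> becomes an isometry fixing the origin, hence an orthogonal map.\<close>

lemma similarity_surj:
  fixes f :: "'a::euclidean_space \<Rightarrow> 'a"
  assumes f: "similarity f c"
  shows "surj f"
proof -
  have c: "c > 0" using f by (simp add: similarity_def)
  define T where "T x = (f x - f 0) /\<^sub>R c" for x
  have "dist (T x) (T y) = dist x y" for x y
  proof -
    have "T x - T y = (f x - f y) /\<^sub>R c" by (simp add: T_def algebra_simps)
    then show ?thesis using f c by (simp add: dist_norm similarity_def)
  qed
  then have "orthogonal_transformation T"
    by (auto simp: orthogonal_transformation_isometry T_def)
  then have sT: "surj T" by (rule orthogonal_transformation_surj)
  show ?thesis
  proof (rule surjI)
    fix y
    show "f (SOME x. T x = (y - f 0) /\<^sub>R c) = y"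
    proof (rule someI2_ex)
      show "\<exists>x. T x = (y - f 0) /\<^sub>R c" using sT by (metis surjD)
    next
      fix x assume "T x = (y - f 0) /\<^sub>R c"
      then show "f x = y" using c by (simp add: T_def)
    qed
  qed
qed

lemma measure_similarity_image:
  fixes f :: "'a::euclidean_space \<Rightarrow> 'a"
  assumes f: "similarity f c" and S: "compact S"
  shows "measure lebesgue (f ` S) = c ^ DIM('a) * measure lebesgue S"
proof (rule antisym)
  have c: "c > 0" and d: "\<And>x y. dist (f x) (f y) = c * dist x y"
    using f by (auto simp: similarity_def)
  have fS: "compact (f ` S)" using S f by (intro compact_continuous_image similarity_continuous)
  show "measure lebesgue (f ` S) \<le> c ^ DIM('a) * measure lebesgue S"
    by (rule measure_Lipschitz_image_le) (use c d S fS lmeasurable_compact in auto)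
  have im: "inv f ` f ` S = S" using similarity_inj[OF f] by (simp add: image_inv_f_f)
  have "measure lebesgue (inv f ` f ` S) \<le> (1 / c) ^ DIM('a) * measure lebesgue (f ` S)"
    by (rule measure_Lipschitz_image_le)
       (use c d S fS lmeasurable_compact similarity_inj[OF f] in \<open>auto simp: im\<close>)
  then show "c ^ DIM('a) * measure lebesgue S \<le> measure lebesgue (f ` S)"
    using c by (simp add: im power_one_over field_simps)
qed

lemma mem_parallel_nbhd:
  fixes Y :: "'a::heine_borel set"
  assumes "compact Y" "Y \<noteq> {}"
  shows "x \<in> parallel_nbhd Y e \<longleftrightarrow> (\<exists>y\<in>Y. dist x y \<le> e)"
proof
  assume "x \<in> parallel_nbhd Y e"
  moreover obtain y where "y \<in> Y" "infdist x Y = dist x y"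
    using infdist_attains_inf[of Y x] assms compact_imp_closed by blast
  ultimately show "\<exists>y\<in>Y. dist x y \<le> e" by (auto simp: parallel_nbhd_def)
next
  assume "\<exists>y\<in>Y. dist x y \<le> e"
  then show "x \<in> parallel_nbhd Y e"
    unfolding parallel_nbhd_def using infdist_le2 by auto
qed

lemma compact_parallel_nbhd:
  fixes Y :: "'a::heine_borel set"
  shows "compact Y \<Longrightarrow> Y \<noteq> {} \<Longrightarrow> e > 0 \<Longrightarrow> compact (parallel_nbhd Y e)"
  unfolding parallel_nbhd_def by (rule compact_infdist_le)

lemma parallel_nbhd_mono: "a \<le> b \<Longrightarrow> parallel_nbhd Y a \<subseteq> parallel_nbhd Y b"
  by (auto simp: parallel_nbhd_def)

lemma parallel_volume_nonneg: "0 \<le> parallel_volume Y e"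
  by (simp add: parallel_volume_def)

lemma parallel_volume_mono:
  assumes "compact Y" "Y \<noteq> {}" "0 < a" "a \<le> b"
  shows "parallel_volume Y a \<le> parallel_volume Y b"
  unfolding parallel_volume_def
  using assms by (intro measure_mono_fmeasurable parallel_nbhd_mono)
    (auto intro!: compact_parallel_nbhd lmeasurable_compact fmeasurableD)

lemma parallel_volume_pos:
  assumes "compact Y" "Y \<noteq> {}" "0 < a"
  shows "0 < parallel_volume Y a"
proof -
  obtain y where y: "y \<in> Y" using assms by auto
  have "0 < measure lebesgue (cball y a)" using content_cball_pos[OF assms(3), of y] by simp
  also have "\<dots> \<le> parallel_volume Y a"
    unfolding parallel_volume_def using y
    by (intro measure_mono_fmeasurable)
       (auto simp: mem_parallel_nbhd[OF assms(1,2)] dist_commute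
             intro!: compact_parallel_nbhd lmeasurable_compact assms)
  finally show ?thesis .
qed

text \<open>Surjectivity of \<open>f\<close> is what makes the parallel set of the image the whole image of a parallel set.\<close>

lemma parallel_volume_similarity:
  fixes f :: "real^'d \<Rightarrow> real^'d"
  assumes f: "similarity f c" and K: "compact K" "K \<noteq> {}" and e: "e > 0"
  shows "parallel_volume (f ` K) e = c ^ CARD('d) * parallel_volume K (e / c)"
proof -
  have c: "c > 0" and d: "\<And>x y. dist (f x) (f y) = c * dist x y"
    using f by (auto simp: similarity_def)
  have fK: "compact (f ` K)" "f ` K \<noteq> {}"
    using K f by (auto intro: compact_continuous_image similarity_continuous)
  have "parallel_nbhd (f ` K) e = f ` parallel_nbhd K (e / c)"
  proof (intro set_eqI iffI)
    fix y assume "y \<in> parallel_nbhd (f ` K) e"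
    then obtain k where k: "k \<in> K" "dist y (f k) \<le> e" unfolding mem_parallel_nbhd[OF fK] by blast
    obtain x where x: "y = f x" using similarity_surj[OF f] by (metis surjD)
    have "dist x k \<le> e / c" using k c x d by (simp add: field_simps)
    then show "y \<in> f ` parallel_nbhd K (e / c)" using x k mem_parallel_nbhd[OF K] by blast
  next
    fix y assume "y \<in> f ` parallel_nbhd K (e / c)"
    then obtain x k where "y = f x" "k \<in> K" "dist x k \<le> e / c" using mem_parallel_nbhd[OF K] by blast
    then show "y \<in> parallel_nbhd (f ` K) e"
      using c d by (auto simp: mem_parallel_nbhd[OF fK] field_simps)
  qed
  then show ?thesis
    using measure_similarity_image[OF f compact_parallel_nbhd[OF K, of "e / c"]] c e
    by (simp add: parallel_volume_def)
qed

lemma compact_family_separated: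
  fixes A :: "'i \<Rightarrow> 'a::heine_borel set"
  assumes I: "finite I" and A: "\<And>i. i \<in> I \<Longrightarrow> compact (A i)"
    and disj: "disjoint_family_on A I"
  obtains d where "d > 0"
    "\<And>i j x y. i \<in> I \<Longrightarrow> j \<in> I \<Longrightarrow> i \<noteq> j \<Longrightarrow> x \<in> A i \<Longrightarrow> y \<in> A j \<Longrightarrow> d \<le> dist x y"
proof -
  have "\<exists>d>0. \<forall>x\<in>A i. \<forall>y\<in>A j. d \<le> dist x y" if "i \<in> I" "j \<in> I" "i \<noteq> j" for i j
    using separate_compact_closed[of "A i" "A j"] A that disj compact_imp_closed
    unfolding disjoint_family_on_def by blast
  then obtain D where D: "\<And>i j. i \<in> I \<Longrightarrow> j \<in> I \<Longrightarrow> i \<noteq> j \<Longrightarrow> D i j > 0 \<and> (\<forall>x\<in>A i. \<forall>y\<in>A j. D i j \<le> dist x y)"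
    by metis
  define P where "P = {(i, j). i \<in> I \<and> j \<in> I \<and> i \<noteq> j}"
  have fP: "finite P" by (rule finite_subset[of _ "I \<times> I"]) (use I in \<open>auto simp: P_def\<close>)
  define d where "d = Min (insert 1 ((\<lambda>(i, j). D i j) ` P))"
  have "d > 0" unfolding d_def using fP D by (subst Min_gr_iff) (auto simp: P_def)
  moreover have "d \<le> dist x y" if "i \<in> I" "j \<in> I" "i \<noteq> j" "x \<in> A i" "y \<in> A j" for i j x y
  proof -
    have "d \<le> D i j" unfolding d_def using fP that by (intro Min_le) (auto simp: P_def)
    then show ?thesis using D[of i j] that by fastforce
  qed
  ultimately show ?thesis using that by blast
qed

lemma parallel_volume_disjoint_UN:
  fixes A :: "'i \<Rightarrow> (real^'d) set"
  assumes I: "finite I" "I \<noteq> {}" and A: "\<And>i. i \<in> I \<Longrightarrow> compact (A i)" "\<And>i. i \<in> I \<Longrightarrow> A i \<noteq> {}"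
    and disj: "disjoint_family_on A I"
  obtains e0 where "e0 > 0"
    "\<And>e. 0 < e \<Longrightarrow> e \<le> e0 \<Longrightarrow> parallel_volume (\<Union>i\<in>I. A i) e = (\<Sum>i\<in>I. parallel_volume (A i) e)"
proof -
  obtain d where d: "d > 0"
    "\<And>i j x y. i \<in> I \<Longrightarrow> j \<in> I \<Longrightarrow> i \<noteq> j \<Longrightarrow> x \<in> A i \<Longrightarrow> y \<in> A j \<Longrightarrow> d \<le> dist x y"
    using compact_family_separated[OF I(1) A(1) disj] by blast
  have "parallel_volume (\<Union>i\<in>I. A i) e = (\<Sum>i\<in>I. parallel_volume (A i) e)" if e: "0 < e" "e \<le> d / 3" for e
  proof -
    have U: "compact (\<Union>i\<in>I. A i)" "(\<Union>i\<in>I. A i) \<noteq> {}" using I A by (auto intro: compact_UN)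
    have "parallel_nbhd (\<Union>i\<in>I. A i) e = (\<Union>i\<in>I. parallel_nbhd (A i) e)"
    proof (intro set_eqI)
      fix x
      have "x \<in> parallel_nbhd (A i) e \<longleftrightarrow> (\<exists>y\<in>A i. dist x y \<le> e)" if "i \<in> I" for i
        using A that by (intro mem_parallel_nbhd)
      then show "x \<in> parallel_nbhd (\<Union>i\<in>I. A i) e \<longleftrightarrow> x \<in> (\<Union>i\<in>I. parallel_nbhd (A i) e)"
        unfolding mem_parallel_nbhd[OF U] by blast
    qed
    moreover have "disjoint_family_on (\<lambda>i. parallel_nbhd (A i) e) I"
      unfolding disjoint_family_on_def
    proof (intro ballI impI equals0I)
      fix i j x assume ij: "i \<in> I" "j \<in> I" "i \<noteq> j" and "x \<in> parallel_nbhd (A i) e \<inter> parallel_nbhd (A j) e"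
      then obtain y z where yz: "y \<in> A i" "z \<in> A j" "dist x y \<le> e" "dist x z \<le> e"
        using A by (auto simp: mem_parallel_nbhd)
      have "dist y z \<le> 2 * e" using yz dist_triangle3[of y z x] by linarith
      then show False using d(1) d(2)[OF ij yz(1,2)] e by linarith
    qed
    moreover have "parallel_nbhd (A i) e \<in> lmeasurable" if "i \<in> I" for i
      using A that e by (intro lmeasurable_compact compact_parallel_nbhd) auto
    ultimately show ?thesis
      unfolding parallel_volume_def using I fmeasurableD2[of "parallel_nbhd (A _) e" lebesgue]
      by (simp only:, intro measure_finite_Union) (auto dest: fmeasurableD simp del: emeasure_completion)
  qed
  then show ?thesis using that[of "d / 3"] d by auto
qed

section \<open>Renewal equations on the multiplicative half-line\<close>

lemma tendsto_inverse_abs_ln: "((\<lambda>T::real. inverse \<bar>ln T\<bar>) \<longlongrightarrow> 0) (at_right 0)"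
proof (rule tendsto_inverse_0_at_top)
  have "LIM T at_right (0::real). - ln T :> at_top"
    by (rule filterlim_compose[OF filterlim_uminus_at_top_at_bot ln_at_0])
  then show "LIM T at_right (0::real). \<bar>ln T\<bar> :> at_top"
    by (rule filterlim_at_top_mono) (auto intro!: eventuallyI)
qed

text \<open>The renewal equation is studied in the variable \<open>\<epsilon>\<close> on \<open>(0, \<infinity>)\<close>; in the time variable
\<open>t = - ln \<epsilon>\<close> it is the usual one, with waiting times \<open>- ln r\<^sub>i\<close> of probabilities \<open>p\<^sub>i\<close> and mean \<open>mean\<close>.\<close>

locale renewal_weights =
  fixes I :: "'i set" and r p :: "'i \<Rightarrow> real"
  assumes fin: "finite I"
    and r_pos: "\<And>i. i \<in> I \<Longrightarrow> 0 < r i" and r_less: "\<And>i. i \<in> I \<Longrightarrow> r i < 1"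
    and p_pos: "\<And>i. i \<in> I \<Longrightarrow> 0 < p i" and p_sum: "(\<Sum>i\<in>I. p i) = 1"
begin

definition rmin where "rmin = Min (r ` I)"

definition rmax where "rmax = Max (r ` I)"

definition mean where "mean = (\<Sum>i\<in>I. p i * - ln (r i))"

lemma nonempty: "I \<noteq> {}"
  using p_sum by auto

lemma rmin_pos: "0 < rmin" and rmax_less: "rmax < 1"
  and rmin_le: "i \<in> I \<Longrightarrow> rmin \<le> r i" and le_rmax: "i \<in> I \<Longrightarrow> r i \<le> rmax"
  using fin nonempty r_pos r_less by (auto simp: rmin_def rmax_def)

lemma rmax_pos: "0 < rmax"
  using nonempty r_pos le_rmax by (metis all_not_in_conv less_le_trans)

lemma rmin_less: "rmin < 1"
  using nonempty r_less rmin_le by (metis all_not_in_conv le_less_trans)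

lemma mean_pos: "0 < mean"
  unfolding mean_def using fin nonempty r_pos r_less p_pos
  by (intro sum_pos) (auto intro!: mult_pos_neg)

text \<open>\<open>H e\<close> is a convex combination of values of \<open>H\<close> at larger arguments. The factors \<open>1 / r\<^sub>i\<close> are
at most \<open>1 / rmin\<close>, so from below the threshold one can never jump over the interval on which the
bound is assumed; and each step moves up by at least the factor \<open>1 / rmax\<close>.\<close>

lemma renewal_lower_bound:
  assumes e1: "0 < e1"
    and rec: "\<And>e. 0 < e \<Longrightarrow> e \<le> e1 \<Longrightarrow> H e = (\<Sum>i\<in>I. p i * H (e / r i))"
    and base: "\<And>e. e1 < e \<Longrightarrow> e \<le> e1 / rmin \<Longrightarrow> m \<le> H e"
    and e: "0 < e" "e \<le> e1 / rmin"
  shows "m \<le> H e"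
proof -
  have *: "m \<le> H e" if "e1 * rmax ^ n < e" "e \<le> e1 / rmin" for n e
    using that
  proof (induction n arbitrary: e)
    case 0
    then show ?case using base by simp
  next
    case (Suc n)
    show ?case
    proof (cases "e1 < e")
      case False
      have e0: "0 < e" using Suc.prems e1 rmax_pos by (smt (verit) mult_pos_pos zero_less_power)
      have "m \<le> H (e / r i)" if i: "i \<in> I" for i
      proof (rule Suc.IH)
        have "e1 * rmax ^ n * r i \<le> e1 * rmax ^ n * rmax"
          using e1 rmax_pos le_rmax[OF i] by (intro mult_left_mono) auto
        also have "\<dots> < e" using Suc.prems by (simp add: mult_ac)
        finally show "e1 * rmax ^ n < e / r i" using r_pos[OF i] by (simp add: field_simps)
        show "e / r i \<le> e1 / rmin"
          using False e0 e1 rmin_pos rmin_le[OF i] by (intro frac_le) auto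
      qed
      then have "(\<Sum>i\<in>I. p i * m) \<le> (\<Sum>i\<in>I. p i * H (e / r i))"
        using p_pos by (intro sum_mono mult_left_mono) (auto intro: less_imp_le)
      then show ?thesis
        using rec[of e] False e0 p_sum by (simp add: sum_distrib_right[symmetric])
    qed (use Suc.prems base in auto)
  qed
  obtain n where "rmax ^ n < e / e1"
    using real_arch_pow_inv[of "e / e1" rmax] rmax_less e e1 by auto
  then show ?thesis using *[of n e] e e1 by (simp add: field_simps)
qed

lemma renewal_upper_bound:
  assumes e1: "0 < e1"
    and rec: "\<And>e. 0 < e \<Longrightarrow> e \<le> e1 \<Longrightarrow> H e = (\<Sum>i\<in>I. p i * H (e / r i))"
    and base: "\<And>e. e1 < e \<Longrightarrow> e \<le> e1 / rmin \<Longrightarrow> H e \<le> m"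
    and e: "0 < e" "e \<le> e1 / rmin"
  shows "H e \<le> m"
  using renewal_lower_bound[OF e1, of "\<lambda>x. - H x" "- m" e] rec base e
  by (auto simp: sum_negf)

text \<open>\<open>(C / mean) * ln T\<close> solves the inhomogeneous equation with constant \<open>- C\<close>, because \<open>mean\<close> is the mean
of \<open>- ln r\<^sub>i\<close>. Adding it to \<open>J\<close> leaves a solution of the homogeneous equation, which is bounded.\<close>

lemma renewal_average_limit:
  assumes e1: "0 < e1"
    and rec: "\<And>T. 0 < T \<Longrightarrow> T \<le> e1 \<Longrightarrow> J T = (\<Sum>i\<in>I. p i * J (T / r i)) + C"
    and bnd: "\<And>T. e1 < T \<Longrightarrow> T \<le> e1 / rmin \<Longrightarrow> \<bar>J T\<bar> \<le> B"
  shows "((\<lambda>T. inverse \<bar>ln T\<bar> * J T) \<longlongrightarrow> C / mean) (at_right 0)"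
proof -
  define G where "G T = J T + (C / mean) * ln T" for T
  have recG: "G T = (\<Sum>i\<in>I. p i * G (T / r i))" if T: "0 < T" "T \<le> e1" for T
  proof -
    have "(\<Sum>i\<in>I. p i * G (T / r i))
        = (\<Sum>i\<in>I. p i * J (T / r i) + (C / mean) * (p i * ln T) + (C / mean) * (p i * - ln (r i)))"
      using T r_pos
      by (intro sum.cong refl) (simp add: G_def ln_divide_pos right_diff_distrib distrib_left diff_divide_distrib mult_ac)
    also have "\<dots> = (\<Sum>i\<in>I. p i * J (T / r i)) + (C / mean) * ((\<Sum>i\<in>I. p i) * ln T) + (C / mean) * mean"
      unfolding mean_def by (simp only: sum.distrib sum_distrib_left sum_distrib_right)
    also have "\<dots> = G T" using rec[OF T] mean_pos by (simp add: G_def p_sum)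
    finally show ?thesis by simp
  qed
  \<comment> \<open>A bound for the homogeneous solution \<open>G\<close> on the initial period.\<close>
  define B' where "B' = B + \<bar>C / mean\<bar> * (\<bar>ln e1\<bar> + \<bar>ln (e1 / rmin)\<bar>)"
  have base: "\<bar>G T\<bar> \<le> B'" if T: "e1 < T" "T \<le> e1 / rmin" for T
  proof -
    have "ln e1 \<le> ln T" "ln T \<le> ln (e1 / rmin)" using T e1 rmin_pos by (simp_all del: ln_div)
    then have "\<bar>ln T\<bar> \<le> \<bar>ln e1\<bar> + \<bar>ln (e1 / rmin)\<bar>" by linarith
    then have "\<bar>C / mean * ln T\<bar> \<le> \<bar>C / mean\<bar> * (\<bar>ln e1\<bar> + \<bar>ln (e1 / rmin)\<bar>)"
      unfolding abs_mult by (intro mult_left_mono) auto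
    then show ?thesis using bnd[OF T] unfolding G_def B'_def by linarith
  qed
  have G: "\<bar>G T\<bar> \<le> B'" if T: "0 < T" "T \<le> e1" for T
  proof -
    have T': "T \<le> e1 / rmin" using T e1 rmin_pos rmin_less
      by (smt (verit) divide_le_eq_1_pos le_divide_eq mult_left_le_one_le mult.commute)
    have "- B' \<le> G x" "G x \<le> B'" if "e1 < x" "x \<le> e1 / rmin" for x
      using base[OF that] by linarith+
    then show ?thesis
      using renewal_lower_bound[OF e1 recG _ T(1) T', of "- B'"]
            renewal_upper_bound[OF e1 recG _ T(1) T', of B'] by force
  qed
  have inv: "((\<lambda>T::real. B' * inverse \<bar>ln T\<bar>) \<longlongrightarrow> 0) (at_right 0)"
    by (rule tendsto_mult_right_zero[OF tendsto_inverse_abs_ln])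
  have "((\<lambda>T. inverse \<bar>ln T\<bar> * G T) \<longlongrightarrow> 0) (at_right 0)"
  proof (rule Lim_null_comparison[OF _ inv])
    show "\<forall>\<^sub>F T in at_right 0. norm (inverse \<bar>ln T\<bar> * G T) \<le> B' * inverse \<bar>ln T\<bar>"
      using eventually_at_right_less[of 0] eventually_at_right_real[OF e1]
      by eventually_elim (use G in \<open>auto simp: abs_mult mult.commute[of _ "inverse _"] intro!: mult_left_mono\<close>)
  qed
  then have "((\<lambda>T. inverse \<bar>ln T\<bar> * G T + C / mean) \<longlongrightarrow> 0 + C / mean) (at_right 0)"
    by (intro tendsto_add tendsto_const)
  moreover have "\<forall>\<^sub>F T in at_right 0. inverse \<bar>ln T\<bar> * G T + C / mean = inverse \<bar>ln T\<bar> * J T"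
    using eventually_at_right_real[OF zero_less_one]
    by eventually_elim (auto simp: G_def field_simps abs_if)
  ultimately show ?thesis by (simp add: tendsto_cong)
qed

text \<open>The possible renewal times, that is, the additive semigroup generated by the waiting times.\<close>

inductive_set epochs :: "real set" where
  zero: "0 \<in> epochs"
| step: "s \<in> epochs \<Longrightarrow> i \<in> I \<Longrightarrow> - ln (r i) + s \<in> epochs"

lemma epochs_add: "s \<in> epochs \<Longrightarrow> t \<in> epochs \<Longrightarrow> s + t \<in> epochs"
  by (induction rule: epochs.induct) (auto simp only: add.assoc add_0 intro: epochs.step)

lemma epochs_mult: "s \<in> epochs \<Longrightarrow> of_nat n * s \<in> epochs"
  by (induction n) (auto simp: algebra_simps intro: epochs.zero epochs_add)

text \<open>Otherwise the group of differences of renewal times would have no elements in \<open>(0, \<zeta>)\<close>. It would then have a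
least positive element \<open>g\<close>, and division with remainder would make every \<open>ln r\<^sub>i\<close> a multiple of \<open>g\<close>.\<close>

lemma close_epochs:
  assumes nonlat: "\<nexists>a. a > 0 \<and> (\<forall>i\<in>I. \<exists>k::int. ln (r i) = a * of_int k)" and z: "\<zeta> > 0"
  obtains x y where "x \<in> epochs" "y \<in> epochs" "0 < y - x" "y - x < \<zeta>"
proof (rule ccontr)
  note * = that
  assume "\<not> thesis"
  then have no: "\<not> (0 < y - x \<and> y - x < \<zeta>)" if "x \<in> epochs" "y \<in> epochs" for x y
    using that \<open>\<not> thesis\<close> * by blast
  define G where "G = {y - x | x y. x \<in> epochs \<and> y \<in> epochs}"
  have G_diff: "g - h \<in> G" if gh: "g \<in> G" "h \<in> G" for g h
  proof -
    obtain x y x' y' where *: "g = y - x" "h = y' - x'" "x \<in> epochs" "y \<in> epochs" "x' \<in> epochs" "y' \<in> epochs"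
      using gh unfolding G_def mem_Collect_eq by metis
    then have "g - h = (y + x') - (x + y')" "y + x' \<in> epochs" "x + y' \<in> epochs"
      by (auto intro: epochs_add)
    then show ?thesis unfolding G_def by blast
  qed
  have G0: "0 \<in> G" unfolding G_def using epochs.zero by force
  have G_neg: "- g \<in> G" if "g \<in> G" for g using G_diff[OF G0 that] by simp
  have G_add: "g + h \<in> G" if "g \<in> G" "h \<in> G" for g h using G_diff[OF that(1) G_neg[OF that(2)]] by simp
  have G_nat: "of_nat n * g \<in> G" if "g \<in> G" for g n
    using that by (induction n) (auto simp: algebra_simps G0 intro: G_add)
  have G_int: "of_int k * g \<in> G" if "g \<in> G" for g k
    using G_nat[OF that, of "nat k"] G_neg[OF G_nat[OF that, of "nat (- k)"]] by (cases "k \<ge> 0") auto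
  have G_log: "- ln (r i) \<in> G" if "i \<in> I" for i
    unfolding G_def using epochs.step[OF epochs.zero that] epochs.zero by force
  have gap: "\<not> (0 < g \<and> g < \<zeta>)" if "g \<in> G" for g using that no by (auto simp: G_def)
  define P where "P = {g \<in> G. 0 < g}"
  have "P \<noteq> {}" using nonempty G_log r_pos r_less by (fastforce simp: P_def)
  moreover have bd: "bdd_below P" by (rule bdd_belowI[of _ 0]) (auto simp: P_def)
  ultimately obtain g where g: "g \<in> P" "g < Inf P + \<zeta>"
    using cInf_lessD[of P "Inf P + \<zeta>"] z by auto
  have least: "g \<le> h" if "h \<in> P" for h
  proof (rule ccontr)
    assume "\<not> g \<le> h"
    then have "0 < g - h" by simp
    moreover have "g - h < \<zeta>" using cInf_lower[OF that bd] g by linarith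
    ultimately show False using gap[OF G_diff[of g h]] g that by (auto simp: P_def)
  qed
  have g0: "g > 0" "g \<in> G" using g by (auto simp: P_def)
  have "\<exists>k::int. ln (r i) = g * of_int k" if i: "i \<in> I" for i
  proof -
    define k where "k = \<lfloor>ln (r i) / g\<rfloor>"
    have "ln (r i) - of_int k * g \<in> G"
      using G_diff[OF G_neg[OF G_log[OF i]] G_int[OF g0(2), of k]] by simp
    moreover have "0 \<le> ln (r i) - of_int k * g" "ln (r i) - of_int k * g < g"
      using g0 floor_divide_lower[of g "ln (r i)"] floor_divide_upper[of g "ln (r i)"]
      by (auto simp: k_def algebra_simps)
    ultimately have "ln (r i) - of_int k * g = 0"
      using least[of "ln (r i) - of_int k * g"] by (fastforce simp: P_def)
    then show ?thesis by (intro exI[of _ k]) (simp add: mult.commute)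
  qed
  then show False using nonlat g0 by blast
qed

text \<open>Let \<open>L\<close> be the upper limit of \<open>H\<close> at \<open>0\<close>. If \<open>H e\<close> is close to \<open>L\<close>, then so is every \<open>H (e / r\<^sub>i)\<close>,
since these values average to \<open>H e\<close> and none exceeds \<open>L\<close> by much. By iteration \<open>H\<close> is close to \<open>L\<close> at
\<open>e * exp t\<close> for any prescribed finite set of renewal times \<open>t\<close>. Two renewal times with a small difference
give such a set that is dense in an interval of length \<open>- ln rmin\<close>, and the one-sided
continuity of \<open>H\<close> in assumption \<open>slow\<close> fills the gaps. The lower bound thus found on a whole period persists at
all smaller scales.\<close>

lemma renewal_limit_exists:
  assumes nonlat: "\<nexists>a. a > 0 \<and> (\<forall>i\<in>I. \<exists>k::int. ln (r i) = a * of_int k)"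
    and e1: "0 < e1"
    and rec: "\<And>e. 0 < e \<Longrightarrow> e \<le> e1 \<Longrightarrow> H e = (\<Sum>i\<in>I. p i * H (e / r i))"
    and bnd: "\<And>e. 0 < e \<Longrightarrow> e \<le> e1 \<Longrightarrow> H e \<le> B"
    and nonneg: "\<And>e. 0 < e \<Longrightarrow> 0 \<le> H e"
    and c: "0 \<le> c"
    and slow: "\<And>e e'. 0 < e' \<Longrightarrow> e' \<le> e \<Longrightarrow> H e' \<le> (e / e') powr c * H e"
  obtains L where "(H \<longlongrightarrow> L) (at_right 0)"
proof -
  define S where "S x = Sup (H ` {0<..x})" for x
  define L where "L = Inf (S ` {0<..e1})"
  have bdS: "bdd_above (H ` {0<..x})" if "x \<le> e1" for x
    by (rule bdd_aboveI[of _ B]) (use bnd that in auto)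
  have S_upper: "H e \<le> S x" if "0 < e" "e \<le> x" "x \<le> e1" for e x
    unfolding S_def using that bdS by (intro cSup_upper) auto
  have bdL: "bdd_below (S ` {0<..e1})"
  proof (rule bdd_belowI[of _ 0])
    fix s assume "s \<in> S ` {0<..e1}"
    then obtain x where "0 < x" "x \<le> e1" "s = S x" by auto
    then show "0 \<le> s" using S_upper[of x x] nonneg[of x] by auto
  qed
  have L_above: "\<exists>x>0. x \<le> e1 \<and> (\<forall>e. 0 < e \<and> e \<le> x \<longrightarrow> H e \<le> L + \<eta>)" if "\<eta> > 0" for \<eta>
  proof -
    have "\<exists>s \<in> S ` {0<..e1}. s < L + \<eta>"
      using cInf_lessD[of "S ` {0<..e1}" "L + \<eta>"] e1 that by (auto simp: L_def)
    then obtain x where "0 < x" "x \<le> e1" "S x < L + \<eta>" by auto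
    then show ?thesis using S_upper by (intro exI[of _ x]) force
  qed
  have L_below: "\<exists>e>0. e \<le> x \<and> H e > L - \<eta>" if "\<eta> > 0" "x > 0" for \<eta> x
  proof -
    define y where "y = min x e1"
    have y: "0 < y" "y \<le> e1" "y \<le> x" using that e1 by (auto simp: y_def)
    have "L \<le> S y" unfolding L_def by (rule cInf_lower[OF _ bdL]) (use y in auto)
    then have "L - \<eta> < Sup (H ` {0<..y})" using that by (simp add: S_def)
    then obtain h where "h \<in> H ` {0<..y}" "L - \<eta> < h" using less_cSupE[of _ "H ` {0<..y}"] y by auto
    then show ?thesis using y by force
  qed
  have L0: "0 \<le> L"
  proof (rule ccontr)
    assume "\<not> 0 \<le> L"
    then obtain x where "x > 0" "\<forall>e. 0 < e \<and> e \<le> x \<longrightarrow> H e \<le> L + (- L / 2)"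
      using L_above[of "- L / 2"] by auto
    then have "H x \<le> L / 2" by auto
    then show False using nonneg[OF \<open>x > 0\<close>] \<open>\<not> 0 \<le> L\<close> by linarith
  qed
  have single: "\<exists>x>0. \<exists>\<eta>'>0. \<forall>e. 0 < e \<and> e \<le> x \<and> H e > L - \<eta>' \<longrightarrow> H (e * exp (- ln (r i))) > L - \<eta>"
    if i: "i \<in> I" and "\<eta> > 0" for i \<eta>
  proof -
    \<comment> \<open>The value at \<open>e / r\<^sub>i\<close> has weight \<open>p i\<close>, so a defect of \<open>H e\<close> is magnified by at most \<open>1 / p i\<close>; half of it is reserved for the excess of the other values over \<open>L\<close>.\<close>
    define \<eta>' where "\<eta>' = p i * \<eta> / 2"
    have \<eta>': "\<eta>' > 0" using p_pos[OF i] \<open>\<eta> > 0\<close> by (simp add: \<eta>'_def)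
    obtain x where x: "x > 0" "x \<le> e1" "\<And>e. 0 < e \<Longrightarrow> e \<le> x \<Longrightarrow> H e \<le> L + \<eta>'"
      using L_above[OF \<eta>'] by blast
    have "H (e * exp (- ln (r i))) > L - \<eta>" if e: "0 < e" "e \<le> x * rmin" "H e > L - \<eta>'" for e
    proof -
      have ee: "e \<le> e1" using e x rmin_less rmin_pos by (smt (verit) mult_left_le)
      have "e / r j \<le> x" if "j \<in> I" for j
      proof -
        have "x * rmin \<le> x * r j" using x rmin_le[OF that] by simp
        then show ?thesis using e r_pos[OF that] by (simp add: divide_le_eq)
      qed
      then have "p j * H (e / r j) \<le> p j * (L + \<eta>')" if "j \<in> I" for j
        using that x(3)[of "e / r j"] e r_pos p_pos by (intro mult_left_mono) (auto intro: less_imp_le)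
      then have "(\<Sum>j\<in>I - {i}. p j * H (e / r j)) \<le> (\<Sum>j\<in>I - {i}. p j * (L + \<eta>'))"
        by (intro sum_mono) auto
      also have "\<dots> = (1 - p i) * (L + \<eta>')"
        using p_sum sum.remove[OF fin i, of p] by (simp add: sum_distrib_right[symmetric])
      finally have "H e \<le> p i * H (e / r i) + (1 - p i) * (L + \<eta>')"
        using rec[OF e(1) ee] sum.remove[OF fin i, of "\<lambda>j. p j * H (e / r j)"] by simp
      then have "L - \<eta>' < p i * H (e / r i) + (1 - p i) * (L + \<eta>')" using e by linarith
      moreover have "p i * \<eta>' > 0" using p_pos[OF i] \<eta>' by simp
      ultimately have "p i * L - 2 * \<eta>' < p i * H (e / r i)" by (simp add: algebra_simps)
      then have "p i * (L - \<eta>) < p i * H (e / r i)" by (simp add: \<eta>'_def algebra_simps)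
      then have "L - \<eta> < H (e / r i)" using p_pos[OF i] by simp
      moreover have "e * exp (- ln (r i)) = e / r i"
        using r_pos[OF i] by (simp add: exp_minus divide_inverse)
      ultimately show ?thesis by simp
    qed
    then show ?thesis using x rmin_pos \<eta>' by (intro exI[of _ "x * rmin"] conjI exI[of _ \<eta>']) auto
  qed
  have chain: "\<exists>x>0. \<exists>\<eta>'>0. \<forall>e. 0 < e \<and> e \<le> x \<and> H e > L - \<eta>' \<longrightarrow> H (e * exp s) > L - \<eta>"
    if "s \<in> epochs" "\<eta> > 0" for s \<eta>
    using that
  proof (induction arbitrary: \<eta>)
    case zero
    then show ?case by (intro exI[of _ 1] conjI exI[of _ \<eta>]) auto
  next
    case (step s i)
    obtain x1 \<eta>1 where 1: "x1 > 0" "\<eta>1 > 0"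
      "\<And>e. 0 < e \<and> e \<le> x1 \<and> H e > L - \<eta>1 \<Longrightarrow> H (e * exp (- ln (r i))) > L - \<eta>"
      using single[OF step.hyps(2) step.prems] by blast
    obtain x2 \<eta>2 where 2: "x2 > 0" "\<eta>2 > 0"
      "\<And>e. 0 < e \<and> e \<le> x2 \<and> H e > L - \<eta>2 \<Longrightarrow> H (e * exp s) > L - \<eta>1"
      using step.IH[OF 1(2)] by blast
    have "H (e * exp (- ln (r i) + s)) > L - \<eta>" if "0 < e" "e \<le> min x2 (x1 * exp (- s))" "H e > L - \<eta>2" for e
    proof -
      have "e * exp s \<le> x1 * exp (- s) * exp s" using that by (intro mult_right_mono) auto
      then have "e * exp s \<le> x1" by (simp add: mult.assoc exp_minus)
      then have "H (e * exp s * exp (- ln (r i))) > L - \<eta>" using 1(3)[of "e * exp s"] 2(3)[of e] that by simp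
      then show ?thesis by (simp only: exp_add mult_ac)
    qed
    then show ?case using 1 2 by (intro exI[of _ "min x2 (x1 * exp (- s))"] conjI exI[of _ \<eta>2]) auto
  qed
  have many: "\<exists>x>0. \<exists>\<eta>'>0. \<forall>e. 0 < e \<and> e \<le> x \<and> H e > L - \<eta>' \<longrightarrow> (\<forall>s\<in>A. H (e * exp s) > L - \<eta>)"
    if "finite A" "A \<subseteq> epochs" "\<eta> > 0" for A \<eta>
    using that
  proof (induction A rule: finite_induct)
    case empty
    then show ?case by (intro exI[of _ 1] conjI) auto
  next
    case (insert s A)
    obtain x1 \<eta>1 where 1: "x1 > 0" "\<eta>1 > 0"
      "\<And>e. 0 < e \<and> e \<le> x1 \<and> H e > L - \<eta>1 \<Longrightarrow> \<forall>s\<in>A. H (e * exp s) > L - \<eta>"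
      using insert by blast
    obtain x2 \<eta>2 where 2: "x2 > 0" "\<eta>2 > 0"
      "\<And>e. 0 < e \<and> e \<le> x2 \<and> H e > L - \<eta>2 \<Longrightarrow> H (e * exp s) > L - \<eta>"
      using chain[of s \<eta>] insert.prems by blast
    show ?case using 1 2 by (intro exI[of _ "min x1 x2"] conjI exI[of _ "min \<eta>1 \<eta>2"]) auto
  qed
  have lower: "\<exists>x>0. \<forall>e. 0 < e \<and> e \<le> x \<longrightarrow> H e \<ge> L - 2 * \<eta>" if \<eta>: "\<eta> > 0" for \<eta>
  proof -
    \<comment> \<open>A gap of logarithmic length \<open>\<zeta>\<close> costs a factor \<open>exp (- c \<zeta>)\<close>, hence at most \<open>c \<zeta> L \<le> \<eta>\<close>; the \<open>1\<close> avoids division by zero.\<close>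
    define \<zeta> where "\<zeta> = \<eta> / (c * L + 1)"
    have cL: "0 \<le> c * L" using c L0 by simp
    have \<zeta>: "\<zeta> > 0" "c * \<zeta> * L \<le> \<eta>" using \<eta> cL by (auto simp: \<zeta>_def field_simps)
    have key: "L - 2 * \<eta> \<le> exp (- (c * \<zeta>)) * (L - \<eta>)"
    proof (cases "L - \<eta> \<ge> 0")
      case True
      have "(1 - c * \<zeta>) * (L - \<eta>) \<le> exp (- (c * \<zeta>)) * (L - \<eta>)"
        using True exp_ge_add_one_self[of "- (c * \<zeta>)"] by (intro mult_right_mono) auto
      moreover have "0 \<le> c * \<zeta> * \<eta>" using c \<zeta> \<eta> by simp
      ultimately show ?thesis using \<zeta>(2) by (simp add: algebra_simps)
    next
      case False
      have "exp (- (c * \<zeta>)) \<le> 1" using c \<zeta> by simp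
      then have "1 * (L - \<eta>) \<le> exp (- (c * \<zeta>)) * (L - \<eta>)" using False by (intro mult_right_mono_neg) auto
      then show ?thesis using \<eta> by simp
    qed
    obtain a b where ab: "a \<in> epochs" "b \<in> epochs" "0 < b - a" "b - a < \<zeta>"
      using close_epochs[OF nonlat \<zeta>(1)] by blast
    define h where "h = b - a"
    obtain k :: nat where k: "- ln rmin \<le> real k * h"
      using reals_Archimedean3[of h] ab by (metis h_def less_imp_le)
    \<comment> \<open>Replacing \<open>a\<close> by \<open>b\<close> one summand at a time moves from \<open>k a\<close> to \<open>k b\<close> in steps of length \<open>h\<close>; all these are renewal times.\<close>
    define E where "E = (\<lambda>j. real k * a + real j * h) ` {..k}"
    have "E \<subseteq> epochs"
    proof
      fix s assume "s \<in> E"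
      then obtain j where j: "j \<le> k" "s = real k * a + real j * h" by (auto simp: E_def)
      then have "s = real (k - j) * a + real j * b" by (simp add: h_def algebra_simps of_nat_diff)
      then show "s \<in> epochs" using ab by (auto intro: epochs_add epochs_mult)
    qed
    then obtain x \<eta>' where x: "x > 0" "\<eta>' > 0"
       "\<And>e. 0 < e \<and> e \<le> x \<and> H e > L - \<eta>' \<Longrightarrow> \<forall>s\<in>E. H (e * exp s) > L - \<eta>"
      using many[of E \<eta>] \<eta> by (auto simp: E_def)
    define u where "u = exp (real k * a)"
    have u: "u > 0" by (simp add: u_def)
    obtain e0 where e0: "e0 > 0" "e0 \<le> min x (e1 / u)" "H e0 > L - \<eta>'"
      using L_below[OF x(2), of "min x (e1 / u)"] x e1 u by auto
    then have E: "H (e0 * exp s) > L - \<eta>" if "s \<in> E" for s using x(3)[of e0] that by auto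
    define w where "w = e0 * u"
    have w: "0 < w" "w \<le> e1" using e0 u by (auto simp: w_def field_simps)
    have base: "L - 2 * \<eta> \<le> H e" if e: "w < e" "e \<le> w / rmin" for e
    proof -
      define t where "t = ln (e / w)"
      have t: "0 \<le> t" "e = w * exp t" using e w by (auto simp: t_def)
      have "t \<le> ln (1 / rmin)" unfolding t_def using e w rmin_pos by (subst ln_le_cancel_iff) (auto simp: field_simps)
      then have tk: "t \<le> real k * h" using k rmin_pos by (simp add: ln_div)
      define j where "j = nat \<lfloor>t / h\<rfloor>"
      have h: "h > 0" using ab by (simp add: h_def)
      have j: "real j * h \<le> t" "t < real j * h + h"
        using floor_divide_lower[OF h, of t] floor_divide_upper[OF h, of t] t h
        by (auto simp: j_def algebra_simps)
      have "real j * h \<le> real k * h" using j tk by linarith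
      then have jk: "j \<le> k" using h by simp
      define e' where "e' = w * exp (real j * h)"
      have e'E: "e' = e0 * exp (real k * a + real j * h)" by (simp add: e'_def w_def u_def exp_add)
      have e'0: "0 < e'" "e' \<le> e" using w j t by (auto simp: e'_def)
      have H': "H e' > L - \<eta>" unfolding e'E by (rule E) (use jk in \<open>auto simp: E_def\<close>)
      have "e / e' = exp (t - real j * h)" using w t by (simp add: e'_def exp_diff)
      then have "(e / e') powr c = exp (c * (t - real j * h))" by (simp add: powr_def)
      also have "\<dots> \<le> exp (c * \<zeta>)" using c j ab by (auto simp: h_def intro!: mult_left_mono)
      finally have "H e' \<le> exp (c * \<zeta>) * H e"
        using slow[OF e'0] nonneg[of e] e'0 by (smt (verit) mult_right_mono)
      then have "exp (- (c * \<zeta>)) * H e' \<le> H e" by (simp add: exp_minus field_simps)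
      moreover have "exp (- (c * \<zeta>)) * (L - \<eta>) \<le> exp (- (c * \<zeta>)) * H e'" using H' by (intro mult_left_mono) auto
      ultimately show ?thesis using key by linarith
    qed
    have "L - 2 * \<eta> \<le> H e" if "0 < e" "e \<le> w" for e
    proof (rule renewal_lower_bound[OF w(1) _ base that(1)])
      show "e \<le> w / rmin" using that w rmin_pos rmin_less
        by (smt (verit) le_divide_eq mult_left_le)
    qed (use rec w in auto)
    then show ?thesis using w by blast
  qed
  have "(H \<longlongrightarrow> L) (at_right 0)"
  proof (rule tendstoI)
    fix \<epsilon> :: real assume \<epsilon>: "\<epsilon> > 0"
    obtain x where x: "x > 0" "\<And>e. 0 < e \<Longrightarrow> e \<le> x \<Longrightarrow> H e \<le> L + \<epsilon> / 3" using L_above[of "\<epsilon>/3"] \<epsilon> by auto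
    obtain y where y: "y > 0" "\<And>e. 0 < e \<Longrightarrow> e \<le> y \<Longrightarrow> H e \<ge> L - 2 * (\<epsilon> / 3)" using lower[of "\<epsilon>/3"] \<epsilon> by auto
    have "\<forall>\<^sub>F e in at_right 0. e \<in> {0<..<min x y}" using x y by (intro eventually_at_right_real) auto
    then show "\<forall>\<^sub>F e in at_right 0. dist (H e) L < \<epsilon>"
    proof eventually_elim
      case (elim e)
      then show ?case using x(2)[of e] y(2)[of e] \<epsilon> unfolding dist_real_def by auto
    qed
  qed
  then show ?thesis using that by blast
qed

end

section \<open>Hausdorff measure\<close>

text \<open>Caratheodory's criterion. A point of \<open>A - F\<close> either has distance at least \<open>1 / (n + 1)\<close> from \<open>F\<close> or lies in
one of the shells \<open>R k\<close> with \<open>k \<ge> n\<close>. Shells with indices of the same parity are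
separated from each other, so the measures of all shells have a finite sum, and the tails of this sum
vanish as \<open>n\<close> grows.\<close>

lemma closed_in_lambda_system_metric_outer:
  fixes \<mu> :: "'a::metric_space set \<Rightarrow> ennreal"
  assumes empty: "\<mu> {} = 0" and mono: "\<And>A B. A \<subseteq> B \<Longrightarrow> \<mu> A \<le> \<mu> B"
    and sub: "\<And>A :: nat \<Rightarrow> 'a set. \<mu> (\<Union>n. A n) \<le> (\<Sum>n. \<mu> (A n))"
    and sep: "\<And>A B d. 0 < d \<Longrightarrow> (\<And>x y. x \<in> A \<Longrightarrow> y \<in> B \<Longrightarrow> d \<le> dist x y) \<Longrightarrow> \<mu> A + \<mu> B \<le> \<mu> (A \<union> B)"
    and F: "closed F"
  shows "\<mu> (A \<inter> F) + \<mu> (A - F) = \<mu> A"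
proof (rule antisym)
  have sub2: "\<mu> (A \<union> B) \<le> \<mu> A + \<mu> B" for A B
  proof -
    define C where "C n = (if n = 0 then A else if n = Suc 0 then B else {})" for n :: nat
    have "\<mu> (\<Union>n. C n) \<le> (\<Sum>n. \<mu> (C n))" by (rule sub)
    also have "(\<Union>n. C n) = A \<union> B" by (auto simp: C_def split: if_splits)
    also have "(\<Sum>n. \<mu> (C n)) = (\<Sum>n\<in>{0, 1}. \<mu> (C n))"
      by (rule suminf_finite) (auto simp: C_def empty)
    finally show ?thesis by (simp add: C_def)
  qed
  show "\<mu> A \<le> \<mu> (A \<inter> F) + \<mu> (A - F)"
    using sub2[of "A \<inter> F" "A - F"] by (simp add: Un_Diff_Int Int_Diff_Un)
  show "\<mu> (A \<inter> F) + \<mu> (A - F) \<le> \<mu> A"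
  proof (cases "F = {} \<or> \<mu> A = \<infinity>")
    case True
    then show ?thesis using empty by auto
  next
    case False
    then have F0: "F \<noteq> {}" and fin: "\<mu> A < \<infinity>" by (auto simp: less_top)
    define B where "B n = {x \<in> A. 1 / (real n + 1) \<le> infdist x F}" for n
    define R where "R k = {x \<in> A. 1 / (real k + 2) \<le> infdist x F \<and> infdist x F < 1 / (real k + 1)}" for k
    have shell: "\<exists>k\<ge>n. x \<in> R k" if "x \<in> A - F" "x \<notin> B n" for x n
    proof -
      define t where "t = infdist x F"
      have t0: "0 < t" using infdist_pos_not_in_closed[OF F F0] that by (auto simp: t_def)
      have t1: "t < 1 / (real n + 1)" using that by (auto simp: B_def t_def)
      \<comment> \<open>The shell of \<open>x\<close> is the first one whose inner radius does not exceed \<open>t\<close>.\<close>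
      obtain m :: nat where "1 / t \<le> real m" using real_arch_simple by blast
      then have ex: "1 / (real m + 2) \<le> t" using t0 by (simp add: field_simps)
      define k where "k = (LEAST k. 1 / (real k + 2) \<le> t)"
      have k: "1 / (real k + 2) \<le> t" unfolding k_def using ex by (rule LeastI)
      have "t < 1 / (real k + 1)"
      proof (cases k)
        case 0
        have "1 / (real n + 1) \<le> 1" by simp
        then have "t < 1" using t1 by linarith
        then show ?thesis using 0 by simp
      next
        case (Suc j)
        have "\<not> 1 / (real j + 2) \<le> t" using not_less_Least[of j "\<lambda>k. 1 / (real k + 2) \<le> t"] Suc by (simp add: k_def)
        then show ?thesis using Suc by (simp add: add.commute)
      qed
      moreover have "n \<le> k"
      proof -
        have "1 / (real k + 2) < 1 / (real n + 1)" using k t1 by linarith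
        then have "real n + 1 < real k + 2" by (simp add: field_simps)
        then show ?thesis by linarith
      qed
      ultimately show ?thesis using k that by (auto simp: R_def t_def)
    qed
    have alternate: "(\<Sum>k<m. \<mu> (R (2 * k + b))) \<le> \<mu> (\<Union>k<m. R (2 * k + b))" for m b
    proof (induction m)
      case (Suc m)
      have "(\<Sum>k<Suc m. \<mu> (R (2 * k + b))) \<le> \<mu> (\<Union>k<m. R (2 * k + b)) + \<mu> (R (2 * m + b))"
        using Suc by (simp add: add_right_mono)
      also have "\<dots> \<le> \<mu> ((\<Union>k<m. R (2 * k + b)) \<union> R (2 * m + b))"
      proof (rule sep)
        let ?d = "1 / (real (2 * m + b)) - 1 / (real (2 * m + b) + 1)"
        show "0 < (if m = 0 then 1 else ?d)" by (auto intro!: frac_less2)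
        fix x y assume "x \<in> (\<Union>k<m. R (2 * k + b))" and y: "y \<in> R (2 * m + b)"
        then obtain k where k: "k < m" "x \<in> R (2 * k + b)" by auto
        have "1 / real (2 * m + b) \<le> 1 / (real (2 * k + b) + 2)" using k by (intro frac_le) auto
        also have "\<dots> \<le> infdist x F" using k by (simp add: R_def)
        finally have "1 / real (2 * m + b) \<le> infdist x F" .
        moreover have "infdist y F < 1 / (real (2 * m + b) + 1)" using y by (simp add: R_def)
        moreover have "infdist x F \<le> infdist y F + dist x y" by (rule infdist_triangle)
        ultimately have "?d \<le> dist x y" by linarith
        then show "(if m = 0 then 1 else ?d) \<le> dist x y" using k by auto
      qed
      also have "(\<Union>k<m. R (2 * k + b)) \<union> R (2 * m + b) = (\<Union>k<Suc m. R (2 * k + b))"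
        by (auto simp: less_Suc_eq)
      finally show ?case .
    qed (simp add: empty)
    have half: "(\<Sum>k<m. \<mu> (R (2 * k + b))) \<le> \<mu> A" for m b
      by (rule order_trans[OF alternate mono]) (auto simp: R_def)
    have split: "(\<Sum>k<2 * m. \<mu> (R k)) = (\<Sum>k<m. \<mu> (R (2 * k + 0))) + (\<Sum>k<m. \<mu> (R (2 * k + 1)))" for m
      by (induction m) (auto simp: algebra_simps)
    have "(\<Sum>k<m. \<mu> (R k)) \<le> \<mu> A + \<mu> A" for m
    proof -
      have "(\<Sum>k<m. \<mu> (R k)) \<le> (\<Sum>k<2 * m. \<mu> (R k))" by (intro sum_mono2) auto
      also have "\<dots> \<le> \<mu> A + \<mu> A" unfolding split by (intro add_mono half)
      finally show ?thesis .
    qed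
    then have "(\<Sum>k. \<mu> (R k)) \<le> \<mu> A + \<mu> A" by (intro suminf_le_const) auto
    also have "\<dots> < \<infinity>" using fin by simp
    finally have tot: "(\<Sum>k. \<mu> (R k)) < top" by simp
    define \<rho> where "\<rho> k = enn2real (\<mu> (R k))" for k
    have Rfin: "\<mu> (R k) < top" for k
      using mono[of "R k" A] fin by (auto simp: R_def intro: le_less_trans)
    have \<rho>: "\<mu> (R k) = ennreal (\<rho> k)" "0 \<le> \<rho> k" for k using Rfin[of k] by (auto simp: \<rho>_def)
    have sm: "summable \<rho>" using tot \<rho> by (intro summable_suminf_not_top) auto
    show ?thesis
    proof (rule ennreal_le_epsilon)
      fix e :: real assume e: "0 < e"
      obtain n where n: "norm (\<Sum>i. \<rho> (i + n)) < e" using suminf_exist_split[OF e sm] by blast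
      have tail: "(\<Sum>i. \<mu> (R (i + n))) \<le> ennreal e"
        using n \<rho>(2) sm by (simp add: \<rho>(1) suminf_ennreal2 summable_iff_shift ennreal_leI suminf_nonneg)
      have "\<mu> (A - F) \<le> \<mu> (B n \<union> (\<Union>i. R (i + n)))"
      proof (rule mono, rule subsetI)
        fix x assume x: "x \<in> A - F"
        show "x \<in> B n \<union> (\<Union>i. R (i + n))"
        proof (cases "x \<in> B n")
          case False
          then obtain k where "k \<ge> n" "x \<in> R k" using shell x by blast
          then have "x \<in> R ((k - n) + n)" by simp
          then show ?thesis by blast
        qed simp
      qed
      also have "\<dots> \<le> \<mu> (B n) + \<mu> (\<Union>i. R (i + n))" by (rule sub2)
      also have "\<dots> \<le> \<mu> (B n) + (\<Sum>i. \<mu> (R (i + n)))" by (intro add_left_mono sub)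
      also have "\<dots> \<le> \<mu> (B n) + ennreal e" by (intro add_left_mono tail)
      finally have "\<mu> (A \<inter> F) + \<mu> (A - F) \<le> (\<mu> (A \<inter> F) + \<mu> (B n)) + ennreal e"
        by (simp add: add.assoc add_left_mono)
      also have "\<mu> (A \<inter> F) + \<mu> (B n) \<le> \<mu> ((A \<inter> F) \<union> B n)"
      proof (rule sep)
        show "0 < 1 / (real n + 1)" by simp
        fix x y assume "x \<in> A \<inter> F" "y \<in> B n"
        then show "1 / (real n + 1) \<le> dist x y"
          using infdist_le[of x F y] by (auto simp: B_def dist_commute)
      qed
      also have "\<mu> ((A \<inter> F) \<union> B n) \<le> \<mu> A" by (rule mono) (auto simp: B_def)
      finally show "\<mu> (A \<inter> F) + \<mu> (A - F) \<le> \<mu> A + ennreal e" by (simp add: add_right_mono)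
    qed
  qed
qed

lemma measure_space_borel_metric_outer:
  fixes \<mu> :: "'a::metric_space set \<Rightarrow> ennreal"
  assumes empty: "\<mu> {} = 0" and mono: "\<And>A B. A \<subseteq> B \<Longrightarrow> \<mu> A \<le> \<mu> B"
    and sub: "\<And>A :: nat \<Rightarrow> 'a set. \<mu> (\<Union>n. A n) \<le> (\<Sum>n. \<mu> (A n))"
    and sep: "\<And>A B d. 0 < d \<Longrightarrow> (\<And>x y. x \<in> A \<Longrightarrow> y \<in> B \<Longrightarrow> d \<le> dist x y) \<Longrightarrow> \<mu> A + \<mu> B \<le> \<mu> (A \<union> B)"
  shows "measure_space UNIV (sets borel) \<mu>"
proof -
  let ?L = "lambda_system UNIV (Pow UNIV) \<mu>"
  interpret P: sigma_algebra UNIV "Pow UNIV :: 'a set set" by (rule sigma_algebra_Pow)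
  have "outer_measure_space (Pow UNIV) \<mu>"
    unfolding outer_measure_space_def positive_def increasing_def countably_subadditive_def
    using empty mono sub by auto
  then have ms: "measure_space UNIV ?L \<mu>" by (rule P.caratheodory_lemma)
  have "\<mu> (A \<inter> F) + \<mu> (A - F) = \<mu> A" if "closed F" for A F
    by (rule closed_in_lambda_system_metric_outer)
       (fact empty, fact mono, fact sub, fact sep, fact that)
  then have "Collect closed \<subseteq> ?L" unfolding P.lambda_system_eq by auto
  then have "sets borel \<subseteq> ?L"
    using ms sigma_algebra.sigma_sets_subset[of UNIV ?L "Collect closed"]
    by (simp add: borel_eq_closed measure_space_def)
  moreover have "sigma_algebra UNIV (sets (borel :: 'a measure))"
    using sets.sigma_algebra_axioms[of "borel :: 'a measure"] by simp
  moreover have "countably_additive (sets borel) \<mu>"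
    unfolding countably_additive_def
  proof (intro allI impI)
    fix A :: "nat \<Rightarrow> 'a set"
    assume "range A \<subseteq> sets borel" "disjoint_family A" "(\<Union>i. A i) \<in> sets borel"
    then show "(\<Sum>i. \<mu> (A i)) = \<mu> (\<Union>i. A i)"
      using ms \<open>sets borel \<subseteq> ?L\<close> unfolding measure_space_def countably_additive_def by blast
  qed
  ultimately show ?thesis
    unfolding measure_space_def positive_def using empty by blast
qed

lemma diameter_leI:
  assumes "0 \<le> d" "\<And>x y. x \<in> S \<Longrightarrow> y \<in> S \<Longrightarrow> dist x y \<le> d"
  shows "diameter S \<le> d"
  unfolding diameter_def using assms by (auto intro!: cSUP_least)

lemma hausdorff_gauge_powr: "s > 0 \<Longrightarrow> hausdorff_gauge s A = ennreal (diameter A powr s)"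
  by (simp add: hausdorff_gauge_def)

lemma hausdorff_gauge_empty: "hausdorff_gauge s {} = 0"
  by (simp add: hausdorff_gauge_def)

lemma hausdorff_gauge_mono:
  assumes "s > 0" "A \<subseteq> B" "bounded B"
  shows "hausdorff_gauge s A \<le> hausdorff_gauge s B"
  using assms diameter_subset[of A B] diameter_ge_0[of A] bounded_subset
  by (auto simp: hausdorff_gauge_powr intro!: ennreal_leI powr_mono2)

lemma hausdorff_pre_le:
  assumes "A \<subseteq> (\<Union>n. C n)" "\<And>n. bounded (C n)" "\<And>n. diameter (C n) \<le> \<eta>"
  shows "hausdorff_pre s \<eta> A \<le> (\<Sum>n. hausdorff_gauge s (C n))"
  unfolding hausdorff_pre_def using assms by (intro INF_lower) auto

lemma hausdorff_pre_greatest: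
  assumes "\<And>C :: nat \<Rightarrow> _. A \<subseteq> (\<Union>n. C n) \<Longrightarrow> (\<And>n. bounded (C n)) \<Longrightarrow> (\<And>n. diameter (C n) \<le> \<eta>)
     \<Longrightarrow> b \<le> (\<Sum>n. hausdorff_gauge s (C n))"
  shows "b \<le> hausdorff_pre s \<eta> A"
  unfolding hausdorff_pre_def using assms by (intro INF_greatest) auto

lemma hausdorff_pre_antimono: "\<eta> \<le> \<eta>' \<Longrightarrow> hausdorff_pre s \<eta>' A \<le> hausdorff_pre s \<eta> A"
  by (rule hausdorff_pre_greatest, rule hausdorff_pre_le) (auto intro: order_trans)

lemma hausdorff_pre_mono: "A \<subseteq> B \<Longrightarrow> hausdorff_pre s \<eta> A \<le> hausdorff_pre s \<eta> B"
  by (rule hausdorff_pre_greatest, rule hausdorff_pre_le) auto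

lemma hausdorff_pre_empty: "0 \<le> \<eta> \<Longrightarrow> hausdorff_pre s \<eta> {} = 0"
  using hausdorff_pre_le[of "{}" "\<lambda>_. {}" \<eta> s] by (simp add: hausdorff_gauge_def)

lemma hausdorff_pre_subadditive:
  fixes A :: "nat \<Rightarrow> 'a::metric_space set"
  shows "hausdorff_pre s \<eta> (\<Union>n. A n) \<le> (\<Sum>n. hausdorff_pre s \<eta> (A n))"
proof (rule ennreal_le_epsilon)
  fix e :: real assume e: "0 < e" and "(\<Sum>n. hausdorff_pre s \<eta> (A n)) < top"
  then have *: "hausdorff_pre s \<eta> (A n) < hausdorff_pre s \<eta> (A n) + e * (1/2)^Suc n" for n
    by (auto simp add: less_top dest!: ennreal_suminf_lessD)
  have "\<exists>B :: nat \<Rightarrow> 'a set. A n \<subseteq> (\<Union>i. B i) \<and> (\<forall>i. bounded (B i) \<and> diameter (B i) \<le> \<eta>) \<and>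
      (\<Sum>i. hausdorff_gauge s (B i)) \<le> hausdorff_pre s \<eta> (A n) + e * (1/2)^Suc n" for n
    using *[of n] unfolding hausdorff_pre_def[of s \<eta> "A n"] INF_less_iff by (auto intro: less_imp_le)
  then obtain B :: "nat \<Rightarrow> nat \<Rightarrow> 'a set" where B: "\<And>n. A n \<subseteq> (\<Union>i. B n i)"
    "\<And>n i. bounded (B n i)" "\<And>n i. diameter (B n i) \<le> \<eta>"
    "\<And>n. (\<Sum>i. hausdorff_gauge s (B n i)) \<le> hausdorff_pre s \<eta> (A n) + e * (1/2)^Suc n"
    by metis
  define C where "C = case_prod B \<circ> prod_decode"
  have "hausdorff_pre s \<eta> (\<Union>n. A n) \<le> (\<Sum>i. hausdorff_gauge s (C i))"
  proof (rule hausdorff_pre_le)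
    show "(\<Union>n. A n) \<subseteq> (\<Union>i. C i)"
      using B(1) by (auto simp: C_def subset_eq) (metis prod.case prod_encode_inverse)
  qed (use B in \<open>auto simp: C_def split_def\<close>)
  also have "\<dots> = (\<Sum>n. \<Sum>i. hausdorff_gauge s (B n i))"
    unfolding C_def comp_def by (intro suminf_ennreal_2dimen) auto
  also have "\<dots> \<le> (\<Sum>n. hausdorff_pre s \<eta> (A n) + e * (1/2) ^ Suc n)"
    by (intro suminf_le allI B) auto
  also have "\<dots> = (\<Sum>n. hausdorff_pre s \<eta> (A n)) + (\<Sum>n. ennreal e * ennreal ((1/2) ^ Suc n))"
    using e by (subst suminf_add[symmetric])
       (auto simp del: ennreal_suminf_cmult simp add: ennreal_mult[symmetric])
  also have "\<dots> = (\<Sum>n. hausdorff_pre s \<eta> (A n)) + e"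
    unfolding ennreal_suminf_cmult
    by (subst suminf_ennreal_eq[OF zero_le_power power_half_series]) auto
  finally show "hausdorff_pre s \<eta> (\<Union>n. A n) \<le> (\<Sum>n. hausdorff_pre s \<eta> (A n)) + e" .
qed

lemma hausdorff_pre_finite_subadditive:
  fixes A :: "'i \<Rightarrow> 'a::metric_space set"
  assumes I: "finite I" and "0 \<le> \<eta>"
  shows "hausdorff_pre s \<eta> (\<Union>i\<in>I. A i) \<le> (\<Sum>i\<in>I. hausdorff_pre s \<eta> (A i))"
  using I
proof (induction I rule: finite_induct)
  case (insert j J)
  define C where "C n = (if n = 0 then A j else if n = Suc 0 then (\<Union>i\<in>J. A i) else {})" for n :: nat
  have "hausdorff_pre s \<eta> (\<Union>n. C n) \<le> (\<Sum>n. hausdorff_pre s \<eta> (C n))" by (rule hausdorff_pre_subadditive)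
  also have "(\<Union>n. C n) = (\<Union>i\<in>insert j J. A i)"
    by (auto simp: C_def split: if_splits)
  also have "(\<Sum>n. hausdorff_pre s \<eta> (C n)) = (\<Sum>n\<in>{0, 1}. hausdorff_pre s \<eta> (C n))"
    by (rule suminf_finite) (auto simp: C_def hausdorff_pre_empty[OF assms(2)])
  also have "\<dots> = hausdorff_pre s \<eta> (A j) + hausdorff_pre s \<eta> (\<Union>i\<in>J. A i)" by (simp add: C_def)
  also have "\<dots> \<le> hausdorff_pre s \<eta> (A j) + (\<Sum>i\<in>J. hausdorff_pre s \<eta> (A i))"
    by (intro add_left_mono insert.IH)
  finally show ?case using insert by simp
qed (simp add: hausdorff_pre_empty assms)

lemma hausdorff_pre_le_outer: "0 < \<eta> \<Longrightarrow> hausdorff_pre s \<eta> A \<le> hausdorff_outer s A"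
  unfolding hausdorff_outer_def by (intro SUP_upper) auto

lemma hausdorff_outer_le: "(\<And>\<eta>. 0 < \<eta> \<Longrightarrow> hausdorff_pre s \<eta> A \<le> b) \<Longrightarrow> hausdorff_outer s A \<le> b"
  unfolding hausdorff_outer_def by (intro SUP_least) auto

text \<open>A covering set whose diameter is smaller than the distance of \<open>A\<close> and \<open>B\<close> meets at most one of them.\<close>

lemma hausdorff_outer_separated:
  assumes s: "s > 0" and d: "0 < d" and AB: "\<And>x y. x \<in> A \<Longrightarrow> y \<in> B \<Longrightarrow> d \<le> dist x y"
  shows "hausdorff_outer s A + hausdorff_outer s B \<le> hausdorff_outer s (A \<union> B)"
proof -
  have fine: "hausdorff_pre s \<eta> A + hausdorff_pre s \<eta> B \<le> hausdorff_pre s \<eta> (A \<union> B)" if \<eta>: "0 < \<eta>" "\<eta> < d" for \<eta>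
  proof (rule hausdorff_pre_greatest)
    fix C :: "nat \<Rightarrow> 'a set"
    assume C: "A \<union> B \<subseteq> (\<Union>n. C n)" "\<And>n. bounded (C n)" "\<And>n. diameter (C n) \<le> \<eta>"
    have dl: "diameter (C n \<inter> X) \<le> \<eta>" for n X
      using diameter_subset[of "C n \<inter> X" "C n"] C(2,3)[of n] by auto
    have "hausdorff_pre s \<eta> A + hausdorff_pre s \<eta> B \<le>
        (\<Sum>n. hausdorff_gauge s (C n \<inter> A)) + (\<Sum>n. hausdorff_gauge s (C n \<inter> B))"
      using C(1) dl by (intro add_mono hausdorff_pre_le) (auto intro: bounded_subset[OF C(2)])
    also have "\<dots> = (\<Sum>n. hausdorff_gauge s (C n \<inter> A) + hausdorff_gauge s (C n \<inter> B))"
      by (intro suminf_add) auto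
    also have "\<dots> \<le> (\<Sum>n. hausdorff_gauge s (C n))"
    proof (rule suminf_le)
      fix n
      have "C n \<inter> A = {} \<or> C n \<inter> B = {}"
      proof (rule ccontr)
        assume "\<not> ?thesis"
        then obtain x y where "x \<in> C n" "x \<in> A" "y \<in> C n" "y \<in> B" by auto
        then show False
          using AB[of x y] diameter_bounded_bound[OF C(2)[of n], of x y] C(3)[of n] \<eta> by auto
      qed
      then show "hausdorff_gauge s (C n \<inter> A) + hausdorff_gauge s (C n \<inter> B) \<le> hausdorff_gauge s (C n)"
        using hausdorff_gauge_mono[OF s _ C(2), of "C n \<inter> A" n] hausdorff_gauge_mono[OF s _ C(2), of "C n \<inter> B" n]
        by (auto simp: hausdorff_gauge_empty)
    qed auto
    finally show "hausdorff_pre s \<eta> A + hausdorff_pre s \<eta> B \<le> (\<Sum>n. hausdorff_gauge s (C n))" .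
  qed
  have two: "hausdorff_pre s \<eta> A + hausdorff_pre s \<eta>' B \<le> hausdorff_outer s (A \<union> B)" if "0 < \<eta>" "0 < \<eta>'" for \<eta> \<eta>'
  proof -
    define m where "m = min (min \<eta> \<eta>') (d / 2)"
    have m: "0 < m" "m < d" "m \<le> \<eta>" "m \<le> \<eta>'" using that d by (auto simp: m_def)
    have "hausdorff_pre s \<eta> A + hausdorff_pre s \<eta>' B \<le> hausdorff_pre s m A + hausdorff_pre s m B"
      using m by (intro add_mono hausdorff_pre_antimono)
    also have "\<dots> \<le> hausdorff_outer s (A \<union> B)"
      using fine[OF m(1,2)] hausdorff_pre_le_outer[OF m(1)] order_trans by blast
    finally show ?thesis .
  qed
  have "hausdorff_outer s A + hausdorff_pre s \<eta>' B \<le> hausdorff_outer s (A \<union> B)" if "0 < \<eta>'" for \<eta>'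
    unfolding hausdorff_outer_def[of s A]
    using two that by (subst ennreal_SUP_add_left[symmetric]) (auto intro!: SUP_least exI[of _ 1])
  then show ?thesis
    unfolding hausdorff_outer_def[of s B]
    by (subst ennreal_SUP_add_right) (auto intro!: SUP_least exI[of _ 1])
qed

lemma emeasure_hausdorff_measure:
  fixes A :: "'a::metric_space set"
  assumes s: "s > 0" and A: "A \<in> sets borel"
  shows "emeasure (hausdorff_measure s) A = hausdorff_outer s A"
proof -
  have "measure_space UNIV (sets borel) (hausdorff_outer s :: 'a set \<Rightarrow> ennreal)"
  proof (rule measure_space_borel_metric_outer)
    show "hausdorff_outer s ({} :: 'a set) = 0"
    proof -
      have "hausdorff_outer s ({} :: 'a set) \<le> 0"
        by (rule hausdorff_outer_le) (simp add: hausdorff_pre_empty)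
      then show ?thesis by simp
    qed
    show "hausdorff_outer s A \<le> hausdorff_outer s B" if "A \<subseteq> B" for A B :: "'a set"
      using that by (intro hausdorff_outer_le order_trans[OF hausdorff_pre_mono hausdorff_pre_le_outer])
    show "hausdorff_outer s (\<Union>n. A n) \<le> (\<Sum>n. hausdorff_outer s (A n))" for A :: "nat \<Rightarrow> 'a set"
      by (intro hausdorff_outer_le order_trans[OF hausdorff_pre_subadditive] suminf_le hausdorff_pre_le_outer) auto
    show "hausdorff_outer s A + hausdorff_outer s B \<le> hausdorff_outer s (A \<union> B)"
      if "0 < d" "\<And>x y. x \<in> A \<Longrightarrow> y \<in> B \<Longrightarrow> d \<le> dist x y" for A B :: "'a set" and d
      using hausdorff_outer_separated[OF s that] .
  qed
  then show ?thesis
    unfolding hausdorff_measure_def measure_space_def using A emeasure_measure_of_sigma by blast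
qed

lemma sets_hausdorff_measure: "sets (hausdorff_measure s) = sets borel"
  unfolding hausdorff_measure_def by (metis sets.sets_measure_of_eq space_borel)

lemma space_hausdorff_measure: "space (hausdorff_measure s) = UNIV"
  unfolding hausdorff_measure_def by (simp add: space_measure_of_conv)

lemma hausdorff_pre_Lipschitz_image:
  fixes f :: "'a::metric_space \<Rightarrow> 'b::metric_space"
  assumes s: "s > 0" and L: "L > 0" and lip: "\<And>x y. x \<in> A \<Longrightarrow> y \<in> A \<Longrightarrow> dist (f x) (f y) \<le> L * dist x y"
    and \<eta>: "0 < \<eta>"
  shows "hausdorff_pre s (L * \<eta>) (f ` A) \<le> ennreal (L powr s) * hausdorff_pre s \<eta> A"
proof -
  have inv: "ennreal (L powr s) * ennreal (L powr - s) = 1"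
    using L by (simp add: ennreal_mult[symmetric] powr_add[symmetric])
  have "ennreal (L powr - s) * hausdorff_pre s (L * \<eta>) (f ` A) \<le> hausdorff_pre s \<eta> A"
  proof (rule hausdorff_pre_greatest)
    fix C :: "nat \<Rightarrow> 'a set"
    assume C: "A \<subseteq> (\<Union>n. C n)" "\<And>n. bounded (C n)" "\<And>n. diameter (C n) \<le> \<eta>"
    have dist_le: "dist (f x) (f y) \<le> L * diameter (C n)" if "x \<in> C n \<inter> A" "y \<in> C n \<inter> A" for n x y
    proof -
      have "dist (f x) (f y) \<le> L * dist x y" using that lip by auto
      also have "\<dots> \<le> L * diameter (C n)"
        using that diameter_bounded_bound[OF C(2)] L by (intro mult_left_mono) auto
      finally show ?thesis .
    qed
    have diam: "diameter (f ` (C n \<inter> A)) \<le> L * diameter (C n)" for n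
      using dist_le L diameter_ge_0[OF C(2), of n] by (intro diameter_leI) auto
    have bdd: "bounded (f ` (C n \<inter> A))" for n
      unfolding bounded_two_points using dist_le by (intro exI[of _ "L * diameter (C n)"]) auto
    have "hausdorff_pre s (L * \<eta>) (f ` A) \<le> (\<Sum>n. hausdorff_gauge s (f ` (C n \<inter> A)))"
    proof (rule hausdorff_pre_le)
      show "diameter (f ` (C n \<inter> A)) \<le> L * \<eta>" for n
        using diam[of n] C(3)[of n] L by (meson mult_left_mono less_imp_le order_trans)
      show "f ` A \<subseteq> (\<Union>n. f ` (C n \<inter> A))" using C(1) by blast
    qed (rule bdd)
    also have "\<dots> \<le> (\<Sum>n. ennreal (L powr s) * hausdorff_gauge s (C n))"
    proof (rule suminf_le)
      fix n
      have "diameter (f ` (C n \<inter> A)) powr s \<le> (L * diameter (C n)) powr s"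
        using diam[of n] s diameter_ge_0[OF bdd, of n] by (intro powr_mono2) auto
      then show "hausdorff_gauge s (f ` (C n \<inter> A)) \<le> ennreal (L powr s) * hausdorff_gauge s (C n)"
        using s L diameter_ge_0[OF C(2), of n]
        by (simp add: hausdorff_gauge_powr powr_mult ennreal_mult[symmetric] ennreal_leI)
    qed auto
    also have "\<dots> = ennreal (L powr s) * (\<Sum>n. hausdorff_gauge s (C n))" by simp
    finally have "ennreal (L powr - s) * hausdorff_pre s (L * \<eta>) (f ` A)
        \<le> ennreal (L powr - s) * (ennreal (L powr s) * (\<Sum>n. hausdorff_gauge s (C n)))"
      by (rule mult_left_mono) simp
    then show "ennreal (L powr - s) * hausdorff_pre s (L * \<eta>) (f ` A) \<le> (\<Sum>n. hausdorff_gauge s (C n))"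
      using inv by (simp add: mult.assoc[symmetric] mult.commute[of "ennreal (L powr - s)"] del: ennreal_suminf_cmult)
  qed
  then have "ennreal (L powr s) * (ennreal (L powr - s) * hausdorff_pre s (L * \<eta>) (f ` A))
      \<le> ennreal (L powr s) * hausdorff_pre s \<eta> A"
    by (rule mult_left_mono) simp
  then show ?thesis using inv by (simp add: mult.assoc[symmetric])
qed

lemma hausdorff_outer_Lipschitz_image:
  fixes f :: "'a::metric_space \<Rightarrow> 'b::metric_space"
  assumes s: "s > 0" and L: "L > 0" and lip: "\<And>x y. x \<in> A \<Longrightarrow> y \<in> A \<Longrightarrow> dist (f x) (f y) \<le> L * dist x y"
  shows "hausdorff_outer s (f ` A) \<le> ennreal (L powr s) * hausdorff_outer s A"
proof (rule hausdorff_outer_le)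
  fix \<eta> :: real assume \<eta>: "0 < \<eta>"
  have "hausdorff_pre s (L * (\<eta> / L)) (f ` A) \<le> ennreal (L powr s) * hausdorff_pre s (\<eta> / L) A"
    using \<eta> L by (intro hausdorff_pre_Lipschitz_image[OF s L lip]) auto
  also have "\<dots> \<le> ennreal (L powr s) * hausdorff_outer s A"
    using \<eta> L by (intro mult_left_mono hausdorff_pre_le_outer) auto
  finally show "hausdorff_pre s \<eta> (f ` A) \<le> ennreal (L powr s) * hausdorff_outer s A" using L by simp
qed

lemma hausdorff_outer_similarity:
  fixes f :: "'a::metric_space \<Rightarrow> 'b::metric_space"
  assumes s: "s > 0" and f: "similarity f c"
  shows "hausdorff_outer s (f ` A) = ennreal (c powr s) * hausdorff_outer s A"
proof (rule antisym)
  have c: "c > 0" and d: "\<And>x y. dist (f x) (f y) = c * dist x y"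
    using f by (auto simp: similarity_def)
  show "hausdorff_outer s (f ` A) \<le> ennreal (c powr s) * hausdorff_outer s A"
    using d by (intro hausdorff_outer_Lipschitz_image[OF s c]) auto
  have im: "inv f ` f ` A = A" using similarity_inj[OF f] by (simp add: image_inv_f_f)
  have "hausdorff_outer s (inv f ` f ` A) \<le> ennreal ((1 / c) powr s) * hausdorff_outer s (f ` A)"
    by (rule hausdorff_outer_Lipschitz_image[OF s]) (use c d similarity_inj[OF f] in auto)
  then have "ennreal (c powr s) * hausdorff_outer s A
      \<le> ennreal (c powr s) * (ennreal ((1 / c) powr s) * hausdorff_outer s (f ` A))"
    unfolding im by (intro mult_left_mono) auto
  also have "\<dots> = hausdorff_outer s (f ` A)"
    using c by (simp add: mult.assoc[symmetric] ennreal_mult[symmetric] powr_mult[symmetric])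
  finally show "ennreal (c powr s) * hausdorff_outer s A \<le> hausdorff_outer s (f ` A)" .
qed

section \<open>Hausdorff measure on a self-similar set\<close>

lemma similarity_word:
  fixes \<phi> :: "'i \<Rightarrow> 'a::metric_space \<Rightarrow> 'a"
  assumes "\<And>i. i \<in> set w \<Longrightarrow> similarity (\<phi> i) (r i)"
  shows "similarity (foldr (\<lambda>i f. \<phi> i \<circ> f) w id) (prod_list (map r w))"
  using assms
proof (induction w)
  case Nil
  then show ?case by (simp add: similarity_def)
next
  case (Cons i w)
  then show ?case using similarity_comp[of "\<phi> i" "r i"] by (simp add: o_def)
qed

locale self_similar_set =
  fixes I :: "'i set" and \<phi> :: "'i \<Rightarrow> 'a::euclidean_space \<Rightarrow> 'a" and r :: "'i \<Rightarrow> real"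
    and K :: "'a set" and s :: real
  assumes finI: "finite I" and sim: "\<And>i. i \<in> I \<Longrightarrow> similarity (\<phi> i) (r i)"
    and contr: "\<And>i. i \<in> I \<Longrightarrow> r i < 1"
    and K_ne: "K \<noteq> {}" and K_cpt: "compact K" and K_eq: "K = (\<Union>i\<in>I. \<phi> i ` K)"
    and disj: "disjoint_family_on (\<lambda>i. \<phi> i ` K) I"
    and two: "\<exists>i\<in>I. \<exists>j\<in>I. i \<noteq> j"
    and s_pos: "0 < s" and s_sum: "(\<Sum>i\<in>I. r i powr s) = 1"
begin

lemma r_pos: "i \<in> I \<Longrightarrow> 0 < r i" and dist_\<phi>: "i \<in> I \<Longrightarrow> dist (\<phi> i x) (\<phi> i y) = r i * dist x y"
  using sim by (auto simp: similarity_def)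

lemma compact_piece: "i \<in> I \<Longrightarrow> compact (\<phi> i ` K)"
  by (intro compact_continuous_image similarity_continuous[OF sim] K_cpt)

text \<open>This is the core of the positivity of \<open>H\<^sup>s(K)\<close>. Suppose that the sum of the \<open>s\<close>-th powers of the diameters is
smaller than \<open>\<kappa>\<^sup>s\<close>. Then every covering set is too small to meet two pieces of \<open>K\<close>, so the sets are
distributed among the pieces, and since \<open>\<Sum>i r\<^sub>i\<^sup>s = 1\<close> some piece receives at most its share of the
sum. Pulling its sets back to \<open>K\<close> gives a cover with no larger sum but strictly fewer sets, as another
piece needs sets of its own.\<close>

lemma finite_cover_lower_bound:
  assumes \<kappa>: "0 < \<kappa>"
    and sep: "\<And>i j x y. i \<in> I \<Longrightarrow> j \<in> I \<Longrightarrow> i \<noteq> j \<Longrightarrow> x \<in> \<phi> i ` K \<Longrightarrow> y \<in> \<phi> j ` K \<Longrightarrow> \<kappa> \<le> dist x y"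
    and J: "finite J" "K \<subseteq> (\<Union>j\<in>J. A j)" "\<And>j. j \<in> J \<Longrightarrow> bounded (A j)"
  shows "\<kappa> powr s \<le> (\<Sum>j\<in>J. diameter (A j) powr s)"
  using J
proof (induction "card J" arbitrary: J A rule: less_induct)
  case less
  show ?case
  proof (rule ccontr)
    let ?S = "\<lambda>J. \<Sum>j\<in>J. diameter (A j) powr s"
    assume "\<not> ?thesis"
    then have small: "?S J < \<kappa> powr s" by simp
    have diam: "diameter (A j) < \<kappa>" if "j \<in> J" for j
    proof (rule ccontr)
      assume "\<not> ?thesis"
      then have "\<kappa> powr s \<le> diameter (A j) powr s" using \<kappa> s_pos by (intro powr_mono2) auto
      also have "\<dots> \<le> ?S J" using that less.prems by (intro member_le_sum) auto
      finally show False using small by simp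
    qed
    define P where "P i = {j \<in> J. A j \<inter> \<phi> i ` K \<noteq> {}}" for i
    have fP: "finite (P i)" for i using less.prems by (auto simp: P_def)
    have P_disj: "P i \<inter> P i' = {}" if i: "i \<in> I" "i' \<in> I" "i \<noteq> i'" for i i'
    proof (rule equals0I)
      fix j assume "j \<in> P i \<inter> P i'"
      then obtain x y where "j \<in> J" "x \<in> A j" "x \<in> \<phi> i ` K" "y \<in> A j" "y \<in> \<phi> i' ` K"
        by (auto simp: P_def)
      then show False
        using sep[OF i, of x y] diam[of j] diameter_bounded_bound[OF less.prems(3), of j x y] by linarith
    qed
    have P_ne: "P i \<noteq> {}" if i: "i \<in> I" for i
    proof -
      obtain x where "x \<in> \<phi> i ` K" using K_ne by auto
      then show ?thesis using less.prems(2) K_eq i by (fastforce simp: P_def)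
    qed
    have "\<exists>i\<in>I. ?S (P i) \<le> r i powr s * ?S J"
    proof (rule ccontr)
      assume "\<not> ?thesis"
      then have "(\<Sum>i\<in>I. r i powr s * ?S J) < (\<Sum>i\<in>I. ?S (P i))"
        using finI two by (intro sum_strict_mono) auto
      also have "\<dots> = ?S (\<Union>i\<in>I. P i)"
        using finI fP P_disj by (intro sum.UNION_disjoint[symmetric]) auto
      also have "\<dots> \<le> ?S J" using less.prems by (intro sum_mono2) (auto simp: P_def)
      finally show False using s_sum by (simp add: sum_distrib_right[symmetric])
    qed
    then obtain i where i: "i \<in> I" "?S (P i) \<le> r i powr s * ?S J" by blast
    obtain i' where i': "i' \<in> I" "i' \<noteq> i" using two by metis
    have "P i \<subseteq> J" "P i' \<subseteq> J" by (auto simp: P_def)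
    then have "P i \<subset> J" using P_ne[OF i'(1)] P_disj[OF i(1) i'(1)] i'(2) by blast
    then have "card (P i) < card J" using less.prems by (intro psubset_card_mono)
    define B where "B j = {x \<in> K. \<phi> i x \<in> A j}" for j
    have Bb: "bounded (B j)" for j
      by (rule bounded_subset[OF compact_imp_bounded[OF K_cpt]]) (auto simp: B_def)
    have "\<kappa> powr s \<le> (\<Sum>j\<in>P i. diameter (B j) powr s)"
    proof (rule less.hyps)
      show "K \<subseteq> (\<Union>j\<in>P i. B j)"
      proof
        fix x assume x: "x \<in> K"
        then have "\<phi> i x \<in> K" using K_eq i by blast
        then obtain j where "j \<in> J" "\<phi> i x \<in> A j" using less.prems by blast
        then show "x \<in> (\<Union>j\<in>P i. B j)" using x by (auto simp: P_def B_def)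
      qed
    qed (use fP Bb \<open>card (P i) < card J\<close> in auto)
    also have "\<dots> \<le> (\<Sum>j\<in>P i. (1 / r i) powr s * diameter (A j) powr s)"
    proof (rule sum_mono)
      fix j assume j: "j \<in> P i"
      then have jb: "bounded (A j)" using less.prems by (auto simp: P_def)
      have "diameter (B j) \<le> diameter (A j) / r i"
      proof (rule diameter_leI)
        show "0 \<le> diameter (A j) / r i" using diameter_ge_0[OF jb] r_pos[OF i(1)] by simp
        fix x y assume "x \<in> B j" "y \<in> B j"
        then show "dist x y \<le> diameter (A j) / r i"
          using diameter_bounded_bound[OF jb, of "\<phi> i x" "\<phi> i y"] r_pos[OF i(1)] dist_\<phi>[OF i(1)]
          by (auto simp: B_def field_simps)
      qed
      then have "diameter (B j) powr s \<le> (1 / r i * diameter (A j)) powr s"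
        using diameter_ge_0[OF Bb] s_pos by (intro powr_mono2) auto
      then show "diameter (B j) powr s \<le> (1 / r i) powr s * diameter (A j) powr s"
        using r_pos[OF i(1)] diameter_ge_0[OF jb] by (subst (asm) powr_mult) auto
    qed
    also have "\<dots> = (1 / r i) powr s * ?S (P i)" by (simp add: sum_distrib_left)
    also have "\<dots> \<le> (1 / r i) powr s * (r i powr s * ?S J)" using i by (intro mult_left_mono) auto
    also have "\<dots> = ?S J"
      using r_pos[OF i(1)] by (simp add: mult.assoc[symmetric] powr_mult[symmetric])
    finally show False using small by simp
  qed
qed

text \<open>Arbitrary countable covers are reduced to finite ones by replacing their sets by slightly larger open
sets and using the compactness of \<open>K\<close>.\<close>

lemma hausdorff_outer_pos: "0 < hausdorff_outer s K"
proof -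
  obtain \<kappa> where \<kappa>: "0 < \<kappa>"
     "\<And>i j x y. i \<in> I \<Longrightarrow> j \<in> I \<Longrightarrow> i \<noteq> j \<Longrightarrow> x \<in> \<phi> i ` K \<Longrightarrow> y \<in> \<phi> j ` K \<Longrightarrow> \<kappa> \<le> dist x y"
    using compact_family_separated[OF finI compact_piece disj] by blast
  have "ennreal (\<kappa> powr s) \<le> hausdorff_pre s 1 K"
  proof (rule hausdorff_pre_greatest)
    fix C :: "nat \<Rightarrow> 'a set"
    assume C: "K \<subseteq> (\<Union>n. C n)" "\<And>n. bounded (C n)"
    show "ennreal (\<kappa> powr s) \<le> (\<Sum>n. hausdorff_gauge s (C n))"
    proof (rule ennreal_le_epsilon)
      fix e :: real assume e: "0 < e" and fin: "(\<Sum>n. hausdorff_gauge s (C n)) < top"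
      have "\<exists>t>0. (diameter (C n) + 2 * t) powr s < diameter (C n) powr s + e * (1/2)^Suc n" for n
      proof -
        have "((\<lambda>t. (diameter (C n) + 2 * t) powr s) \<longlongrightarrow> (diameter (C n) + 2 * 0) powr s) (at_right 0)"
          using s_pos diameter_ge_0[OF C(2), of n]
          by (intro tendsto_powr' tendsto_intros) (auto intro!: eventually_mono[OF eventually_at_right_less[of 0]])
        then have "\<forall>\<^sub>F t in at_right 0. (diameter (C n) + 2 * t) powr s < diameter (C n) powr s + e * (1/2)^Suc n"
          by (rule order_tendstoD) (use e in simp)
        then have "\<forall>\<^sub>F t in at_right 0. 0 < t \<and> (diameter (C n) + 2 * t) powr s < diameter (C n) powr s + e * (1/2)^Suc n"
          using eventually_at_right_less[of 0] by eventually_elim auto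
        then show ?thesis using eventually_happens[of _ "at_right (0::real)"] by force
      qed
      then obtain \<tau> where \<tau>: "\<And>n. \<tau> n > 0"
        "\<And>n. (diameter (C n) + 2 * \<tau> n) powr s < diameter (C n) powr s + e * (1/2)^Suc n" by metis
      \<comment> \<open>Enlarging \<open>C n\<close> by \<open>\<tau> n\<close> costs at most \<open>e / 2\<^bsup>n + 1\<^esup>\<close> in the \<open>n\<close>-th summand, in total \<open>e\<close>.\<close>
      define O' where "O' n = (\<Union>x\<in>C n. ball x (\<tau> n))" for n
      have dist_le: "dist x y \<le> diameter (C n) + 2 * \<tau> n" if xy: "x \<in> O' n" "y \<in> O' n" for x y n
      proof -
        obtain a b where ab: "a \<in> C n" "dist a x < \<tau> n" "b \<in> C n" "dist b y < \<tau> n"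
          using xy by (auto simp: O'_def)
        then have "dist a b \<le> diameter (C n)" using diameter_bounded_bound[OF C(2)] by blast
        then show ?thesis using ab by metric
      qed
      have diam: "diameter (O' n) \<le> diameter (C n) + 2 * \<tau> n" for n
        using dist_le \<tau>(1)[of n] diameter_ge_0[OF C(2), of n] by (intro diameter_leI) auto
      have bdd: "bounded (O' n)" for n
        unfolding bounded_two_points using dist_le by blast
      have "K \<subseteq> (\<Union>n. O' n)" using C(1) \<tau>(1) by (force simp: O'_def)
      then obtain J where J: "finite J" "K \<subseteq> (\<Union>n\<in>J. O' n)"
        by (rule compactE_image[OF K_cpt, of UNIV O', rotated]) (auto simp: O'_def)
      have "\<kappa> powr s \<le> (\<Sum>n\<in>J. diameter (O' n) powr s)"
        by (rule finite_cover_lower_bound[OF \<kappa> J bdd])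
      also have "\<dots> \<le> (\<Sum>n\<in>J. diameter (C n) powr s + e * (1/2)^Suc n)"
      proof (rule sum_mono)
        fix n
        have "diameter (O' n) powr s \<le> (diameter (C n) + 2 * \<tau> n) powr s"
          using diam diameter_ge_0[OF bdd] s_pos by (intro powr_mono2) auto
        then show "diameter (O' n) powr s \<le> diameter (C n) powr s + e * (1/2)^Suc n"
          using \<tau>(2)[of n] by linarith
      qed
      finally have "ennreal (\<kappa> powr s) \<le> ennreal (\<Sum>n\<in>J. diameter (C n) powr s + e * (1/2)^Suc n)"
        by (rule ennreal_leI)
      also have "\<dots> = (\<Sum>n\<in>J. hausdorff_gauge s (C n) + ennreal (e * (1/2)^Suc n))"
        using e by (subst sum_ennreal[symmetric]) (auto simp: hausdorff_gauge_powr[OF s_pos] intro!: sum.cong)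
      also have "\<dots> \<le> (\<Sum>n. hausdorff_gauge s (C n) + ennreal (e * (1/2)^Suc n))"
        using J by (intro sum_le_suminf) auto
      also have "\<dots> = (\<Sum>n. hausdorff_gauge s (C n)) + (\<Sum>n. ennreal (e * (1/2)^Suc n))"
        by (intro suminf_add[symmetric]) auto
      also have "(\<Sum>n. ennreal (e * (1/2)^Suc n)) = ennreal e"
        using sums_mult[OF power_half_series, of e] e by (intro suminf_ennreal_eq) auto
      finally show "ennreal (\<kappa> powr s) \<le> (\<Sum>n. hausdorff_gauge s (C n)) + ennreal e" .
    qed
  qed
  also have "\<dots> \<le> hausdorff_outer s K" by (rule hausdorff_pre_le_outer) simp
  finally show ?thesis using \<kappa>(1) by (auto intro: less_le_trans[rotated])
qed

text \<open>Replacing a cover of \<open>K\<close> by its images under all \<open>\<phi>\<^sub>i\<close> does not change the sum of the \<open>s\<close>-th powers of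
the diameters but makes the diameters smaller by a fixed factor.\<close>

lemma hausdorff_outer_finite: "hausdorff_outer s K < \<infinity>"
proof -
  \<comment> \<open>The summand \<open>1\<close> makes \<open>D\<close> positive at once.\<close>
  define D where "D = diameter K + 1"
  have D: "D > 0" using diameter_ge_0[OF compact_imp_bounded[OF K_cpt]] by (simp add: D_def)
  define q where "q = Max (r ` I)"
  have ne: "I \<noteq> {}" using two by auto
  have q: "q < 1" "\<And>i. i \<in> I \<Longrightarrow> r i \<le> q" using finI ne contr by (auto simp: q_def)
  obtain i0 where i0: "i0 \<in> I" using ne by auto
  have q0: "0 < q" using r_pos[OF i0] q(2)[OF i0] by linarith
  have refine: "hausdorff_pre s (q * \<eta>) K \<le> hausdorff_pre s \<eta> K" if \<eta>: "0 < \<eta>" for \<eta>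
  proof -
    have "hausdorff_pre s (q * \<eta>) K \<le> (\<Sum>i\<in>I. hausdorff_pre s (q * \<eta>) (\<phi> i ` K))"
      using hausdorff_pre_finite_subadditive[OF finI, of "q * \<eta>" s "\<lambda>i. \<phi> i ` K"] \<eta> q0
      by (simp add: K_eq[symmetric])
    also have "\<dots> \<le> (\<Sum>i\<in>I. ennreal (r i powr s) * hausdorff_pre s \<eta> K)"
    proof (rule sum_mono)
      fix i assume i: "i \<in> I"
      have "hausdorff_pre s (q * \<eta>) (\<phi> i ` K) \<le> hausdorff_pre s (r i * \<eta>) (\<phi> i ` K)"
        using q(2)[OF i] \<eta> by (intro hausdorff_pre_antimono) auto
      also have "\<dots> \<le> ennreal (r i powr s) * hausdorff_pre s \<eta> K"
        using dist_\<phi>[OF i] by (intro hausdorff_pre_Lipschitz_image s_pos r_pos i \<eta>) auto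
      finally show "hausdorff_pre s (q * \<eta>) (\<phi> i ` K) \<le> ennreal (r i powr s) * hausdorff_pre s \<eta> K" .
    qed
    also have "\<dots> = (\<Sum>i\<in>I. ennreal (r i powr s)) * hausdorff_pre s \<eta> K"
      by (rule sum_distrib_right[symmetric])
    also have "(\<Sum>i\<in>I. ennreal (r i powr s)) = 1"
      using s_sum by (subst sum_ennreal) auto
    finally show ?thesis by simp
  qed
  have step: "hausdorff_pre s (q ^ n * D) K \<le> hausdorff_pre s D K" for n
  proof (induction n)
    case (Suc n)
    have "hausdorff_pre s (q ^ Suc n * D) K \<le> hausdorff_pre s (q ^ n * D) K"
      using refine[of "q ^ n * D"] D q0 by (simp add: mult.assoc)
    then show ?case using Suc by (rule order_trans)
  qed simp
  have "hausdorff_pre s D K \<le> (\<Sum>n. hausdorff_gauge s (if n = 0 then K else {}))"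
    by (rule hausdorff_pre_le) (use K_cpt D in \<open>auto simp: compact_imp_bounded D_def\<close>)
  also have "\<dots> = (\<Sum>n\<in>{0::nat}. hausdorff_gauge s (if n = 0 then K else {}))"
    by (rule suminf_finite) (auto simp: hausdorff_gauge_empty)
  finally have base: "hausdorff_pre s D K \<le> hausdorff_gauge s K" by simp
  have "hausdorff_outer s K \<le> hausdorff_gauge s K"
  proof (rule hausdorff_outer_le)
    fix \<eta> :: real assume \<eta>: "0 < \<eta>"
    obtain n where "q ^ n < \<eta> / D" using real_arch_pow_inv[of "\<eta> / D" q] \<eta> D q by auto
    then have "q ^ n * D \<le> \<eta>" using D by (simp add: field_simps)
    then have "hausdorff_pre s \<eta> K \<le> hausdorff_pre s (q ^ n * D) K" by (rule hausdorff_pre_antimono)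
    also have "\<dots> \<le> hausdorff_pre s D K" by (rule step)
    also note base
    finally show "hausdorff_pre s \<eta> K \<le> hausdorff_gauge s K" .
  qed
  also have "\<dots> < \<infinity>" by (simp add: hausdorff_gauge_powr[OF s_pos])
  finally show ?thesis .
qed

abbreviation "\<nu> \<equiv> normalised_hausdorff s K"

lemma space_\<nu>: "space \<nu> = K"
  by (simp add: normalised_hausdorff_def space_scale_measure space_restrict_space space_hausdorff_measure)

lemma sets_\<nu>: "sets \<nu> = sets (restrict_space borel K)"
  by (simp add: normalised_hausdorff_def sets_hausdorff_measure cong: sets_restrict_space_cong)

lemma emeasure_\<nu>:
  assumes "A \<in> sets borel" "A \<subseteq> K"
  shows "emeasure \<nu> A = hausdorff_outer s A / hausdorff_outer s K"
proof -
  have K: "K \<in> sets borel" by (simp add: K_cpt compact_imp_closed)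
  have "emeasure (restrict_space (hausdorff_measure s) K) A = hausdorff_outer s A"
    using assms K by (subst emeasure_restrict_space)
      (auto simp: sets_hausdorff_measure space_hausdorff_measure emeasure_hausdorff_measure[OF s_pos])
  then have "emeasure \<nu> A = 1 / hausdorff_outer s K * hausdorff_outer s A"
    unfolding normalised_hausdorff_def emeasure_scale_measure
    by (simp only: emeasure_hausdorff_measure[OF s_pos K])
  then show ?thesis
    by (metis ennreal_times_divide mult.commute mult.right_neutral)
qed

text \<open>Together with \<open>word_map_disjoint\<close> this identifies the normalised Hausdorff measure as the self-similar measure
that gives mass \<open>r\<^sub>w\<^sup>s\<close> to the cylinder of the word \<open>w\<close>.\<close>

lemma emeasure_\<nu>_similarity:
  assumes f: "similarity f c" and fK: "f ` K \<subseteq> K"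
  shows "emeasure \<nu> (f ` K) = ennreal (c powr s)"
proof -
  have "compact (f ` K)" by (intro compact_continuous_image similarity_continuous[OF f] K_cpt)
  then have "emeasure \<nu> (f ` K) = ennreal (c powr s) * hausdorff_outer s K / hausdorff_outer s K"
    using fK by (simp add: emeasure_\<nu> compact_imp_closed hausdorff_outer_similarity[OF s_pos f])
  also have "\<dots> = ennreal (c powr s)"
    using hausdorff_outer_pos hausdorff_outer_finite
    by (intro ennreal_mult_divide_eq) auto
  finally show ?thesis .
qed

lemma finite_\<nu>: "finite_measure \<nu>"
proof
  have "emeasure \<nu> (id ` K) = ennreal (1 powr s)"
    by (rule emeasure_\<nu>_similarity) (auto simp: similarity_def)
  then show "emeasure \<nu> (space \<nu>) \<noteq> \<infinity>" by (simp add: space_\<nu>)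
qed

text \<open>The images of \<open>K\<close> under the maps \<open>word_map w\<close> with \<open>w \<in> words n\<close> are the cylinders of generation \<open>n\<close>.\<close>

definition words :: "nat \<Rightarrow> 'i list set" where
  "words n = {w. set w \<subseteq> I \<and> length w = n}"

definition word_map :: "'i list \<Rightarrow> 'a \<Rightarrow> 'a" where
  "word_map w = foldr (\<lambda>i f. \<phi> i \<circ> f) w id"

definition word_ratio :: "'i list \<Rightarrow> real" where
  "word_ratio w = prod_list (map r w)"

lemma word_map_Cons: "word_map (i # w) = \<phi> i \<circ> word_map w"
  by (simp add: word_map_def o_def)

lemma finite_words: "finite (words n)"
  unfolding words_def by (rule finite_lists_length_eq[OF finI])

lemma words_0: "words 0 = {[]}"
  by (auto simp: words_def)

lemma words_Suc: "words (Suc n) = (\<lambda>(i, w). i # w) ` (I \<times> words n)"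
  by (auto simp: words_def length_Suc_conv image_iff)

lemma similarity_word_map: "w \<in> words n \<Longrightarrow> similarity (word_map w) (word_ratio w)"
  unfolding word_map_def word_ratio_def words_def by (intro similarity_word sim) auto

lemma sum_word_ratio: "(\<Sum>w\<in>words n. word_ratio w powr s) = 1"
proof (induction n)
  case (Suc n)
  have "(\<Sum>w\<in>words (Suc n). word_ratio w powr s) = (\<Sum>(i, w)\<in>I \<times> words n. word_ratio (i # w) powr s)"
    unfolding words_Suc by (subst sum.reindex) (auto simp: inj_on_def case_prod_unfold)
  also have "\<dots> = (\<Sum>(i, w)\<in>I \<times> words n. r i powr s * word_ratio w powr s)"
    using similarity_word_map r_pos
    by (intro sum.cong) (auto simp: word_ratio_def powr_mult similarity_def less_imp_le)
  also have "\<dots> = (\<Sum>i\<in>I. r i powr s) * (\<Sum>w\<in>words n. word_ratio w powr s)"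
    by (simp add: sum_product sum.cartesian_product)
  finally show ?case using Suc s_sum by simp
qed (simp add: words_0 word_ratio_def)

lemma word_map_cover: "(\<Union>w\<in>words n. word_map w ` K) = K"
proof (induction n)
  case (Suc n)
  have "(\<Union>w\<in>words (Suc n). word_map w ` K) = (\<Union>i\<in>I. \<Union>w\<in>words n. \<phi> i ` word_map w ` K)"
    unfolding words_Suc by (auto simp: word_map_Cons) (blast intro: imageI)
  also have "\<dots> = (\<Union>i\<in>I. \<phi> i ` (\<Union>w\<in>words n. word_map w ` K))"
    by (simp only: image_UN)
  finally show ?case by (simp only: Suc K_eq[symmetric])
qed (simp add: words_0 word_map_def)

lemma word_map_sub: "w \<in> words n \<Longrightarrow> word_map w ` K \<subseteq> K"
  using word_map_cover by blast

lemma word_map_disjoint: "disjoint_family_on (\<lambda>w. word_map w ` K) (words n)"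
proof (induction n)
  case (Suc n)
  show ?case unfolding disjoint_family_on_def
  proof (intro ballI impI)
    fix v w assume v: "v \<in> words (Suc n)" and w: "w \<in> words (Suc n)" and vw: "v \<noteq> w"
    obtain i v' where v': "v = i # v'" "i \<in> I" "v' \<in> words n" using v by (auto simp: words_Suc)
    obtain j w' where w': "w = j # w'" "j \<in> I" "w' \<in> words n" using w by (auto simp: words_Suc)
    have eq: "word_map v ` K = \<phi> i ` word_map v' ` K" "word_map w ` K = \<phi> j ` word_map w' ` K"
      by (auto simp: v' w' word_map_def)
    show "word_map v ` K \<inter> word_map w ` K = {}"
    proof (cases "i = j")
      case True
      then have "v' \<noteq> w'" using vw v' w' by auto
      then have "word_map v' ` K \<inter> word_map w' ` K = {}"
        using Suc v' w' by (auto simp: disjoint_family_on_def)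
      then show ?thesis unfolding eq True
        using similarity_inj[OF sim[OF w'(2)]] by (simp add: image_Int[symmetric])
    next
      case False
      then have "\<phi> i ` K \<inter> \<phi> j ` K = {}" using disj v' w' by (auto simp: disjoint_family_on_def)
      then show ?thesis unfolding eq using word_map_sub[OF v'(3)] word_map_sub[OF w'(3)] by blast
    qed
  qed
qed (simp add: words_0 disjoint_family_on_def)

lemma small_words:
  assumes "\<eta> > 0"
  obtains n where "\<And>w. w \<in> words n \<Longrightarrow> word_ratio w < \<eta>"
proof -
  define q where "q = Max (r ` I)"
  have ne: "I \<noteq> {}" using two by auto
  have q: "q < 1" "\<And>i. i \<in> I \<Longrightarrow> r i \<le> q" using finI ne contr by (auto simp: q_def)
  obtain i0 where i0: "i0 \<in> I" using ne by auto
  have q0: "0 < q" using r_pos[OF i0] q(2)[OF i0] by linarith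
  have *: "w \<in> words n \<Longrightarrow> word_ratio w \<le> q ^ n" for w n
  proof (induction n arbitrary: w)
    case (Suc n)
    then obtain i v where v: "w = i # v" "i \<in> I" "v \<in> words n" by (auto simp: words_Suc)
    have "0 < word_ratio v" using similarity_word_map[OF v(3)] by (simp add: similarity_def)
    then have "r i * word_ratio v \<le> q * q ^ n"
      using Suc.IH[OF v(3)] q(2)[OF v(2)] r_pos[OF v(2)] q0 by (intro mult_mono) auto
    then show ?case by (simp add: v word_ratio_def)
  qed (simp add: words_0 word_ratio_def)
  obtain n where n: "q ^ n < \<eta>" using real_arch_pow_inv[OF assms q(1)] by blast
  have "word_ratio w < \<eta>" if "w \<in> words n" for w
    using *[OF that] n by linarith
  then show ?thesis by (rule that)
qed

lemma integrable_\<nu>: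
  fixes f :: "'a \<Rightarrow> real"
  assumes f: "continuous_on K f"
  shows "integrable \<nu> f"
proof -
  interpret finite_measure \<nu> by (rule finite_\<nu>)
  obtain B where B: "\<And>x. x \<in> K \<Longrightarrow> \<bar>f x\<bar> \<le> B"
    using compact_imp_bounded[OF compact_continuous_image[OF f K_cpt]] by (auto simp: bounded_iff)
  have "f \<in> borel_measurable \<nu>"
    using borel_measurable_continuous_on_restrict[OF f] measurable_cong_sets[OF sets_\<nu> refl] by blast
  then show ?thesis
    by (intro integrable_const_bound[of _ B]) (auto simp: space_\<nu> B)
qed

lemma integral_\<nu>_le:
  fixes f :: "'a \<Rightarrow> real"
  assumes f: "continuous_on K f" and M: "\<And>w x. w \<in> words n \<Longrightarrow> x \<in> word_map w ` K \<Longrightarrow> f x \<le> M w"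
  shows "(LINT x:K|\<nu>. f x) \<le> (\<Sum>w\<in>words n. word_ratio w powr s * M w)"
proof -
  interpret finite_measure \<nu> by (rule finite_\<nu>)
  have cpt: "compact (word_map w ` K)" if "w \<in> words n" for w
    by (intro compact_continuous_image similarity_continuous[OF similarity_word_map[OF that]] K_cpt)
  have sets: "word_map w ` K \<in> sets \<nu>" if "w \<in> words n" for w
    using cpt[OF that] word_map_sub[OF that]
    by (auto simp: sets_\<nu> sets_restrict_space_iff K_cpt compact_imp_closed)
  have meas: "measure \<nu> (word_map w ` K) = word_ratio w powr s" if "w \<in> words n" for w
    using emeasure_\<nu>_similarity[OF similarity_word_map[OF that] word_map_sub[OF that]]
    by (simp add: measure_def)
  have "(LINT x:K|\<nu>. f x) = integral\<^sup>L \<nu> f"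
    unfolding set_lebesgue_integral_def by (intro Bochner_Integration.integral_cong) (auto simp: space_\<nu>)
  also have "\<dots> \<le> (\<integral>x. (\<Sum>w\<in>words n. M w * indicator (word_map w ` K) x) \<partial>\<nu>)"
  proof (rule integral_mono)
    show "integrable \<nu> f" by (rule integrable_\<nu>[OF f])
    show "integrable \<nu> (\<lambda>x. \<Sum>w\<in>words n. M w * indicator (word_map w ` K) x)"
      using sets by (intro Bochner_Integration.integrable_sum integrable_mult_right integrable_real_indicator)
        (auto simp: less_top[symmetric])
    fix x assume "x \<in> space \<nu>"
    then obtain w where w: "w \<in> words n" "x \<in> word_map w ` K" using word_map_cover[of n] unfolding space_\<nu> by blast
    have "(\<Sum>v\<in>words n. M v * indicator (word_map v ` K) x) = (\<Sum>v\<in>words n. if v = w then M w else 0)"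
    proof (intro sum.cong refl)
      fix v assume "v \<in> words n"
      then show "M v * indicator (word_map v ` K) x = (if v = w then M w else 0)"
        using w word_map_disjoint[of n] by (cases "v = w") (auto simp: disjoint_family_on_def indicator_def)
    qed
    also have "\<dots> = M w" using w finite_words by simp
    finally show "f x \<le> (\<Sum>w\<in>words n. M w * indicator (word_map w ` K) x)" using M[OF w] by simp
  qed
  also have "\<dots> = (\<Sum>w\<in>words n. word_ratio w powr s * M w)"
  proof (subst Bochner_Integration.integral_sum)
    show "integrable \<nu> (\<lambda>x. M w * indicator (word_map w ` K) x)" if "w \<in> words n" for w
      using sets[OF that]
      by (intro integrable_mult_right integrable_real_indicator) (auto simp: less_top[symmetric])
    show "(\<Sum>w\<in>words n. \<integral>x. M w * indicator (word_map w ` K) x \<partial>\<nu>)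
        = (\<Sum>w\<in>words n. word_ratio w powr s * M w)"
    proof (rule sum.cong[OF refl])
      fix w assume w: "w \<in> words n"
      have "(\<integral>x. M w * indicator (word_map w ` K) x \<partial>\<nu>) = M w * measure \<nu> (word_map w ` K \<inter> space \<nu>)"
        by simp
      also have "word_map w ` K \<inter> space \<nu> = word_map w ` K"
        using word_map_sub[OF w] by (auto simp: space_\<nu>)
      finally show "(\<integral>x. M w * indicator (word_map w ` K) x \<partial>\<nu>) = word_ratio w powr s * M w"
        by (simp add: meas[OF w] mult.commute)
    qed
  qed
  finally show ?thesis .
qed

lemma integral_\<nu>_ge:
  fixes f :: "'a \<Rightarrow> real"
  assumes f: "continuous_on K f" and M: "\<And>w x. w \<in> words n \<Longrightarrow> x \<in> word_map w ` K \<Longrightarrow> M w \<le> f x"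
  shows "(\<Sum>w\<in>words n. word_ratio w powr s * M w) \<le> (LINT x:K|\<nu>. f x)"
proof -
  have "(LINT x:K|\<nu>. - f x) \<le> (\<Sum>w\<in>words n. word_ratio w powr s * - M w)"
  proof (rule integral_\<nu>_le)
    show "continuous_on K (\<lambda>x. - f x)" by (intro continuous_on_minus f)
    show "- f x \<le> - M w" if "w \<in> words n" "x \<in> word_map w ` K" for w x
      using M[OF that] by simp
  qed
  then show ?thesis by (simp add: set_lebesgue_integral_def sum_negf)
qed

end

section \<open>Distortion of conformal diffeomorphisms\<close>

lemma norm_orthogonal_matrix_mult:
  fixes Q :: "real^'d^'d"
  assumes "orthogonal_matrix Q"
  shows "norm (Q *v v) = norm v"
proof -
  have "orthogonal_transformation ((*v) Q)"
    unfolding orthogonal_transformation_matrix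
    by (simp only: matrix_of_matrix_vector_mul matrix_vector_mul_linear assms simp_thms)
  then show ?thesis by (rule orthogonal_transformation_norm)
qed

text \<open>Uniform continuity of \<open>ln f\<close> on a compact neighbourhood of \<open>C\<close>.\<close>

lemma continuous_pos_ratio_close:
  fixes f :: "'a::heine_borel \<Rightarrow> real"
  assumes C: "compact C" "C \<noteq> {}" "C \<subseteq> V" and V: "open V"
    and f: "continuous_on V f" "\<And>x. x \<in> V \<Longrightarrow> 0 < f x" and \<eta>: "0 < \<eta>"
  obtains \<rho> where "0 < \<rho>" "\<And>p x. p \<in> C \<Longrightarrow> dist p x < \<rho> \<Longrightarrow> x \<in> V \<and> f x \<le> (1 + \<eta>) * f p \<and> f p \<le> (1 + \<eta>) * f x"
proof -
  obtain e where e: "0 < e" "(\<Union>x\<in>C. cball x e) \<subseteq> V"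
    using compact_subset_open_imp_cball_epsilon_subset[OF C(1) V C(3)] by blast
  have sub: "parallel_nbhd C e \<subseteq> V"
  proof
    fix x assume "x \<in> parallel_nbhd C e"
    then obtain y where "y \<in> C" "dist y x \<le> e" unfolding mem_parallel_nbhd[OF C(1,2)] by (metis dist_commute)
    then have "x \<in> (\<Union>x\<in>C. cball x e)" by auto
    then show "x \<in> V" using e(2) by blast
  qed
  have "continuous_on (parallel_nbhd C e) (\<lambda>x. ln (f x))"
  proof (intro continuous_on_ln continuous_on_subset[OF f(1)] sub ballI)
    fix x assume "x \<in> parallel_nbhd C e"
    then show "f x \<noteq> 0" using f(2)[of x] sub by auto
  qed
  then have unif: "uniformly_continuous_on (parallel_nbhd C e) (\<lambda>x. ln (f x))"
    by (rule compact_uniformly_continuous) (rule compact_parallel_nbhd[OF C(1,2) e(1)])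
  have "0 < ln (1 + \<eta>)" using \<eta> by simp
  from unif[unfolded uniformly_continuous_on_def, rule_format, OF this]
  obtain \<delta> where \<delta>: "0 < \<delta>" "\<forall>x \<in> parallel_nbhd C e. \<forall>y \<in> parallel_nbhd C e.
      dist y x < \<delta> \<longrightarrow> dist (ln (f y)) (ln (f x)) < ln (1 + \<eta>)"
    by blast
  have "x \<in> V \<and> f x \<le> (1 + \<eta>) * f p \<and> f p \<le> (1 + \<eta>) * f x"
    if "p \<in> C" "dist p x < min e \<delta>" for p x
  proof -
    have in_nbhd: "p \<in> parallel_nbhd C e" "x \<in> parallel_nbhd C e"
      unfolding mem_parallel_nbhd[OF C(1,2)] using that e
      by (intro bexI[of _ p]; simp add: dist_commute)+
    then have pos: "x \<in> V" "0 < f x" "0 < f p" using sub f by auto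
    have "\<bar>ln (f x) - ln (f p)\<bar> < ln (1 + \<eta>)"
      using \<delta>(2)[rule_format, OF in_nbhd] that by (simp add: dist_real_def dist_commute)
    moreover have "ln ((1 + \<eta>) * f p) = ln (1 + \<eta>) + ln (f p)" "ln ((1 + \<eta>) * f x) = ln (1 + \<eta>) + ln (f x)"
      using pos \<eta> by (simp_all add: ln_mult_pos)
    ultimately have "ln (f x) \<le> ln ((1 + \<eta>) * f p)" "ln (f p) \<le> ln ((1 + \<eta>) * f x)"
      by linarith+
    then show ?thesis using pos \<eta> by (simp add: ln_le_cancel_iff)
  qed
  then show ?thesis by (rule that[of "min e \<delta>", rotated]) (use e(1) \<delta>(1) in auto)
qed

locale conformal_diffeomorphism =
  fixes g h :: "real^'d \<Rightarrow> real^'d" and U :: "(real^'d) set"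
  assumes g_C1: "C1_map_on g U" and h_C1: "C1_map_on h (g ` U)"
    and h_g: "\<And>x. x \<in> U \<Longrightarrow> h (g x) = x" and conf: "conformal_on g U"
begin

abbreviation "\<sigma> \<equiv> scaling_ratio g"

lemma open_U: "open U" and open_gU: "open (g ` U)"
  using g_C1 h_C1 by (auto simp: C1_map_on_def)

lemma g_derivative: "x \<in> U \<Longrightarrow> (g has_derivative (\<lambda>v. jacobian g (at x) *v v)) (at x)"
  using g_C1 unfolding C1_map_on_def differentiable_on_def
  by (intro iffD1[OF jacobian_works]) (metis at_within_open)

lemma h_derivative: "x \<in> U \<Longrightarrow> (h has_derivative (\<lambda>v. jacobian h (at (g x)) *v v)) (at (g x))"
  using h_C1 unfolding C1_map_on_def differentiable_on_def
  by (intro iffD1[OF jacobian_works]) (metis at_within_open imageI)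

lemma continuous_g: "continuous_on U g" and continuous_h: "continuous_on (g ` U) h"
  using g_C1 h_C1 by (auto simp: C1_map_on_def intro: differentiable_imp_continuous_on)

text \<open>The scaling ratio is well defined because an orthogonal matrix preserves norms: the norm of the image of a
unit vector determines \<open>|c|\<close>.\<close>

lemma norm_jacobian:
  assumes x: "x \<in> U"
  shows "norm (jacobian g (at x) *v v) = \<sigma> x * norm v"
proof -
  obtain c Q where Q: "orthogonal_matrix Q" "jacobian g (at x) = c *\<^sub>R Q"
    using conf x unfolding conformal_on_def by blast
  have *: "norm (jacobian g (at x) *v w) = \<bar>a\<bar> * norm w"
    if "orthogonal_matrix P" "jacobian g (at x) = a *\<^sub>R P" for a P w
    unfolding that(2) scaleR_matrix_vector_assoc[symmetric] norm_scaleR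
    by (simp only: norm_orthogonal_matrix_mult[OF that(1)])
  have "\<sigma> x = \<bar>c\<bar>"
    unfolding scaling_ratio_def
  proof (rule the_equality)
    show "\<exists>a P. orthogonal_matrix P \<and> jacobian g (at x) = a *\<^sub>R P \<and> \<bar>c\<bar> = \<bar>a\<bar>" using Q by blast
    fix s assume "\<exists>a P. orthogonal_matrix P \<and> jacobian g (at x) = a *\<^sub>R P \<and> s = \<bar>a\<bar>"
    then obtain a P where P: "orthogonal_matrix P" "jacobian g (at x) = a *\<^sub>R P" "s = \<bar>a\<bar>" by blast
    show "s = \<bar>c\<bar>"
      using *[OF P(1,2), of "axis undefined 1"] *[OF Q, of "axis undefined 1"] P(3) by simp
  qed
  then show ?thesis using *[OF Q] by simp
qed

lemma continuous_\<sigma>: "continuous_on U \<sigma>"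
proof -
  have "linear (\<lambda>A::real^'d^'d. A *v axis undefined 1)"
    by (intro linearI) (auto simp: matrix_vector_mult_add_rdistrib scaleR_matrix_vector_assoc)
  then have "bounded_linear (\<lambda>A::real^'d^'d. A *v axis undefined 1)"
    by (simp only: linear_conv_bounded_linear)
  then have "continuous_on UNIV (\<lambda>A::real^'d^'d. A *v axis undefined 1)"
    by (rule linear_continuous_on)
  then have "continuous_on U (\<lambda>x. jacobian g (at x) *v axis undefined 1)"
    by (rule continuous_on_compose2) (use g_C1 in \<open>simp_all add: C1_map_on_def\<close>)
  then have "continuous_on U (\<lambda>x. norm (jacobian g (at x) *v axis undefined 1))"
    by (rule continuous_on_norm)
  then show ?thesis by (rule continuous_on_eq) (simp add: norm_jacobian)
qed

lemma jacobian_inverse: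
  assumes x: "x \<in> U"
  shows "jacobian h (at (g x)) *v (jacobian g (at x) *v v) = v"
proof -
  have "((\<lambda>y. h (g y)) has_derivative (\<lambda>v. jacobian h (at (g x)) *v (jacobian g (at x) *v v))) (at x)"
    using has_derivative_compose[OF g_derivative[OF x] h_derivative[OF x]] .
  moreover have "((\<lambda>y. h (g y)) has_derivative (\<lambda>v. v)) (at x)"
    by (rule has_derivative_transform_within_open[OF has_derivative_ident open_U x]) (simp add: h_g)
  ultimately have "(\<lambda>v. jacobian h (at (g x)) *v (jacobian g (at x) *v v)) = (\<lambda>v. v)"
    by (rule has_derivative_unique)
  then show ?thesis by (rule fun_cong)
qed

lemma \<sigma>_pos: assumes x: "x \<in> U" shows "0 < \<sigma> x"
proof -
  let ?e = "axis undefined 1 :: real^'d"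
  have "jacobian g (at x) *v ?e \<noteq> 0"
    using jacobian_inverse[OF x, of ?e] by (auto simp: axis_eq_0_iff)
  then have "0 < norm (jacobian g (at x) *v ?e)" by simp
  then show ?thesis by (simp add: norm_jacobian[OF x])
qed

lemma norm_jacobian_inverse:
  assumes x: "x \<in> U"
  shows "norm (jacobian h (at (g x)) *v w) = norm w / \<sigma> x"
proof -
  have "inj ((*v) (jacobian g (at x)))" by (rule inj_on_inverseI) (rule jacobian_inverse[OF x])
  then have "surj ((*v) (jacobian g (at x)))"
    by (intro linear_injective_imp_surjective) auto
  then obtain v where v: "w = jacobian g (at x) *v v" by (metis surjD)
  show ?thesis using \<sigma>_pos[OF x] by (simp add: v jacobian_inverse[OF x] norm_jacobian[OF x])
qed

lemma g_Lipschitz_on_ball: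
  assumes "ball p \<rho> \<subseteq> U" "\<And>x. x \<in> ball p \<rho> \<Longrightarrow> \<sigma> x \<le> L" "x \<in> ball p \<rho>" "y \<in> ball p \<rho>"
  shows "dist (g x) (g y) \<le> L * dist x y"
  unfolding dist_norm
proof (rule differentiable_bound[OF convex_ball[of p \<rho>]])
  fix z assume z: "z \<in> ball p \<rho>"
  then have zU: "z \<in> U" using assms by auto
  show "(g has_derivative (\<lambda>v. jacobian g (at z) *v v)) (at z within ball p \<rho>)"
    using g_derivative[OF zU] by (rule has_derivative_at_withinI)
  show "onorm (\<lambda>v. jacobian g (at z) *v v) \<le> L"
    using assms(2)[OF z] by (intro onorm_le) (auto simp: norm_jacobian[OF zU] intro: mult_right_mono)
qed (use assms in auto)

lemma h_Lipschitz_on_ball: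
  assumes "ball q \<rho> \<subseteq> g ` U" "\<And>z. z \<in> ball q \<rho> \<Longrightarrow> 1 / \<sigma> (h z) \<le> L" "x \<in> ball q \<rho>" "y \<in> ball q \<rho>"
  shows "dist (h x) (h y) \<le> L * dist x y"
  unfolding dist_norm
proof (rule differentiable_bound[OF convex_ball[of q \<rho>]])
  fix z assume z: "z \<in> ball q \<rho>"
  then obtain u where u: "u \<in> U" "z = g u" using assms by auto
  show "(h has_derivative (\<lambda>v. jacobian h (at z) *v v)) (at z within ball q \<rho>)"
    using h_derivative[OF u(1)] unfolding u(2) by (rule has_derivative_at_withinI)
  show "onorm (\<lambda>v. jacobian h (at z) *v v) \<le> L"
  proof (rule onorm_le)
    fix v
    have "norm (jacobian h (at z) *v v) = 1 / \<sigma> (h z) * norm v"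
      using norm_jacobian_inverse[OF u(1)] by (simp add: u h_g)
    also have "\<dots> \<le> L * norm v" using assms(2)[OF z] by (intro mult_right_mono) auto
    finally show "norm (jacobian h (at z) *v v) \<le> L * norm v" .
  qed
qed (use assms in auto)

text \<open>If \<open>L\<close> is a Lipschitz constant of \<open>h\<close> near \<open>g p\<close>, then \<open>h\<close> maps the \<open>e\<close>-parallel set of \<open>g A\<close> into the
\<open>L e\<close>-parallel set of \<open>A\<close>, and \<open>g\<close> carries it back while multiplying volumes by at most the \<open>d\<close>-th power of
its own Lipschitz constant. The lower estimate is the same argument with \<open>g\<close> and \<open>h\<close> exchanged. The smallness
conditions keep all points within the balls on which the Lipschitz constants are valid.\<close>

lemma parallel_volume_image_bounds:
  assumes A: "compact A" "A \<noteq> {}" and \<eta>: "0 < \<eta>" and p: "p \<in> U"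
    and \<rho>: "\<And>x. dist p x < \<rho> \<Longrightarrow> x \<in> U \<and> \<sigma> x \<le> (1 + \<eta>) * \<sigma> p"
           "\<And>z. dist (g p) z < \<rho> \<Longrightarrow> z \<in> g ` U \<and> \<sigma> p \<le> (1 + \<eta>) * \<sigma> (h z)"
    and near: "\<And>y. y \<in> A \<Longrightarrow> dist p y < \<rho> / 2" "\<And>y. y \<in> A \<Longrightarrow> dist (g p) (g y) < \<rho> / 2"
    and e: "0 < e" "e < \<rho> / 2"
  shows "(1 + \<eta>) / \<sigma> p * e < \<rho> / 2 \<Longrightarrow>
      parallel_volume (g ` A) e \<le> ((1 + \<eta>) * \<sigma> p) ^ CARD('d) * parallel_volume A ((1 + \<eta>) / \<sigma> p * e)" (is "?small \<Longrightarrow> ?upper")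
    and "1 / ((1 + \<eta>) * \<sigma> p) * e < \<rho> / 2 \<Longrightarrow>
      parallel_volume A (1 / ((1 + \<eta>) * \<sigma> p) * e) \<le> ((1 + \<eta>) / \<sigma> p) ^ CARD('d) * parallel_volume (g ` A) e" (is "?small' \<Longrightarrow> ?lower")
proof -
  have \<sigma>p: "0 < \<sigma> p" by (rule \<sigma>_pos[OF p])
  have AU: "A \<subseteq> ball p \<rho>" using near(1) e by (force simp: dist_commute)
  have gA: "compact (g ` A)" "g ` A \<noteq> {}"
    using A AU \<rho>(1) by (auto intro!: compact_continuous_image continuous_on_subset[OF continuous_g])
  have gLip: "dist (g x) (g y) \<le> ((1 + \<eta>) * \<sigma> p) * dist x y" if "x \<in> ball p \<rho>" "y \<in> ball p \<rho>" for x y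
    by (rule g_Lipschitz_on_ball[OF _ _ that]) (use \<rho>(1) in auto)
  have hLip: "dist (h x) (h y) \<le> ((1 + \<eta>) / \<sigma> p) * dist x y" if "x \<in> ball (g p) \<rho>" "y \<in> ball (g p) \<rho>" for x y
  proof (rule h_Lipschitz_on_ball[OF _ _ that])
    show "ball (g p) \<rho> \<subseteq> g ` U" using \<rho>(2) by auto
    fix z assume "z \<in> ball (g p) \<rho>"
    then have z: "z \<in> g ` U" "\<sigma> p \<le> (1 + \<eta>) * \<sigma> (h z)" using \<rho>(2) by auto
    then have "0 < \<sigma> (h z)" using \<sigma>_pos h_g by auto
    then show "1 / \<sigma> (h z) \<le> (1 + \<eta>) / \<sigma> p" using z \<sigma>p by (simp add: field_simps)
  qed
  have N_ball: "parallel_nbhd (g ` A) e \<subseteq> ball (g p) \<rho>"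
  proof
    fix z assume "z \<in> parallel_nbhd (g ` A) e"
    then obtain y where "y \<in> A" "dist z (g y) \<le> e" unfolding mem_parallel_nbhd[OF gA] by auto
    then show "z \<in> ball (g p) \<rho>"
      using near(2)[of y] e dist_triangle_less_add[of "g p" "g y" "\<rho> / 2" z "\<rho> / 2"] by (auto simp: dist_commute)
  qed
  have B_ball: "parallel_nbhd A t \<subseteq> ball p \<rho>" if t: "t < \<rho> / 2" for t
  proof
    fix z assume "z \<in> parallel_nbhd A t"
    then obtain y where "y \<in> A" "dist z y \<le> t" unfolding mem_parallel_nbhd[OF A] by auto
    then show "z \<in> ball p \<rho>"
      using near(1)[of y] t dist_triangle_less_add[of p y "\<rho> / 2" z "\<rho> / 2"] by (auto simp: dist_commute)
  qed
  have N: "compact (parallel_nbhd (g ` A) e)" by (rule compact_parallel_nbhd[OF gA e(1)])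
  show ?upper if small: ?small
  proof -
    let ?B = "parallel_nbhd A ((1 + \<eta>) / \<sigma> p * e)"
    have B: "compact ?B" by (rule compact_parallel_nbhd[OF A]) (use e \<eta> \<sigma>p in simp)
    have BU: "?B \<subseteq> ball p \<rho>" by (rule B_ball[OF small])
    have gB: "compact (g ` ?B)"
      using B BU \<rho>(1) by (intro compact_continuous_image continuous_on_subset[OF continuous_g]) auto
    have "parallel_nbhd (g ` A) e \<subseteq> g ` ?B"
    proof
      fix z assume zN: "z \<in> parallel_nbhd (g ` A) e"
      then obtain y where y: "y \<in> A" "dist z (g y) \<le> e" unfolding mem_parallel_nbhd[OF gA] by auto
      have z: "z \<in> ball (g p) \<rho>" using zN N_ball by auto
      have gy: "g y \<in> ball (g p) \<rho>" using near(2)[OF y(1)] e by auto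
      have "y \<in> U" using y AU \<rho>(1) by auto
      then have "dist (h z) y \<le> (1 + \<eta>) / \<sigma> p * dist z (g y)" using hLip[OF z gy] by (simp add: h_g)
      also have "\<dots> \<le> (1 + \<eta>) / \<sigma> p * e" using y \<eta> \<sigma>p by (intro mult_left_mono) auto
      finally have "h z \<in> ?B" unfolding mem_parallel_nbhd[OF A] using y by auto
      moreover obtain u where "u \<in> U" "z = g u" using z \<rho>(2)[of z] by auto
      then have "g (h z) = z" by (simp add: h_g)
      ultimately show "z \<in> g ` ?B" by force
    qed
    then have "measure lebesgue (parallel_nbhd (g ` A) e) \<le> measure lebesgue (g ` ?B)"
      using N gB by (intro measure_mono_fmeasurable) (auto intro: lmeasurable_compact fmeasurableD)
    also have "\<dots> \<le> ((1 + \<eta>) * \<sigma> p) ^ DIM(real^'d) * measure lebesgue ?B"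
      using B gB BU \<eta> \<sigma>p by (intro measure_Lipschitz_image_le gLip) (auto intro: lmeasurable_compact)
    finally show ?thesis by (simp add: parallel_volume_def)
  qed
  show ?lower if small: ?small'
  proof -
    let ?B = "parallel_nbhd A (1 / ((1 + \<eta>) * \<sigma> p) * e)"
    have B: "compact ?B" by (rule compact_parallel_nbhd[OF A]) (use e \<eta> \<sigma>p in simp)
    have BU: "?B \<subseteq> ball p \<rho>" by (rule B_ball[OF small])
    have hN: "compact (h ` parallel_nbhd (g ` A) e)"
      using N N_ball \<rho>(2) by (intro compact_continuous_image continuous_on_subset[OF continuous_h]) auto
    have "?B \<subseteq> h ` parallel_nbhd (g ` A) e"
    proof
      fix x assume xB: "x \<in> ?B"
      then obtain y where y: "y \<in> A" "dist x y \<le> 1 / ((1 + \<eta>) * \<sigma> p) * e" unfolding mem_parallel_nbhd[OF A] by auto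
      have x: "x \<in> ball p \<rho>" using xB BU by auto
      have "dist (g x) (g y) \<le> ((1 + \<eta>) * \<sigma> p) * dist x y" using gLip[OF x] y AU by auto
      also have "\<dots> \<le> ((1 + \<eta>) * \<sigma> p) * (1 / ((1 + \<eta>) * \<sigma> p) * e)" using y \<eta> \<sigma>p by (intro mult_left_mono) auto
      also have "\<dots> = e" using \<eta> \<sigma>p by simp
      finally have "g x \<in> parallel_nbhd (g ` A) e" unfolding mem_parallel_nbhd[OF gA] using y by auto
      moreover have "h (g x) = x" using x \<rho>(1) h_g by auto
      ultimately show "x \<in> h ` parallel_nbhd (g ` A) e" by force
    qed
    then have "measure lebesgue ?B \<le> measure lebesgue (h ` parallel_nbhd (g ` A) e)"
      using B hN by (intro measure_mono_fmeasurable) (auto intro: lmeasurable_compact fmeasurableD)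
    also have "\<dots> \<le> ((1 + \<eta>) / \<sigma> p) ^ DIM(real^'d) * measure lebesgue (parallel_nbhd (g ` A) e)"
      using N hN N_ball \<eta> \<sigma>p by (intro measure_Lipschitz_image_le hLip) (auto intro: lmeasurable_compact)
    finally show ?thesis by (simp add: parallel_volume_def)
  qed
qed

lemma uniform_distortion:
  assumes K: "compact K" "K \<noteq> {}" "K \<subseteq> U" and \<eta>: "0 < \<eta>"
  obtains \<rho> where "0 < \<rho>"
    "\<And>p x. p \<in> K \<Longrightarrow> dist p x < \<rho> \<Longrightarrow> x \<in> U \<and> \<sigma> x \<le> (1 + \<eta>) * \<sigma> p \<and> \<sigma> p \<le> (1 + \<eta>) * \<sigma> x"
    "\<And>p z. p \<in> K \<Longrightarrow> dist (g p) z < \<rho> \<Longrightarrow> z \<in> g ` U \<and> \<sigma> p \<le> (1 + \<eta>) * \<sigma> (h z)"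
proof -
  obtain \<rho>1 where 1: "0 < \<rho>1"
    "\<And>p x. p \<in> K \<Longrightarrow> dist p x < \<rho>1 \<Longrightarrow> x \<in> U \<and> \<sigma> x \<le> (1 + \<eta>) * \<sigma> p \<and> \<sigma> p \<le> (1 + \<eta>) * \<sigma> x"
    using continuous_pos_ratio_close[OF K open_U continuous_\<sigma> \<sigma>_pos \<eta>] by blast
  have hU: "h z \<in> U" if "z \<in> g ` U" for z using that h_g by auto
  have ch: "continuous_on (g ` U) (\<lambda>z. \<sigma> (h z))"
    by (rule continuous_on_compose2[OF continuous_\<sigma> continuous_h]) (use hU in auto)
  have gK: "compact (g ` K)" "g ` K \<noteq> {}" "g ` K \<subseteq> g ` U"
    using K by (auto intro!: compact_continuous_image continuous_on_subset[OF continuous_g])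
  obtain \<rho>2 where 2: "0 < \<rho>2"
    "\<And>q z. q \<in> g ` K \<Longrightarrow> dist q z < \<rho>2 \<Longrightarrow> z \<in> g ` U \<and> \<sigma> (h z) \<le> (1 + \<eta>) * \<sigma> (h q) \<and> \<sigma> (h q) \<le> (1 + \<eta>) * \<sigma> (h z)"
    using continuous_pos_ratio_close[OF gK open_gU ch _ \<eta>] \<sigma>_pos hU by blast
  show ?thesis
  proof (rule that[of "min \<rho>1 \<rho>2"])
    show "z \<in> g ` U \<and> \<sigma> p \<le> (1 + \<eta>) * \<sigma> (h z)" if "p \<in> K" "dist (g p) z < min \<rho>1 \<rho>2" for p z
      using 2(2)[of "g p" z] that K h_g by auto
  qed (use 1 2 in auto)
qed

end

section \<open>Logarithmic averages\<close>

text \<open>For \<open>\<kappa> = \<delta> - d\<close> and a parallel volume \<open>V\<close>, \<open>log_average \<kappa> V T\<close> is the expression whose limit at \<open>T = 0\<close> is the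
average Minkowski content.\<close>

definition log_integral :: "real \<Rightarrow> (real \<Rightarrow> real) \<Rightarrow> real \<Rightarrow> real \<Rightarrow> real" where
  "log_integral \<kappa> V a b = (LINT x:{a..b}|lborel. x powr \<kappa> * V x / x)"

definition log_average :: "real \<Rightarrow> (real \<Rightarrow> real) \<Rightarrow> real \<Rightarrow> real" where
  "log_average \<kappa> V T = inverse \<bar>ln T\<bar> * log_integral \<kappa> V T 1"

definition log_integrable :: "real \<Rightarrow> (real \<Rightarrow> real) \<Rightarrow> bool" where
  "log_integrable \<kappa> V \<longleftrightarrow> (\<forall>a b. 0 < a \<longrightarrow> set_integrable lborel {a..b} (\<lambda>x. x powr \<kappa> * V x / x))"

lemma log_integrableD: "log_integrable \<kappa> V \<Longrightarrow> 0 < a \<Longrightarrow> set_integrable lborel {a..b} (\<lambda>x. x powr \<kappa> * V x / x)"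
  by (simp add: log_integrable_def)

lemma log_integrable_monotone:
  assumes nonneg: "\<And>x. 0 < x \<Longrightarrow> 0 \<le> V x" and mono: "\<And>x y. 0 < x \<Longrightarrow> x \<le> y \<Longrightarrow> V x \<le> V y"
  shows "log_integrable \<kappa> V"
  unfolding log_integrable_def
proof (intro allI impI)
  fix a b :: real assume a: "0 < a"
  define V' where "V' x = (if 0 < x then V x else 0)" for x
  have "mono V'" by (rule monoI) (use nonneg mono in \<open>auto simp: V'_def\<close>)
  then have V': "V' \<in> borel_measurable borel" by (rule borel_measurable_mono)
  have "continuous_on {a..b} (\<lambda>x. x powr \<kappa> / x)" using a by (intro continuous_intros) auto
  then obtain B where B: "\<And>x. x \<in> {a..b} \<Longrightarrow> \<bar>x powr \<kappa> / x\<bar> \<le> B"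
    using compact_imp_bounded[OF compact_continuous_image] by (fastforce simp: bounded_iff)
  have "set_integrable lborel {a..b} (\<lambda>x. x powr \<kappa> / x * V' x)"
    unfolding set_integrable_def
  proof (rule integrableI_bounded_set_indicator[of _ _ _ "B * V b"])
    show "AE x in lborel. x \<in> {a..b} \<longrightarrow> norm (x powr \<kappa> / x * V' x) \<le> B * V b"
    proof (rule AE_I2, rule impI)
      fix x assume x: "x \<in> {a..b}"
      then have "0 \<le> V' x" "V' x \<le> V b" using a nonneg mono by (auto simp: V'_def)
      moreover have "0 \<le> B" using order_trans[OF abs_ge_zero B[OF x]] .
      ultimately show "norm (x powr \<kappa> / x * V' x) \<le> B * V b"
        using B[OF x] unfolding real_norm_def abs_mult by (intro mult_mono) auto
    qed
    show "(\<lambda>x. x powr \<kappa> / x * V' x) \<in> borel_measurable lborel" using V' by simp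
    show "emeasure lborel {a..b} < \<infinity>" by (simp add: emeasure_lborel_Icc_eq)
  qed simp
  moreover have "x powr \<kappa> / x * V' x = x powr \<kappa> * V x / x" if "x \<in> {a..b}" for x
    using that a by (simp add: V'_def)
  ultimately show "set_integrable lborel {a..b} (\<lambda>x. x powr \<kappa> * V x / x)"
    by (subst (asm) set_integrable_cong[OF refl refl]) auto
qed

lemma log_integral_combine:
  assumes V: "log_integrable \<kappa> V" and "0 < a" "a \<le> b" "b \<le> c"
  shows "log_integral \<kappa> V a c = log_integral \<kappa> V a b + log_integral \<kappa> V b c"
proof -
  let ?f = "\<lambda>x. x powr \<kappa> * V x / x"
  have eq: "log_integral \<kappa> V x y = integral {x..y} ?f" if "0 < x" for x y
    unfolding log_integral_def by (rule set_borel_integral_eq_integral) (rule log_integrableD[OF V that])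
  have "?f integrable_on {a..c}" by (rule set_borel_integral_eq_integral) (rule log_integrableD[OF V assms(2)])
  then show ?thesis using assms Henstock_Kurzweil_Integration.integral_combine[of a b c ?f] by (simp add: eq)
qed

lemma log_integral_mono:
  assumes "log_integrable \<kappa> V" "log_integrable \<kappa> W" "0 < a" "\<And>x. a \<le> x \<Longrightarrow> x \<le> b \<Longrightarrow> V x \<le> W x"
  shows "log_integral \<kappa> V a b \<le> log_integral \<kappa> W a b"
  unfolding log_integral_def
  by (rule set_integral_mono) (use assms in \<open>auto intro!: log_integrableD divide_right_mono mult_left_mono\<close>)

lemma log_integrable_scale:
  assumes V: "log_integrable \<kappa> V" and u: "0 < u"
  shows "log_integrable \<kappa> (\<lambda>x. V (u * x))"
    and "0 < a \<Longrightarrow> log_integral \<kappa> (\<lambda>x. V (u * x)) a b = u powr - \<kappa> * log_integral \<kappa> V (u * a) (u * b)"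
proof -
  let ?F = "\<lambda>a b x. indicator {u * a..u * b} x *\<^sub>R (x powr \<kappa> * V x / x)"
  have eq: "indicator {a..b} x *\<^sub>R (x powr \<kappa> * V (u * x) / x) = (u powr - \<kappa> * u) * ?F a b (0 + u * x)" if "0 < a" for a b x
  proof (cases "x \<in> {a..b}")
    case True
    then have "0 < x" "u * x \<in> {u * a..u * b}" using that u by auto
    then show ?thesis using True u by (simp add: powr_mult powr_minus field_simps)
  next
    case False
    then have "u * x \<notin> {u * a..u * b}" using u by auto
    then show ?thesis using False by simp
  qed
  show "log_integrable \<kappa> (\<lambda>x. V (u * x))"
    unfolding log_integrable_def set_integrable_def
  proof (intro allI impI)
    fix a b :: real assume a: "0 < a"
    have "integrable lborel (?F a b)"
      using log_integrableD[OF V, of "u * a" "u * b"] a u by (simp add: set_integrable_def)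
    then have "integrable lborel (\<lambda>x. ?F a b (0 + u * x))"
      by (rule lborel_integrable_real_affine) (use u in simp)
    then show "integrable lborel (\<lambda>x. indicator {a..b} x *\<^sub>R (x powr \<kappa> * V (u * x) / x))"
      unfolding eq[OF a] by (rule integrable_mult_right)
  qed
  assume a: "0 < a"
  have "log_integral \<kappa> (\<lambda>x. V (u * x)) a b = (u powr - \<kappa> * u) * (\<integral>x. ?F a b (0 + u * x) \<partial>lborel)"
    unfolding log_integral_def set_lebesgue_integral_def eq[OF a] by (rule integral_mult_right_zero)
  also have "(\<integral>x. ?F a b x \<partial>lborel) = \<bar>u\<bar> *\<^sub>R (\<integral>x. ?F a b (0 + u * x) \<partial>lborel)"
    using u by (intro lborel_integral_real_affine) simp
  then have "(u powr - \<kappa> * u) * (\<integral>x. ?F a b (0 + u * x) \<partial>lborel) = u powr - \<kappa> * (\<integral>x. ?F a b x \<partial>lborel)"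
    using u by simp
  finally show "log_integral \<kappa> (\<lambda>x. V (u * x)) a b = u powr - \<kappa> * log_integral \<kappa> V (u * a) (u * b)"
    by (simp add: log_integral_def set_lebesgue_integral_def)
qed

lemma log_integrable_sum:
  assumes "finite A" "\<And>w. w \<in> A \<Longrightarrow> log_integrable \<kappa> (V w)"
  shows "log_integrable \<kappa> (\<lambda>x. \<Sum>w\<in>A. b w * V w x)"
    and "0 < a \<Longrightarrow> log_integral \<kappa> (\<lambda>x. \<Sum>w\<in>A. b w * V w x) a c = (\<Sum>w\<in>A. b w * log_integral \<kappa> (V w) a c)"
proof -
  have eq: "indicator {a..c} x *\<^sub>R (x powr \<kappa> * (\<Sum>w\<in>A. b w * V w x) / x)
      = (\<Sum>w\<in>A. b w * (indicator {a..c} x *\<^sub>R (x powr \<kappa> * V w x / x)))" for a c x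
    by (simp add: sum_distrib_left sum_divide_distrib mult_ac)
  have int: "integrable lborel (\<lambda>x. indicator {a..c} x *\<^sub>R (x powr \<kappa> * V w x / x))" if "w \<in> A" "0 < a" for w a c
    using log_integrableD[OF assms(2)[OF that(1)] that(2)] by (simp add: set_integrable_def)
  show "log_integrable \<kappa> (\<lambda>x. \<Sum>w\<in>A. b w * V w x)"
    unfolding log_integrable_def set_integrable_def eq
    by (intro allI impI Bochner_Integration.integrable_sum integrable_mult_right int)
  assume a: "0 < a"
  have "(\<integral>x. (\<Sum>w\<in>A. b w * (indicator {a..c} x *\<^sub>R (x powr \<kappa> * V w x / x))) \<partial>lborel)
      = (\<Sum>w\<in>A. \<integral>x. b w * (indicator {a..c} x *\<^sub>R (x powr \<kappa> * V w x / x)) \<partial>lborel)"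
    by (intro Bochner_Integration.integral_sum integrable_mult_right int a)
  then show "log_integral \<kappa> (\<lambda>x. \<Sum>w\<in>A. b w * V w x) a c = (\<Sum>w\<in>A. b w * log_integral \<kappa> (V w) a c)"
    unfolding log_integral_def set_lebesgue_integral_def eq by (simp only: integral_mult_right_zero)
qed

text \<open>Rescaling shifts the interval of integration \<open>[T, 1]\<close> to \<open>[u T, u]\<close>; in the logarithmic scale both end points
move by a constant, which is negligible after division by \<open>|ln T|\<close>.\<close>

lemma log_average_scale:
  assumes V: "log_integrable \<kappa> V" and u: "0 < u" and lim: "(log_average \<kappa> V \<longlongrightarrow> M) (at_right 0)"
  shows "(log_average \<kappa> (\<lambda>x. V (u * x)) \<longlongrightarrow> u powr - \<kappa> * M) (at_right 0)"
proof -
  define m where "m = min 1 u"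
  have m: "0 < m" "m \<le> 1" "m \<le> u" using u by (auto simp: m_def)
  define C where "C = log_integral \<kappa> V m u - log_integral \<kappa> V m 1"
  have sc: "filterlim (\<lambda>T. u * T) (at_right 0) (at_right 0)"
    using u by (auto simp: filterlim_at intro!: tendsto_eq_intros eventually_at_right_less[THEN eventually_mono])
  have ratio: "((\<lambda>T. inverse \<bar>ln T\<bar> * \<bar>ln (u * T)\<bar>) \<longlongrightarrow> 1) (at_right 0)"
  proof -
    have "((\<lambda>T. 1 - ln u * inverse \<bar>ln T\<bar>) \<longlongrightarrow> 1 - ln u * 0) (at_right 0)"
      by (intro tendsto_intros tendsto_inverse_abs_ln)
    moreover have "\<forall>\<^sub>F T in at_right 0. 1 - ln u * inverse \<bar>ln T\<bar> = inverse \<bar>ln T\<bar> * \<bar>ln (u * T)\<bar>"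
      using eventually_at_right_real[OF zero_less_one]
        eventually_at_right_real[of 0 "1 / u", simplified, OF u]
    proof eventually_elim
      case (elim T)
      then have T: "0 < T" "T < 1" "u * T < 1" using u by (auto simp: field_simps)
      then have "ln T < 0" "ln (u * T) < 0" using u by (auto simp: ln_less_zero)
      moreover have "ln (u * T) = ln u + ln T" using T u by (simp add: ln_mult_pos)
      ultimately show ?case by (simp add: field_simps)
    qed
    ultimately show ?thesis by (simp add: tendsto_cong)
  qed
  have "((\<lambda>T. u powr - \<kappa> * ((inverse \<bar>ln T\<bar> * \<bar>ln (u * T)\<bar>) * log_average \<kappa> V (u * T) + C * inverse \<bar>ln T\<bar>))
      \<longlongrightarrow> u powr - \<kappa> * (1 * M + C * 0)) (at_right 0)"
    by (intro tendsto_intros ratio tendsto_inverse_abs_ln filterlim_compose[OF lim sc])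
  moreover have "\<forall>\<^sub>F T in at_right 0. u powr - \<kappa> * ((inverse \<bar>ln T\<bar> * \<bar>ln (u * T)\<bar>) * log_average \<kappa> V (u * T) + C * inverse \<bar>ln T\<bar>)
      = log_average \<kappa> (\<lambda>x. V (u * x)) T"
    using eventually_at_right_real[of 0 "m / u", simplified, OF divide_pos_pos[OF m(1) u]]
      eventually_at_right_real[of 0 "1 / u", simplified, OF u]
  proof eventually_elim
    case (elim T)
    then have T: "0 < T" "u * T < m" "u * T < 1" using u by (auto simp: field_simps)
    have "log_integral \<kappa> V (u * T) u = log_integral \<kappa> V (u * T) m + log_integral \<kappa> V m u"
      "log_integral \<kappa> V (u * T) 1 = log_integral \<kappa> V (u * T) m + log_integral \<kappa> V m 1"
      using T u m by (auto intro!: log_integral_combine[OF V])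
    then have "log_integral \<kappa> V (u * T) u = log_integral \<kappa> V (u * T) 1 + C" by (simp add: C_def)
    moreover have "ln (u * T) \<noteq> 0" using T u by (simp add: ln_eq_zero_iff)
    then have "\<bar>ln (u * T)\<bar> * log_average \<kappa> V (u * T) = log_integral \<kappa> V (u * T) 1"
      unfolding log_average_def by simp
    ultimately have "\<bar>ln (u * T)\<bar> * log_average \<kappa> V (u * T) + C = log_integral \<kappa> V (u * T) u" by simp
    moreover have "log_average \<kappa> (\<lambda>x. V (u * x)) T = u powr - \<kappa> * (inverse \<bar>ln T\<bar> * log_integral \<kappa> V (u * T) u)"
      unfolding log_average_def using log_integrable_scale(2)[OF V u T(1), of 1] by (simp add: mult_ac)
    ultimately have "log_average \<kappa> (\<lambda>x. V (u * x)) T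
        = u powr - \<kappa> * (inverse \<bar>ln T\<bar> * (\<bar>ln (u * T)\<bar> * log_average \<kappa> V (u * T) + C))" by simp
    then show ?case by (simp only: distrib_left mult_ac)
  qed
  ultimately show ?thesis by (simp add: tendsto_cong)
qed

lemma log_average_sum:
  assumes A: "finite A" "\<And>w. w \<in> A \<Longrightarrow> log_integrable \<kappa> (V w)"
    "\<And>w. w \<in> A \<Longrightarrow> (log_average \<kappa> (V w) \<longlongrightarrow> M w) (at_right 0)"
  shows "(log_average \<kappa> (\<lambda>x. \<Sum>w\<in>A. b w * V w x) \<longlongrightarrow> (\<Sum>w\<in>A. b w * M w)) (at_right 0)"
proof -
  have "((\<lambda>T. \<Sum>w\<in>A. b w * log_average \<kappa> (V w) T) \<longlongrightarrow> (\<Sum>w\<in>A. b w * M w)) (at_right 0)"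
    by (intro tendsto_sum tendsto_mult_left A)
  moreover have "\<forall>\<^sub>F T in at_right 0. (\<Sum>w\<in>A. b w * log_average \<kappa> (V w) T) = log_average \<kappa> (\<lambda>x. \<Sum>w\<in>A. b w * V w x) T"
    using eventually_at_right_less[of 0]
  proof eventually_elim
    case (elim T)
    have "log_integral \<kappa> (\<lambda>x. \<Sum>w\<in>A. b w * V w x) T 1 = (\<Sum>w\<in>A. b w * log_integral \<kappa> (V w) T 1)"
      by (rule log_integrable_sum(2)) (use A elim in auto)
    then show ?case unfolding log_average_def by (simp add: sum_distrib_left mult_ac)
  qed
  ultimately show ?thesis by (simp add: tendsto_cong)
qed

lemma log_average_eventually_le:
  assumes V: "log_integrable \<kappa> V" and W: "log_integrable \<kappa> W"
    and x0: "0 < x0" and le: "\<And>x. 0 < x \<Longrightarrow> x \<le> x0 \<Longrightarrow> V x \<le> W x"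
  obtains C where "\<forall>\<^sub>F T in at_right 0. log_average \<kappa> V T \<le> log_average \<kappa> W T + C * inverse \<bar>ln T\<bar>"
proof -
  define m where "m = min x0 1"
  have m: "0 < m" "m \<le> 1" "m \<le> x0" using x0 by (auto simp: m_def)
  define C where "C = log_integral \<kappa> V m 1 - log_integral \<kappa> W m 1"
  have "\<forall>\<^sub>F T in at_right 0. log_average \<kappa> V T \<le> log_average \<kappa> W T + C * inverse \<bar>ln T\<bar>"
    using eventually_at_right_real[OF m(1)]
  proof eventually_elim
    case (elim T)
    then have T: "0 < T" "T < m" by auto
    have "log_integral \<kappa> V T m \<le> log_integral \<kappa> W T m"
      using T m by (intro log_integral_mono V W le) auto
    moreover have "log_integral \<kappa> V T 1 = log_integral \<kappa> V T m + log_integral \<kappa> V m 1"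
      "log_integral \<kappa> W T 1 = log_integral \<kappa> W T m + log_integral \<kappa> W m 1"
      using T m by (auto intro!: log_integral_combine V W)
    ultimately have "log_integral \<kappa> V T 1 \<le> log_integral \<kappa> W T 1 + C" by (simp add: C_def)
    then have "inverse \<bar>ln T\<bar> * log_integral \<kappa> V T 1 \<le> inverse \<bar>ln T\<bar> * (log_integral \<kappa> W T 1 + C)"
      by (intro mult_left_mono) auto
    then show ?case by (simp add: log_average_def algebra_simps)
  qed
  then show ?thesis by (rule that)
qed

lemma log_average_power:
  shows "log_integrable \<kappa> (\<lambda>x. k * x powr - \<kappa>)"
    and "(log_average \<kappa> (\<lambda>x. k * x powr - \<kappa>) \<longlongrightarrow> k) (at_right 0)"
proof -
  have eq: "x powr \<kappa> * (k * x powr - \<kappa>) / x = k / x" if "0 < x" for x :: real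
    using that by (simp add: powr_minus)
  show int: "log_integrable \<kappa> (\<lambda>x. k * x powr - \<kappa>)"
    unfolding log_integrable_def
  proof (intro allI impI)
    fix a b :: real assume a: "0 < a"
    have "set_integrable lborel {a..b} (\<lambda>x. x powr \<kappa> * (k * x powr - \<kappa>) / x)"
      by (intro borel_integrable_atLeastAtMost' continuous_intros) (use a in auto)
    then show "set_integrable lborel {a..b} (\<lambda>x. x powr \<kappa> * (k * x powr - \<kappa>) / x)" .
  qed
  have "\<forall>\<^sub>F T in at_right 0. k = log_average \<kappa> (\<lambda>x. k * x powr - \<kappa>) T"
    using eventually_at_right_real[OF zero_less_one]
  proof eventually_elim
    case (elim T)
    then have T: "0 < T" "T < 1" by auto
    have "((\<lambda>x. k / x) has_integral (k * ln 1 - k * ln T)) {T..1}"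
    proof (rule fundamental_theorem_of_calculus)
      fix x assume "x \<in> {T..1}"
      then have "((\<lambda>x. k * ln x) has_real_derivative k / x) (at x within {T..1})"
        using T by (auto intro!: derivative_eq_intros)
      then show "((\<lambda>x. k * ln x) has_vector_derivative k / x) (at x within {T..1})"
        by (simp add: has_real_derivative_iff_has_vector_derivative)
    qed (use T in simp)
    then have "integral {T..1} (\<lambda>x. x powr \<kappa> * (k * x powr - \<kappa>) / x) = - k * ln T"
      using T eq by (subst integral_cong[of _ _ "\<lambda>x. k / x"]) (auto dest: integral_unique)
    then have "log_integral \<kappa> (\<lambda>x. k * x powr - \<kappa>) T 1 = - k * ln T"
      unfolding log_integral_def
      by (subst set_borel_integral_eq_integral(2)[OF log_integrableD[OF int T(1)]])
    moreover have "ln T < 0" using T by simp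
    ultimately show ?case by (simp add: log_average_def field_simps)
  qed
  then show "(log_average \<kappa> (\<lambda>x. k * x powr - \<kappa>) \<longlongrightarrow> k) (at_right 0)"
    by (rule Lim_transform_eventually[OF tendsto_const])
qed

lemma log_average_le_limit:
  assumes V: "log_integrable \<kappa> V" and W: "log_integrable \<kappa> W"
    and x0: "0 < x0" and le: "\<And>x. 0 < x \<Longrightarrow> x \<le> x0 \<Longrightarrow> V x \<le> W x"
    and lV: "(log_average \<kappa> V \<longlongrightarrow> l) (at_right 0)" and lW: "(log_average \<kappa> W \<longlongrightarrow> m) (at_right 0)"
  shows "l \<le> m"
proof -
  obtain C where C: "\<forall>\<^sub>F T in at_right 0. log_average \<kappa> V T \<le> log_average \<kappa> W T + C * inverse \<bar>ln T\<bar>"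
    using log_average_eventually_le[OF V W x0 le] by blast
  have "((\<lambda>T. log_average \<kappa> W T + C * inverse \<bar>ln T\<bar>) \<longlongrightarrow> m + C * 0) (at_right 0)"
    by (intro tendsto_intros lW tendsto_inverse_abs_ln)
  from tendsto_le[OF trivial_limit_at_right_real this lV C] show ?thesis by simp
qed

text \<open>A limit of \<open>x\<^sup>\<kappa> V(x)\<close> is also the limit of the averages; here the limit of the averages is known to exist, and
\<open>V\<close> is compared with pure powers.\<close>

lemma log_average_eq_limit:
  assumes V: "log_integrable \<kappa> V" and lV: "(log_average \<kappa> V \<longlongrightarrow> M) (at_right 0)"
    and lim: "((\<lambda>x. x powr \<kappa> * V x) \<longlongrightarrow> L) (at_right 0)"
  shows "L = M"
proof -
  have close: "L - \<epsilon> \<le> M \<and> M \<le> L + \<epsilon>" if \<epsilon>: "0 < \<epsilon>" for \<epsilon>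
  proof -
    have "\<forall>\<^sub>F x in at_right 0. dist (x powr \<kappa> * V x) L < \<epsilon>" using lim \<epsilon> by (rule tendstoD)
    then obtain x1 where x1: "0 < x1" "\<And>x. 0 < x \<Longrightarrow> x < x1 \<Longrightarrow> dist (x powr \<kappa> * V x) L < \<epsilon>"
      unfolding eventually_at_right_field by blast
    \<comment> \<open>The pure power \<open>k x\<^sup>-\<^sup>\<kappa>\<close> has all its logarithmic averages equal to \<open>k\<close>.\<close>
    have b: "(L - \<epsilon>) * x powr - \<kappa> \<le> V x \<and> V x \<le> (L + \<epsilon>) * x powr - \<kappa>" if "0 < x" "x \<le> x1 / 2" for x
    proof -
      have "L - \<epsilon> \<le> x powr \<kappa> * V x" "x powr \<kappa> * V x \<le> L + \<epsilon>"
        using x1(2)[of x] x1(1) that unfolding dist_real_def by linarith+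
      then have "(L - \<epsilon>) * x powr - \<kappa> \<le> (x powr \<kappa> * V x) * x powr - \<kappa>"
        "(x powr \<kappa> * V x) * x powr - \<kappa> \<le> (L + \<epsilon>) * x powr - \<kappa>"
        by (intro mult_right_mono; simp)+
      moreover have "(x powr \<kappa> * V x) * x powr - \<kappa> = V x" using that by (simp add: powr_minus)
      ultimately show ?thesis by simp
    qed
    have "0 < x1 / 2" using x1 by simp
    have "L - \<epsilon> \<le> M"
      by (rule log_average_le_limit[OF log_average_power(1) V _ _ log_average_power(2) lV])
         (fact, use b in blast)
    moreover have "M \<le> L + \<epsilon>"
      by (rule log_average_le_limit[OF V log_average_power(1) _ _ lV log_average_power(2)])
         (fact, use b in blast)
    ultimately show ?thesis by simp
  qed
  have *: "L \<le> M + \<epsilon>" "M \<le> L + \<epsilon>" if "0 < \<epsilon>" for \<epsilon>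
    using close[OF that] by linarith+
  show ?thesis
  proof (rule antisym)
    show "L \<le> M" by (rule field_le_epsilon) (rule *(1))
    show "M \<le> L" by (rule field_le_epsilon) (rule *(2))
  qed
qed

section \<open>Comparison of functions across scales\<close>

lemma tendsto_squeeze_powers:
  fixes X :: "real \<Rightarrow> real"
  assumes L: "0 \<le> L" and F: "F \<noteq> bot"
    and up: "\<And>\<eta>. 0 < \<eta> \<Longrightarrow> \<exists>Y u. (Y \<longlongrightarrow> u) F \<and> u \<le> (1 + \<eta>) ^ k * L \<and> (\<forall>\<^sub>F T in F. X T \<le> Y T)"
    and lo: "\<And>\<eta>. 0 < \<eta> \<Longrightarrow> \<exists>Y l. (Y \<longlongrightarrow> l) F \<and> L \<le> (1 + \<eta>) ^ k * l \<and> (\<forall>\<^sub>F T in F. Y T \<le> X T)"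
  shows "(X \<longlongrightarrow> L) F"
proof (rule order_tendstoI)
  fix y assume y: "L < y"
  have "((\<lambda>\<eta>. (1 + \<eta>) ^ k * L) \<longlongrightarrow> (1 + 0) ^ k * L) (at_right 0)" by (intro tendsto_intros)
  then have "\<forall>\<^sub>F \<eta> in at_right (0::real). (1 + \<eta>) ^ k * L < y" by (rule order_tendstoD) (use y in simp)
  with eventually_at_right_less[of 0] have "\<forall>\<^sub>F \<eta> in at_right (0::real). 0 < \<eta> \<and> (1 + \<eta>) ^ k * L < y"
    by eventually_elim auto
  then obtain \<eta> :: real where \<eta>: "0 < \<eta>" "(1 + \<eta>) ^ k * L < y"
    using eventually_happens[of _ "at_right (0::real)"] by force
  obtain Y u where Y: "(Y \<longlongrightarrow> u) F" "u \<le> (1 + \<eta>) ^ k * L" "\<forall>\<^sub>F T in F. X T \<le> Y T"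
    using up[OF \<eta>(1)] by blast
  have "\<forall>\<^sub>F T in F. Y T < y" by (rule order_tendstoD(2)[OF Y(1)]) (use Y \<eta> in linarith)
  with Y(3) show "\<forall>\<^sub>F T in F. X T < y" by eventually_elim auto
next
  fix y assume y: "y < L"
  have "((\<lambda>\<eta>. (1 + \<eta>) ^ k * y) \<longlongrightarrow> (1 + 0) ^ k * y) (at_right 0)" by (intro tendsto_intros)
  then have "\<forall>\<^sub>F \<eta> in at_right (0::real). (1 + \<eta>) ^ k * y < L" by (rule order_tendstoD) (use y in simp)
  with eventually_at_right_less[of 0] have "\<forall>\<^sub>F \<eta> in at_right (0::real). 0 < \<eta> \<and> (1 + \<eta>) ^ k * y < L"
    by eventually_elim auto
  then obtain \<eta> :: real where \<eta>: "0 < \<eta>" "(1 + \<eta>) ^ k * y < L"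
    using eventually_happens[of _ "at_right (0::real)"] by force
  obtain Y l where Y: "(Y \<longlongrightarrow> l) F" "L \<le> (1 + \<eta>) ^ k * l" "\<forall>\<^sub>F T in F. Y T \<le> X T"
    using lo[OF \<eta>(1)] by blast
  have "(1 + \<eta>) ^ k * y < (1 + \<eta>) ^ k * l" using \<eta> Y by linarith
  then have "y < l" using \<eta> by simp
  then have "\<forall>\<^sub>F T in F. y < Y T" by (rule order_tendstoD(1)[OF Y(1)])
  with Y(3) show "\<forall>\<^sub>F T in F. y < X T" by eventually_elim auto
qed

text \<open>\<open>W\<close> is enclosed near \<open>0\<close> between finite combinations of rescaled copies of \<open>V\<close>. If \<open>x\<^sup>\<kappa> V(x)\<close> tends to \<open>M\<close>, then
\<open>x\<^sup>\<kappa> V(u x)\<close> tends to \<open>M u\<^sup>-\<^sup>\<kappa>\<close>; the two sums at the end are thus the factors by which the combinations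
multiply a limit. Up to \<open>(1 + \<eta>)\<^sup>k\<close> with \<open>\<eta>\<close> arbitrarily small, the lower factor is at least and the upper one at
most \<open>c\<close>. The index type is that of the words that number the cylinders.\<close>

definition comparable :: "real \<Rightarrow> (real \<Rightarrow> real) \<Rightarrow> (real \<Rightarrow> real) \<Rightarrow> nat \<Rightarrow> real \<Rightarrow> bool" where
  "comparable \<kappa> V W k c \<longleftrightarrow> (\<forall>\<eta>>0. \<exists>(A :: nat list set) b u b' u' e0. finite A \<and> 0 < e0 \<and>
     (\<forall>w\<in>A. 0 < u w \<and> 0 < u' w \<and> 0 \<le> b w \<and> 0 \<le> b' w) \<and>
     (\<forall>e. 0 < e \<and> e \<le> e0 \<longrightarrow> (\<Sum>w\<in>A. b w * V (u w * e)) \<le> W e \<and> W e \<le> (\<Sum>w\<in>A. b' w * V (u' w * e))) \<and>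
     c \<le> (1 + \<eta>) ^ k * (\<Sum>w\<in>A. b w * u w powr - \<kappa>) \<and>
     (\<Sum>w\<in>A. b' w * u' w powr - \<kappa>) \<le> (1 + \<eta>) ^ k * c)"

lemma comparableE:
  assumes "comparable \<kappa> V W k c" "0 < \<eta>"
  obtains A :: "nat list set" and b u b' u' e0 where "finite A" "0 < e0"
    "\<And>w. w\<in>A \<Longrightarrow> 0 < u w \<and> 0 < u' w"  "\<And>w. w\<in>A \<Longrightarrow> 0 \<le> b w \<and> 0 \<le> b' w"
    "\<And>e. 0 < e \<Longrightarrow> e \<le> e0 \<Longrightarrow> (\<Sum>w\<in>A. b w * V (u w * e)) \<le> W e"
    "\<And>e. 0 < e \<Longrightarrow> e \<le> e0 \<Longrightarrow> W e \<le> (\<Sum>w\<in>A. b' w * V (u' w * e))"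
    "c \<le> (1 + \<eta>) ^ k * (\<Sum>w\<in>A. b w * u w powr - \<kappa>)"
    "(\<Sum>w\<in>A. b' w * u' w powr - \<kappa>) \<le> (1 + \<eta>) ^ k * c"
proof -
  from assms(1)[unfolded comparable_def, rule_format, OF assms(2)]
  obtain A :: "nat list set" and b u b' u' e0 where H: "finite A" "0 < e0"
     "\<forall>w\<in>A. 0 < u w \<and> 0 < u' w \<and> 0 \<le> b w \<and> 0 \<le> b' w"
     "\<forall>e. 0 < e \<and> e \<le> e0 \<longrightarrow> (\<Sum>w\<in>A. b w * V (u w * e)) \<le> W e \<and> W e \<le> (\<Sum>w\<in>A. b' w * V (u' w * e))"
     "c \<le> (1 + \<eta>) ^ k * (\<Sum>w\<in>A. b w * u w powr - \<kappa>)"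
     "(\<Sum>w\<in>A. b' w * u' w powr - \<kappa>) \<le> (1 + \<eta>) ^ k * c"
    by (elim exE conjE) (rule that)
  show ?thesis
    by (rule that[of A e0 u u' b b']) (use H in \<open>simp_all\<close>)
qed

lemma comparable_log_average:
  assumes cmp: "comparable \<kappa> V W k c" and c: "0 \<le> c" and M: "0 \<le> M"
    and V: "log_integrable \<kappa> V" and W: "log_integrable \<kappa> W" and lim: "(log_average \<kappa> V \<longlongrightarrow> M) (at_right 0)"
  shows "(log_average \<kappa> W \<longlongrightarrow> M * c) (at_right 0)"
proof (rule tendsto_squeeze_powers)
  show "0 \<le> M * c" using c M by simp
  show "at_right (0::real) \<noteq> bot" by (rule trivial_limit_at_right_real)
  fix \<eta> :: real assume "0 < \<eta>"
  then obtain A :: "nat list set" and b u b' u' e0 where *: "finite A" "0 < e0"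
     "\<And>w. w\<in>A \<Longrightarrow> 0 < u w \<and> 0 < u' w"
     "\<And>e. 0 < e \<Longrightarrow> e \<le> e0 \<Longrightarrow> (\<Sum>w\<in>A. b w * V (u w * e)) \<le> W e"
     "\<And>e. 0 < e \<Longrightarrow> e \<le> e0 \<Longrightarrow> W e \<le> (\<Sum>w\<in>A. b' w * V (u' w * e))"
     "c \<le> (1 + \<eta>) ^ k * (\<Sum>w\<in>A. b w * u w powr - \<kappa>)"
     "(\<Sum>w\<in>A. b' w * u' w powr - \<kappa>) \<le> (1 + \<eta>) ^ k * c"
    by (rule comparableE[OF cmp]) blast
  have combo: "log_integrable \<kappa> (\<lambda>e. \<Sum>w\<in>A. a w * V (v w * e))"
    "(log_average \<kappa> (\<lambda>e. \<Sum>w\<in>A. a w * V (v w * e)) \<longlongrightarrow> (\<Sum>w\<in>A. a w * (v w powr - \<kappa> * M))) (at_right 0)"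
    if "\<And>w. w \<in> A \<Longrightarrow> 0 < v w" for a v
    using that *(1) by (auto intro!: log_integrable_sum(1) log_average_sum log_integrable_scale(1)[OF V] log_average_scale[OF V _ lim])
  have tot: "(\<Sum>w\<in>A. a w * (v w powr - \<kappa> * M)) = M * (\<Sum>w\<in>A. a w * v w powr - \<kappa>)" for a v :: "nat list \<Rightarrow> real"
    by (simp add: sum_distrib_left mult_ac)
  show "\<exists>Y y. (Y \<longlongrightarrow> y) (at_right 0) \<and> y \<le> (1 + \<eta>) ^ k * (M * c) \<and> (\<forall>\<^sub>F T in at_right 0. log_average \<kappa> W T \<le> Y T)"
  proof -
    let ?W = "\<lambda>e. \<Sum>w\<in>A. b' w * V (u' w * e)"
    have u': "\<And>w. w \<in> A \<Longrightarrow> 0 < u' w" using *(3) by auto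
    obtain C where C: "\<forall>\<^sub>F T in at_right 0. log_average \<kappa> W T \<le> log_average \<kappa> ?W T + C * inverse \<bar>ln T\<bar>"
      using log_average_eventually_le[OF W combo(1)[of u' b', OF u'] *(2) *(5)] by blast
    have "((\<lambda>T. log_average \<kappa> ?W T + C * inverse \<bar>ln T\<bar>) \<longlongrightarrow> M * (\<Sum>w\<in>A. b' w * u' w powr - \<kappa>) + C * 0) (at_right 0)"
      unfolding tot[symmetric] by (intro tendsto_intros combo(2) u' tendsto_inverse_abs_ln)
    moreover have "M * (\<Sum>w\<in>A. b' w * u' w powr - \<kappa>) + C * 0 \<le> (1 + \<eta>) ^ k * (M * c)"
      using mult_left_mono[OF *(7) M] by (simp add: mult_ac)
    ultimately show ?thesis using C by blast
  qed
  show "\<exists>Y y. (Y \<longlongrightarrow> y) (at_right 0) \<and> M * c \<le> (1 + \<eta>) ^ k * y \<and> (\<forall>\<^sub>F T in at_right 0. Y T \<le> log_average \<kappa> W T)"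
  proof -
    let ?W = "\<lambda>e. \<Sum>w\<in>A. b w * V (u w * e)"
    have u: "\<And>w. w \<in> A \<Longrightarrow> 0 < u w" using *(3) by auto
    obtain C where C: "\<forall>\<^sub>F T in at_right 0. log_average \<kappa> ?W T \<le> log_average \<kappa> W T + C * inverse \<bar>ln T\<bar>"
      using log_average_eventually_le[OF combo(1)[of u b, OF u] W *(2) *(4)] by blast
    have "((\<lambda>T. log_average \<kappa> ?W T - C * inverse \<bar>ln T\<bar>) \<longlongrightarrow> M * (\<Sum>w\<in>A. b w * u w powr - \<kappa>) - C * 0) (at_right 0)"
      unfolding tot[symmetric] by (intro tendsto_intros combo(2) u tendsto_inverse_abs_ln)
    moreover have "M * c \<le> (1 + \<eta>) ^ k * (M * (\<Sum>w\<in>A. b w * u w powr - \<kappa>) - C * 0)"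
      using mult_left_mono[OF *(6) M] by (simp add: mult_ac)
    moreover have "\<forall>\<^sub>F T in at_right 0. log_average \<kappa> ?W T - C * inverse \<bar>ln T\<bar> \<le> log_average \<kappa> W T"
      using C by eventually_elim simp
    ultimately show ?thesis by blast
  qed
qed

lemma tendsto_scaled_sum:
  fixes V :: "real \<Rightarrow> real"
  assumes lim: "((\<lambda>e. e powr \<kappa> * V e) \<longlongrightarrow> M) (at_right 0)" and A: "finite A" "\<And>w. w \<in> A \<Longrightarrow> 0 < v w"
  shows "((\<lambda>e. e powr \<kappa> * (\<Sum>w\<in>A. a w * V (v w * e))) \<longlongrightarrow> M * (\<Sum>w\<in>A. a w * v w powr - \<kappa>)) (at_right 0)"
proof -
  have sc: "filterlim (\<lambda>T. t * T) (at_right 0) (at_right 0)" if "0 < t" for t :: real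
    using that by (auto simp: filterlim_at intro!: tendsto_eq_intros eventually_at_right_less[THEN eventually_mono])
  have "((\<lambda>e. \<Sum>w\<in>A. (a w * v w powr - \<kappa>) * ((v w * e) powr \<kappa> * V (v w * e))) \<longlongrightarrow> (\<Sum>w\<in>A. (a w * v w powr - \<kappa>) * M)) (at_right 0)"
    by (intro tendsto_sum tendsto_mult_left filterlim_compose[OF lim sc] A)
  moreover have "\<forall>\<^sub>F e in at_right 0. (\<Sum>w\<in>A. (a w * v w powr - \<kappa>) * ((v w * e) powr \<kappa> * V (v w * e)))
      = e powr \<kappa> * (\<Sum>w\<in>A. a w * V (v w * e))"
    using eventually_at_right_less[of 0]
  proof eventually_elim
    case (elim e)
    show ?case unfolding sum_distrib_left
    proof (rule sum.cong[OF refl])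
      fix w assume "w \<in> A"
      then have "0 < v w" by (rule A)
      then show "a w * v w powr - \<kappa> * ((v w * e) powr \<kappa> * V (v w * e)) = e powr \<kappa> * (a w * V (v w * e))"
        using elim by (simp add: powr_mult powr_minus)
    qed
  qed
  ultimately show ?thesis by (simp add: tendsto_cong sum_distrib_left mult_ac)
qed

lemma comparable_limit:
  assumes cmp: "comparable \<kappa> V W k c" and c: "0 \<le> c" and M: "0 \<le> M"
    and lim: "((\<lambda>e. e powr \<kappa> * V e) \<longlongrightarrow> M) (at_right 0)"
  shows "((\<lambda>e. e powr \<kappa> * W e) \<longlongrightarrow> M * c) (at_right 0)"
proof (rule tendsto_squeeze_powers)
  show "0 \<le> M * c" using c M by simp
  show "at_right (0::real) \<noteq> bot" by (rule trivial_limit_at_right_real)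
  fix \<eta> :: real assume "0 < \<eta>"
  then obtain A :: "nat list set" and b u b' u' e0 where *: "finite A" "0 < e0"
     "\<And>w. w\<in>A \<Longrightarrow> 0 < u w \<and> 0 < u' w"
     "\<And>e. 0 < e \<Longrightarrow> e \<le> e0 \<Longrightarrow> (\<Sum>w\<in>A. b w * V (u w * e)) \<le> W e"
     "\<And>e. 0 < e \<Longrightarrow> e \<le> e0 \<Longrightarrow> W e \<le> (\<Sum>w\<in>A. b' w * V (u' w * e))"
     "c \<le> (1 + \<eta>) ^ k * (\<Sum>w\<in>A. b w * u w powr - \<kappa>)"
     "(\<Sum>w\<in>A. b' w * u' w powr - \<kappa>) \<le> (1 + \<eta>) ^ k * c"
    by (rule comparableE[OF cmp]) blast
  have ev: "\<forall>\<^sub>F e in at_right 0. 0 < e \<and> e \<le> e0"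
    using eventually_at_right_real[OF *(2)] by eventually_elim auto
  show "\<exists>Y y. (Y \<longlongrightarrow> y) (at_right 0) \<and> y \<le> (1 + \<eta>) ^ k * (M * c) \<and> (\<forall>\<^sub>F e in at_right 0. e powr \<kappa> * W e \<le> Y e)"
  proof (intro exI conjI)
    show "((\<lambda>e. e powr \<kappa> * (\<Sum>w\<in>A. b' w * V (u' w * e))) \<longlongrightarrow> M * (\<Sum>w\<in>A. b' w * u' w powr - \<kappa>)) (at_right 0)"
      by (rule tendsto_scaled_sum[OF lim *(1)]) (use *(3) in auto)
    show "M * (\<Sum>w\<in>A. b' w * u' w powr - \<kappa>) \<le> (1 + \<eta>) ^ k * (M * c)"
      using mult_left_mono[OF *(7) M] by (simp add: mult_ac)
    show "\<forall>\<^sub>F e in at_right 0. e powr \<kappa> * W e \<le> e powr \<kappa> * (\<Sum>w\<in>A. b' w * V (u' w * e))"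
      using ev by eventually_elim (intro mult_left_mono *(5), auto)
  qed
  show "\<exists>Y y. (Y \<longlongrightarrow> y) (at_right 0) \<and> M * c \<le> (1 + \<eta>) ^ k * y \<and> (\<forall>\<^sub>F e in at_right 0. Y e \<le> e powr \<kappa> * W e)"
  proof (intro exI conjI)
    show "((\<lambda>e. e powr \<kappa> * (\<Sum>w\<in>A. b w * V (u w * e))) \<longlongrightarrow> M * (\<Sum>w\<in>A. b w * u w powr - \<kappa>)) (at_right 0)"
      by (rule tendsto_scaled_sum[OF lim *(1)]) (use *(3) in auto)
    show "M * c \<le> (1 + \<eta>) ^ k * (M * (\<Sum>w\<in>A. b w * u w powr - \<kappa>))"
      using mult_left_mono[OF *(6) M] by (simp add: mult_ac)
    show "\<forall>\<^sub>F e in at_right 0. e powr \<kappa> * (\<Sum>w\<in>A. b w * V (u w * e)) \<le> e powr \<kappa> * W e"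
      using ev by eventually_elim (intro mult_left_mono *(4), auto)
  qed
qed

section \<open>Parallel volume of a self-similar set\<close>

lemma has_minkowski_dim_unique: "has_minkowski_dim Y a \<Longrightarrow> has_minkowski_dim Y b \<Longrightarrow> a = b"
  by (simp add: has_minkowski_dim_def)

lemma minkowski_dim_eq: "has_minkowski_dim Y a \<Longrightarrow> minkowski_dim Y = a"
  unfolding minkowski_dim_def using has_minkowski_dim_unique by (intro the_equality) auto

text \<open>The logarithm of \<open>e\<^bsup>\<delta> - d\<^esup> V(e)\<close> stays bounded, so it does not contribute to the quotient by \<open>ln e\<close>.\<close>

lemma has_minkowski_dimI:
  fixes Y :: "(real^'d) set"
  assumes a: "0 < a" and e0: "0 < e0"
    and bnd: "\<And>e. 0 < e \<Longrightarrow> e \<le> e0 \<Longrightarrow>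
       a \<le> e powr (\<delta> - real CARD('d)) * parallel_volume Y e \<and> e powr (\<delta> - real CARD('d)) * parallel_volume Y e \<le> b"
  shows "has_minkowski_dim Y \<delta>"
proof -
  let ?d = "real CARD('d)"
  let ?Q = "\<lambda>e. e powr (\<delta> - ?d) * parallel_volume Y e"
  define B where "B = \<bar>ln a\<bar> + \<bar>ln b\<bar>"
  have small: "\<forall>\<^sub>F e in at_right (0::real). 0 < e \<and> e < 1 \<and> e \<le> e0"
    using eventually_at_right_real[OF e0] eventually_at_right_real[OF zero_less_one]
    by eventually_elim auto
  have "((\<lambda>e. B * inverse \<bar>ln e\<bar>) \<longlongrightarrow> B * 0) (at_right 0)"
    by (intro tendsto_intros tendsto_inverse_abs_ln)
  then have B0: "((\<lambda>e. B * inverse \<bar>ln e\<bar>) \<longlongrightarrow> 0) (at_right 0)" by simp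
  have "((\<lambda>e. ln (?Q e) * inverse (ln e)) \<longlongrightarrow> 0) (at_right 0)"
  proof (rule Lim_null_comparison[OF _ B0])
    show "\<forall>\<^sub>F e in at_right 0. norm (ln (?Q e) * inverse (ln e)) \<le> B * inverse \<bar>ln e\<bar>"
      using small
    proof eventually_elim
      case (elim e)
      then have "a \<le> ?Q e" "?Q e \<le> b" using bnd by auto
      then have "ln a \<le> ln (?Q e)" "ln (?Q e) \<le> ln b" using a by (auto simp del: ln_mult)
      then have "\<bar>ln (?Q e)\<bar> \<le> B" unfolding B_def by linarith
      then show ?case by (simp only: real_norm_def abs_mult abs_inverse) (simp add: mult_right_mono)
    qed
  qed
  then have "((\<lambda>e. ln (?Q e) * inverse (ln e) + (?d - \<delta>)) \<longlongrightarrow> 0 + (?d - \<delta>)) (at_right 0)"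
    by (intro tendsto_add tendsto_const)
  moreover have "\<forall>\<^sub>F e in at_right 0. ln (?Q e) * inverse (ln e) + (?d - \<delta>) = ln (parallel_volume Y e) / ln e"
    using small
  proof eventually_elim
    case (elim e)
    have "0 < ?Q e" using bnd[of e] elim a by auto
    then have "0 < parallel_volume Y e" using elim by (simp add: zero_less_mult_iff)
    then have "ln (?Q e) = (\<delta> - ?d) * ln e + ln (parallel_volume Y e)"
      using elim by (simp add: ln_mult_pos ln_powr)
    moreover have "ln e \<noteq> 0" using elim by (simp add: ln_eq_zero_iff)
    ultimately show ?case by (simp add: field_simps)
  qed
  ultimately have "((\<lambda>e. ln (parallel_volume Y e) / ln e) \<longlongrightarrow> ?d - \<delta>) (at_right 0)"
    by (simp add: tendsto_cong)
  then have "((\<lambda>e. ereal (ln (parallel_volume Y e) / ln e)) \<longlongrightarrow> ereal (?d - \<delta>)) (at_right 0)"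
    by (intro tendsto_intros)
  then have "Liminf (at_right 0) (\<lambda>e. ereal (ln (parallel_volume Y e) / ln e)) = ereal (?d - \<delta>)"
    "Limsup (at_right 0) (\<lambda>e. ereal (ln (parallel_volume Y e) / ln e)) = ereal (?d - \<delta>)"
    using lim_imp_Liminf lim_imp_Limsup trivial_limit_at_right_real by blast+
  then show ?thesis
    by (simp add: has_minkowski_dim_def upper_minkowski_dim_def lower_minkowski_dim_def)
qed

text \<open>The sum decreases continuously from \<open>N > 1\<close> at \<open>0\<close> to \<open>0\<close> at infinity.\<close>

lemma similarity_dimension_exists:
  fixes r :: "nat \<Rightarrow> real"
  assumes N: "N \<ge> 2" and r: "\<And>i. i \<in> {1..N} \<Longrightarrow> 0 < r i \<and> r i < 1"
  obtains s where "0 < s" "(\<Sum>i=1..N. r i powr s) = 1"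
proof -
  let ?f = "\<lambda>t. \<Sum>i=1..N. r i powr t"
  have "((\<lambda>t. r i powr t) \<longlongrightarrow> 0) at_top" if "i \<in> {1..N}" for i
  proof -
    have "LIM t at_top. ln (r i) * t :> at_bot"
      by (rule filterlim_tendsto_neg_mult_at_bot[OF tendsto_const _ filterlim_ident]) (use r[OF that] in auto)
    then have "((\<lambda>t. exp (ln (r i) * t)) \<longlongrightarrow> 0) at_top" by (rule filterlim_compose[OF exp_at_bot])
    then show ?thesis using r[OF that] by (simp add: powr_def mult.commute)
  qed
  then have "(?f \<longlongrightarrow> (\<Sum>i=1..N. 0)) at_top" by (intro tendsto_sum) auto
  then have "\<forall>\<^sub>F t in at_top. ?f t < 1" by (intro order_tendstoD(2)) auto
  with eventually_gt_at_top[of 0] have "\<forall>\<^sub>F t in at_top. 0 < t \<and> ?f t < 1" by eventually_elim auto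
  then obtain t where t: "0 < t" "?f t < 1" using eventually_happens[of _ "at_top :: real filter"] by force
  have f0: "?f 0 = real N"
  proof -
    have "?f 0 = (\<Sum>i=1..N. 1)" using r by (intro sum.cong) force+
    then show ?thesis by simp
  qed
  have cont: "continuous_on {0..t} ?f" using r by (intro continuous_intros) force+
  obtain s where s: "0 \<le> s" "s \<le> t" "?f s = 1"
    using IVT2'[of ?f t 1 0] cont t f0 N by force
  have "s \<noteq> 0" using f0 s N by auto
  then show ?thesis using s that[of s] by auto
qed

locale self_similar_set_vec = self_similar_set I \<phi> r K s
  for I :: "'i set" and \<phi> :: "'i \<Rightarrow> real^'d \<Rightarrow> real^'d" and r K s +
  fixes \<kappa> :: real
  assumes \<kappa>_eq: "\<kappa> = s - real CARD('d)"
begin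

abbreviation "V \<equiv> parallel_volume K"

sublocale renewal_weights I r "\<lambda>i. r i powr s"
proof
  show "0 < r i powr s" if "i \<in> I" for i using r_pos[OF that] by simp
qed (use finI r_pos contr s_sum in auto)

lemma V_nonneg: "0 \<le> V e" and V_mono: "0 < a \<Longrightarrow> a \<le> b \<Longrightarrow> V a \<le> V b" and V_pos: "0 < a \<Longrightarrow> 0 < V a"
  using parallel_volume_nonneg parallel_volume_mono[OF K_cpt K_ne] parallel_volume_pos[OF K_cpt K_ne] by auto

lemma log_integrable_V: "log_integrable \<kappa> V"
  by (rule log_integrable_monotone) (auto intro: V_nonneg V_mono)

lemma volume_piece: "i \<in> I \<Longrightarrow> 0 < e \<Longrightarrow> parallel_volume (\<phi> i ` K) e = r i ^ CARD('d) * V (e / r i)"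
  by (rule parallel_volume_similarity[OF sim K_cpt K_ne])

text \<open>The threshold is chosen below every ratio, so that \<open>e / r\<^sub>i \<le> 1\<close> and all indicators in the scaling function are
\<open>1\<close> on \<open>(0, e0]\<close>; the scaling function vanishes there.\<close>

lemma volume_recursion:
  obtains e0 where "0 < e0" "e0 \<le> rmin" "\<And>e. 0 < e \<Longrightarrow> e \<le> e0 \<Longrightarrow> V e = (\<Sum>i\<in>I. parallel_volume (\<phi> i ` K) e)"
proof -
  have ne: "\<phi> i ` K \<noteq> {}" for i using K_ne by simp
  obtain e1 where e1: "0 < e1"
    "\<And>e. 0 < e \<Longrightarrow> e \<le> e1 \<Longrightarrow> parallel_volume (\<Union>i\<in>I. \<phi> i ` K) e = (\<Sum>i\<in>I. parallel_volume (\<phi> i ` K) e)"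
    using parallel_volume_disjoint_UN[OF finI nonempty compact_piece ne disj] by metis
  have "V e = (\<Sum>i\<in>I. parallel_volume (\<phi> i ` K) e)" if "0 < e" "e \<le> min e1 rmin" for e
    using e1(2)[of e] that by (simp add: K_eq[symmetric])
  then show ?thesis using that[of "min e1 rmin"] e1(1) rmin_pos by simp
qed

lemma r_power: "i \<in> I \<Longrightarrow> r i ^ CARD('d) * r i powr \<kappa> = r i powr s"
  using r_pos by (simp add: \<kappa>_eq powr_realpow[symmetric] powr_add[symmetric])

lemma density_recursion:
  assumes e: "0 < e" and rec: "V e = (\<Sum>i\<in>I. parallel_volume (\<phi> i ` K) e)"
  shows "e powr \<kappa> * V e = (\<Sum>i\<in>I. r i powr s * ((e / r i) powr \<kappa> * V (e / r i)))"
  unfolding rec sum_distrib_left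
proof (rule sum.cong[OF refl])
  fix i assume i: "i \<in> I"
  have "r i powr \<kappa> * (e / r i) powr \<kappa> = e powr \<kappa>"
    using r_pos[OF i] e by (simp add: powr_mult[symmetric])
  then show "e powr \<kappa> * parallel_volume (\<phi> i ` K) e = r i powr s * ((e / r i) powr \<kappa> * V (e / r i))"
    using volume_piece[OF i e] r_power[OF i] by (metis mult.assoc mult.commute)
qed

text \<open>On \<open>[e0, 1]\<close> the bounds follow from monotonicity of the volume, and the renewal equation carries them to all
smaller scales.\<close>

lemma density_bounds:
  obtains a b where "0 < a" "\<And>e. 0 < e \<Longrightarrow> e \<le> 1 \<Longrightarrow> a \<le> e powr \<kappa> * V e \<and> e powr \<kappa> * V e \<le> b"
proof -
  obtain e0 where e0: "0 < e0" "e0 \<le> rmin" "\<And>e. 0 < e \<Longrightarrow> e \<le> e0 \<Longrightarrow> V e = (\<Sum>i\<in>I. parallel_volume (\<phi> i ` K) e)"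
    using volume_recursion by blast
  define m where "m = min (e0 powr \<kappa>) 1"
  define M where "M = max (e0 powr \<kappa>) 1"
  have p: "m \<le> e powr \<kappa> \<and> e powr \<kappa> \<le> M" if "e0 \<le> e" "e \<le> 1" for e
  proof (cases "\<kappa> \<ge> 0")
    case True
    have "e0 powr \<kappa> \<le> e powr \<kappa>" "e powr \<kappa> \<le> 1 powr \<kappa>" using True that e0 by (intro powr_mono2; simp)+
    then show ?thesis by (simp add: m_def M_def)
  next
    case False
    have "e powr \<kappa> \<le> e0 powr \<kappa>" "1 powr \<kappa> \<le> e powr \<kappa>" using False that e0 by (intro powr_mono2'; simp)+
    then show ?thesis by (simp add: m_def M_def)
  qed
  have m0: "0 < m" using e0 by (simp add: m_def)
  have top: "m * V e0 \<le> e powr \<kappa> * V e \<and> e powr \<kappa> * V e \<le> M * V 1" if "e0 \<le> e" "e \<le> 1" for e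
    using p[OF that] V_mono[of e0 e] V_mono[of e 1] V_nonneg m0 that e0(1) by (auto intro!: mult_mono)
  have e1: "e0 / rmin \<le> 1" using e0 rmin_pos by simp
  have rec: "e powr \<kappa> * V e = (\<Sum>i\<in>I. r i powr s * ((e / r i) powr \<kappa> * V (e / r i)))" if "0 < e" "e \<le> e0" for e
    using density_recursion[OF that(1) e0(3)[OF that]] .
  show ?thesis
  proof (rule that)
    show "0 < m * V e0" using m0 V_pos[OF e0(1)] by simp
    fix e :: real assume e: "0 < e" "e \<le> 1"
    show "m * V e0 \<le> e powr \<kappa> * V e \<and> e powr \<kappa> * V e \<le> M * V 1"
    proof (cases "e0 \<le> e")
      case True
      then show ?thesis using top e by blast
    next
      case False
      have "e0 * rmin \<le> e0 * 1" using e0 rmin_less by (intro mult_left_mono) auto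
      then have "e \<le> e0 / rmin" using False e0 rmin_pos e by (simp add: le_divide_eq) (smt (verit) mult_left_le rmin_less)
      then show ?thesis
        using renewal_lower_bound[of e0 "\<lambda>e. e powr \<kappa> * V e" "m * V e0" e, OF e0(1) rec _ e(1)]
          renewal_upper_bound[of e0 "\<lambda>e. e powr \<kappa> * V e" "M * V 1" e, OF e0(1) rec _ e(1)] top e1 by force
    qed
  qed
qed

lemma has_minkowski_dim_K: "has_minkowski_dim K s"
proof -
  obtain a b where ab: "0 < a" "\<And>e. 0 < e \<Longrightarrow> e \<le> 1 \<Longrightarrow> a \<le> e powr \<kappa> * V e \<and> e powr \<kappa> * V e \<le> b"
    using density_bounds by blast
  show ?thesis
    using has_minkowski_dimI[OF ab(1) zero_less_one, of s K b] ab(2)[unfolded \<kappa>_eq] by blast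
qed

definition scaling_integral :: real where
  "scaling_integral = (LINT e:{0<..1}|lborel. e powr (\<kappa> - 1) *
     (V e - (\<Sum>i\<in>I. indicator {0<..r i} e * parallel_volume (\<phi> i ` K) e)))"

text \<open>Integrating the definition of the scaling function over \<open>[T, 1]\<close> and substituting \<open>x = e / r\<^sub>i\<close> in the \<open>i\<close>-th summand
gives the inhomogeneous renewal equation for the integral of the density of \<open>K\<close>.\<close>

lemma log_average_K: "(log_average \<kappa> V \<longlongrightarrow> scaling_integral / mean) (at_right 0)"
proof -
  obtain e0 where e0: "0 < e0" "e0 \<le> rmin" "\<And>e. 0 < e \<Longrightarrow> e \<le> e0 \<Longrightarrow> V e = (\<Sum>i\<in>I. parallel_volume (\<phi> i ` K) e)"
    using volume_recursion by blast
  let ?R = "\<lambda>e. V e - (\<Sum>i\<in>I. indicator {0<..r i} e * parallel_volume (\<phi> i ` K) e)"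
  have R0: "?R e = 0" if e: "0 < e" "e \<le> e0" for e
  proof -
    have "(\<Sum>i\<in>I. indicator {0<..r i} e * parallel_volume (\<phi> i ` K) e) = (\<Sum>i\<in>I. parallel_volume (\<phi> i ` K) e)"
    proof (rule sum.cong[OF refl])
      fix i assume "i \<in> I"
      then have "e \<le> r i" using e e0(2) rmin_le by force
      then show "indicator {0<..r i} e * parallel_volume (\<phi> i ` K) e = parallel_volume (\<phi> i ` K) e" using e by simp
    qed
    then show ?thesis using e0(3)[OF e] by simp
  qed
  have J: "log_integral \<kappa> V T 1 = (\<Sum>i\<in>I. r i powr s * log_integral \<kappa> V (T / r i) 1) + scaling_integral"
    if T: "0 < T" "T \<le> e0" for T
  proof -
    let ?G = "\<lambda>i e. indicator {T..r i} e *\<^sub>R (e powr \<kappa> * V (1 / r i * e) / e)"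
    let ?F = "\<lambda>e. indicator {T..1} e *\<^sub>R (e powr \<kappa> * V e / e)"
    have pt: "indicator {0<..1} e *\<^sub>R (e powr (\<kappa> - 1) * ?R e) = ?F e - (\<Sum>i\<in>I. r i ^ CARD('d) * ?G i e)" for e :: real
    proof (cases "T \<le> e \<and> e \<le> 1")
      case True
      then have e: "0 < e" "e \<le> 1" "T \<le> e" using T by auto
      have p: "e powr (\<kappa> - 1) = e powr \<kappa> / e" using e by (simp add: powr_diff)
      have t: "e powr (\<kappa> - 1) * (indicator {0<..r i} e * parallel_volume (\<phi> i ` K) e) = r i ^ CARD('d) * ?G i e"
        if "i \<in> I" for i
        using e volume_piece[OF that e(1)] by (auto simp: indicator_def p)
      have "indicator {0<..1} e *\<^sub>R (e powr (\<kappa> - 1) * ?R e)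
          = e powr (\<kappa> - 1) * V e - (\<Sum>i\<in>I. e powr (\<kappa> - 1) * (indicator {0<..r i} e * parallel_volume (\<phi> i ` K) e))"
        using e by (simp add: right_diff_distrib sum_distrib_left)
      also have "\<dots> = e powr (\<kappa> - 1) * V e - (\<Sum>i\<in>I. r i ^ CARD('d) * ?G i e)"
        using t by (simp only: cong: sum.cong)
      also have "e powr (\<kappa> - 1) * V e = ?F e" using e by (simp add: p)
      finally show ?thesis .
    next
      case False
      have G: "?G i e = 0" if i: "i \<in> I" for i using False contr[OF i] by (auto simp: indicator_def)
      have "indicator {0<..1} e *\<^sub>R (e powr (\<kappa> - 1) * ?R e) = 0"
      proof (cases "0 < e \<and> e \<le> 1")
        case True
        then show ?thesis using False T R0[of e] by simp
      qed (auto simp: indicator_def)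
      moreover have "?F e = 0" using False by (auto simp: indicator_def)
      moreover have "(\<Sum>i\<in>I. r i ^ CARD('d) * ?G i e) = 0"
      proof (rule sum.neutral, rule ballI)
        fix i assume "i \<in> I"
        then show "r i ^ CARD('d) * ?G i e = 0" by (simp only: G mult_zero_right)
      qed
      ultimately show ?thesis by (simp only: diff_zero)
    qed
    have iF: "integrable lborel ?F" using log_integrableD[OF log_integrable_V T(1), of 1] by (simp add: set_integrable_def)
    have sc: "log_integrable \<kappa> (\<lambda>x. V (1 / r i * x))" if "i \<in> I" for i
      using log_integrable_scale(1)[OF log_integrable_V, of "1 / r i"] r_pos[OF that] by simp
    have iG: "integrable lborel (?G i)" if "i \<in> I" for i
      using log_integrableD[OF sc[OF that] T(1), of "r i"] by (simp add: set_integrable_def)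
    have vG: "r i ^ CARD('d) * (\<integral>e. ?G i e \<partial>lborel) = r i powr s * log_integral \<kappa> V (T / r i) 1" if i: "i \<in> I" for i
    proof -
      have "(\<integral>e. ?G i e \<partial>lborel) = log_integral \<kappa> (\<lambda>x. V (1 / r i * x)) T (r i)"
        by (simp add: log_integral_def set_lebesgue_integral_def)
      also have "\<dots> = (1 / r i) powr - \<kappa> * log_integral \<kappa> V (1 / r i * T) (1 / r i * r i)"
        using r_pos[OF i] by (intro log_integrable_scale(2)[OF log_integrable_V _ T(1)]) simp
      also have "(1 / r i) powr - \<kappa> = r i powr \<kappa>"
        using r_pos[OF i] by (simp add: powr_minus powr_divide)
      finally have "(\<integral>e. ?G i e \<partial>lborel) = r i powr \<kappa> * log_integral \<kappa> V (T / r i) 1"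
        using r_pos[OF i] by simp
      then show ?thesis using r_power[OF i] by (metis mult.assoc)
    qed
    have "scaling_integral = (\<integral>e. ?F e - (\<Sum>i\<in>I. r i ^ CARD('d) * ?G i e) \<partial>lborel)"
      unfolding scaling_integral_def set_lebesgue_integral_def pt ..
    also have "\<dots> = (\<integral>e. ?F e \<partial>lborel) - (\<integral>e. (\<Sum>i\<in>I. r i ^ CARD('d) * ?G i e) \<partial>lborel)"
      by (intro Bochner_Integration.integral_diff Bochner_Integration.integrable_sum integrable_mult_right iF iG)
    also have "(\<integral>e. (\<Sum>i\<in>I. r i ^ CARD('d) * ?G i e) \<partial>lborel) = (\<Sum>i\<in>I. \<integral>e. r i ^ CARD('d) * ?G i e \<partial>lborel)"
      by (intro Bochner_Integration.integral_sum integrable_mult_right iG)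
    also have "\<dots> = (\<Sum>i\<in>I. r i powr s * log_integral \<kappa> V (T / r i) 1)"
      by (rule sum.cong[OF refl]) (simp only: integral_mult_right_zero vG)
    also have "(\<integral>e. ?F e \<partial>lborel) = log_integral \<kappa> V T 1"
      by (simp add: log_integral_def set_lebesgue_integral_def)
    finally show ?thesis by simp
  qed
  have z: "log_integrable \<kappa> (\<lambda>_. 0)" by (rule log_integrable_monotone) auto
  have nn: "0 \<le> log_integral \<kappa> V a b" if "0 < a" for a b
    using log_integral_mono[OF z log_integrable_V that, of b] V_nonneg
    by (simp add: log_integral_def set_lebesgue_integral_def)
  have "\<bar>log_integral \<kappa> V T 1\<bar> \<le> log_integral \<kappa> V e0 1" if T: "e0 < T" "T \<le> e0 / rmin" for T
  proof -
    have "e0 / rmin \<le> 1" using e0 rmin_pos by simp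
    then have "T \<le> 1" using T by linarith
    then have "log_integral \<kappa> V e0 1 = log_integral \<kappa> V e0 T + log_integral \<kappa> V T 1"
      using T e0(1) by (intro log_integral_combine[OF log_integrable_V]) auto
    then show ?thesis using nn[of e0 T] nn[of T 1] T e0(1) by simp
  qed
  from renewal_average_limit[OF e0(1) J this] show ?thesis by (simp add: log_average_def[abs_def])
qed

text \<open>The density is bounded below by a positive constant, and so are its averages.\<close>

lemma average_pos: "0 < scaling_integral / mean"
proof -
  obtain a b where ab: "0 < a" "\<And>e. 0 < e \<Longrightarrow> e \<le> 1 \<Longrightarrow> a \<le> e powr \<kappa> * V e \<and> e powr \<kappa> * V e \<le> b"
    using density_bounds by blast
  have "a * e powr - \<kappa> \<le> V e" if e: "0 < e" "e \<le> 1" for e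
  proof -
    have "a * e powr - \<kappa> \<le> (e powr \<kappa> * V e) * e powr - \<kappa>" using ab(2)[OF e] by (intro mult_right_mono) auto
    also have "\<dots> = V e" using e by (simp add: powr_minus)
    finally show ?thesis .
  qed
  then have "a \<le> scaling_integral / mean"
    by (rule log_average_le_limit[OF log_average_power(1) log_integrable_V zero_less_one _ log_average_power(2) log_average_K])
  then show ?thesis using ab(1) by linarith
qed

text \<open>Monotonicity of the volume supplies the one-sided continuity that \<open>renewal_limit_exists\<close> needs.\<close>

lemma density_limit_nonlattice:
  assumes "\<nexists>a. a > 0 \<and> (\<forall>i\<in>I. \<exists>k::int. ln (r i) = a * of_int k)"
  shows "((\<lambda>e. e powr \<kappa> * V e) \<longlongrightarrow> scaling_integral / mean) (at_right 0)"
proof -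
  obtain e0 where e0: "0 < e0" "e0 \<le> rmin" "\<And>e. 0 < e \<Longrightarrow> e \<le> e0 \<Longrightarrow> V e = (\<Sum>i\<in>I. parallel_volume (\<phi> i ` K) e)"
    using volume_recursion by blast
  obtain a b where ab: "0 < a" "\<And>e. 0 < e \<Longrightarrow> e \<le> 1 \<Longrightarrow> a \<le> e powr \<kappa> * V e \<and> e powr \<kappa> * V e \<le> b"
    using density_bounds by blast
  obtain L where L: "((\<lambda>e. e powr \<kappa> * V e) \<longlongrightarrow> L) (at_right 0)"
  proof (rule renewal_limit_exists[OF assms e0(1)])
    show "e powr \<kappa> * V e = (\<Sum>i\<in>I. r i powr s * ((e / r i) powr \<kappa> * V (e / r i)))" if "0 < e" "e \<le> e0" for e
      using density_recursion[OF that(1) e0(3)[OF that]] .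
    show "e powr \<kappa> * V e \<le> b" if "0 < e" "e \<le> e0" for e
      using ab(2)[of e] that e0(2) rmin_less by auto
    show "0 \<le> \<bar>\<kappa>\<bar>" by simp
    show "e' powr \<kappa> * V e' \<le> (e / e') powr \<bar>\<kappa>\<bar> * (e powr \<kappa> * V e)" if e: "0 < e'" "e' \<le> e" for e e'
    proof -
      have "e' powr \<kappa> = (e / e') powr - \<kappa> * e powr \<kappa>"
        using e by (simp add: powr_minus powr_divide)
      also have "\<dots> \<le> (e / e') powr \<bar>\<kappa>\<bar> * e powr \<kappa>"
        using e by (intro mult_right_mono powr_mono) auto
      finally have "e' powr \<kappa> * V e' \<le> ((e / e') powr \<bar>\<kappa>\<bar> * e powr \<kappa>) * V e"
        using V_mono[OF e] V_nonneg by (intro mult_mono) auto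
      then show ?thesis by (simp add: mult.assoc)
    qed
  qed (use V_nonneg in auto)
  with log_average_eq_limit[OF log_integrable_V log_average_K L] show ?thesis by simp
qed

end

lemma comparable_density_bounds:
  assumes cmp: "comparable \<kappa> V W k c" and c: "0 < c"
    and a: "0 < a" and bnd: "\<And>e. 0 < e \<Longrightarrow> e \<le> 1 \<Longrightarrow> a \<le> e powr \<kappa> * V e \<and> e powr \<kappa> * V e \<le> b"
  obtains a' b' e0 where "0 < a'" "0 < e0" "\<And>e. 0 < e \<Longrightarrow> e \<le> e0 \<Longrightarrow> a' \<le> e powr \<kappa> * W e \<and> e powr \<kappa> * W e \<le> b'"
proof -
  obtain A :: "nat list set" and \<beta> u \<beta>' u' e0 where *: "finite A" "0 < e0"
     "\<And>w. w\<in>A \<Longrightarrow> 0 < u w \<and> 0 < u' w" "\<And>w. w\<in>A \<Longrightarrow> 0 \<le> \<beta> w \<and> 0 \<le> \<beta>' w"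
     "\<And>e. 0 < e \<Longrightarrow> e \<le> e0 \<Longrightarrow> (\<Sum>w\<in>A. \<beta> w * V (u w * e)) \<le> W e"
     "\<And>e. 0 < e \<Longrightarrow> e \<le> e0 \<Longrightarrow> W e \<le> (\<Sum>w\<in>A. \<beta>' w * V (u' w * e))"
     "c \<le> (1 + 1) ^ k * (\<Sum>w\<in>A. \<beta> w * u w powr - \<kappa>)"
    by (rule comparableE[OF cmp zero_less_one]) blast
  have small: "\<forall>\<^sub>F e in at_right (0::real). \<forall>w\<in>A. v w * e \<le> 1" for v :: "nat list \<Rightarrow> real"
  proof (rule eventually_ball_finite[OF *(1)], rule ballI)
    fix w
    have "((\<lambda>e. v w * e) \<longlongrightarrow> v w * 0) (at_right 0)" by (intro tendsto_intros)
    then have "\<forall>\<^sub>F e in at_right 0. v w * e < 1" by (rule order_tendstoD) simp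
    then show "\<forall>\<^sub>F e in at_right 0. v w * e \<le> 1" by eventually_elim simp
  qed
  have "\<forall>\<^sub>F e in at_right (0::real). e \<le> e0 \<and> (\<forall>w\<in>A. u w * e \<le> 1) \<and> (\<forall>w\<in>A. u' w * e \<le> 1)"
    using small[of u] small[of u'] eventually_at_right_real[OF *(2)] by eventually_elim auto
  then obtain e1 where e1: "0 < e1" "\<And>e. 0 < e \<Longrightarrow> e < e1 \<Longrightarrow> e \<le> e0 \<and> (\<forall>w\<in>A. u w * e \<le> 1) \<and> (\<forall>w\<in>A. u' w * e \<le> 1)"
    unfolding eventually_at_right_field by blast
  have V_eq: "e powr \<kappa> * (\<Sum>w\<in>A. \<gamma> w * V (v w * e)) = (\<Sum>w\<in>A. (\<gamma> w * v w powr - \<kappa>) * ((v w * e) powr \<kappa> * V (v w * e)))"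
    if "0 < e" "\<And>w. w \<in> A \<Longrightarrow> 0 < v w" for e \<gamma> v
    unfolding sum_distrib_left
  proof (rule sum.cong[OF refl])
    fix w assume "w \<in> A"
    then have "0 < v w" by (rule that)
    then show "e powr \<kappa> * (\<gamma> w * V (v w * e)) = \<gamma> w * v w powr - \<kappa> * ((v w * e) powr \<kappa> * V (v w * e))"
      using that by (simp add: powr_mult powr_minus)
  qed
  show ?thesis
  proof (rule that)
    have "0 < (1 + 1 :: real) ^ k * (\<Sum>w\<in>A. \<beta> w * u w powr - \<kappa>)" using *(7) c by linarith
    then have "0 < (\<Sum>w\<in>A. \<beta> w * u w powr - \<kappa>)" by (simp add: zero_less_mult_iff)
    then show "0 < (\<Sum>w\<in>A. \<beta> w * u w powr - \<kappa>) * a" using a by simp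
    show "0 < e1 / 2" using e1 by simp
    fix e :: real assume e: "0 < e" "e \<le> e1 / 2"
    then have e': "e \<le> e0" "\<forall>w\<in>A. u w * e \<le> 1" "\<forall>w\<in>A. u' w * e \<le> 1" using e1(2)[of e] e1(1) by auto
    have eq: "e powr \<kappa> * (\<Sum>w\<in>A. \<beta> w * V (u w * e)) = (\<Sum>w\<in>A. (\<beta> w * u w powr - \<kappa>) * ((u w * e) powr \<kappa> * V (u w * e)))"
      "e powr \<kappa> * (\<Sum>w\<in>A. \<beta>' w * V (u' w * e)) = (\<Sum>w\<in>A. (\<beta>' w * u' w powr - \<kappa>) * ((u' w * e) powr \<kappa> * V (u' w * e)))"
      by (rule V_eq[OF e(1)], use *(3) in blast)+
    have "(\<Sum>w\<in>A. \<beta> w * u w powr - \<kappa>) * a \<le> e powr \<kappa> * (\<Sum>w\<in>A. \<beta> w * V (u w * e))"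
      unfolding eq sum_distrib_right
    proof (intro sum_mono mult_left_mono)
      fix w assume w: "w \<in> A"
      show "a \<le> (u w * e) powr \<kappa> * V (u w * e)" using bnd[of "u w * e"] *(3)[OF w] e e' w by simp
      show "0 \<le> \<beta> w * u w powr - \<kappa>" using *(4)[OF w] by simp
    qed
    also have "\<dots> \<le> e powr \<kappa> * W e" using *(5)[OF e(1) e'(1)] by (intro mult_left_mono) auto
    finally have lower: "(\<Sum>w\<in>A. \<beta> w * u w powr - \<kappa>) * a \<le> e powr \<kappa> * W e" .
    have "e powr \<kappa> * W e \<le> e powr \<kappa> * (\<Sum>w\<in>A. \<beta>' w * V (u' w * e))" using *(6)[OF e(1) e'(1)] by (intro mult_left_mono) auto
    also have "\<dots> \<le> (\<Sum>w\<in>A. \<beta>' w * u' w powr - \<kappa>) * b"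
      unfolding eq sum_distrib_right
    proof (intro sum_mono mult_left_mono)
      fix w assume w: "w \<in> A"
      show "(u' w * e) powr \<kappa> * V (u' w * e) \<le> b" using bnd[of "u' w * e"] *(3)[OF w] e e' w by simp
      show "0 \<le> \<beta>' w * u' w powr - \<kappa>" using *(4)[OF w] by simp
    qed
    finally show "(\<Sum>w\<in>A. \<beta> w * u w powr - \<kappa>) * a \<le> e powr \<kappa> * W e \<and>
        e powr \<kappa> * W e \<le> (\<Sum>w\<in>A. \<beta>' w * u' w powr - \<kappa>) * b" using lower by blast
  qed
qed

section \<open>Conformal images of self-similar sets\<close>

text \<open>The cylinders of a sufficiently late generation are so small that on each of them \<open>\<sigma>\<close> varies by at most
the factor \<open>1 + \<eta>\<close>. A cylinder with ratio \<open>t\<close> and base point \<open>p\<close> contributes the summand with scale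
\<open>1 / (\<sigma>(p) t)\<close> and weight \<open>(\<sigma>(p) t)\<^sup>d\<close>, up to powers of \<open>1 + \<eta>\<close>. It multiplies limits by
\<open>(\<sigma>(p) t)\<^sup>s\<close>, and \<open>\<Sum> t\<^sup>s \<sigma>(p)\<^sup>s\<close> is a Riemann sum of the integral.\<close>

lemma conformal_image_comparable:
  fixes \<phi> :: "nat \<Rightarrow> real^'d \<Rightarrow> real^'d" and g h :: "real^'d \<Rightarrow> real^'d"
  assumes "self_similar_set_vec I \<phi> r K s \<kappa>" and "conformal_diffeomorphism g h U" and KU: "K \<subseteq> U"
  shows "comparable \<kappa> (parallel_volume K) (parallel_volume (g ` K)) (2 * CARD('d))
     (LINT x:K|normalised_hausdorff s K. scaling_ratio g x powr s)"
proof -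
  interpret self_similar_set_vec I \<phi> r K s \<kappa> by fact
  interpret conformal_diffeomorphism g h U by fact
  let ?d = "CARD('d)"
  let ?Int = "LINT x:K|\<nu>. \<sigma> x powr s"
  have cont: "continuous_on K (\<lambda>x. \<sigma> x powr s)"
    using KU \<sigma>_pos by (intro continuous_intros continuous_on_subset[OF continuous_\<sigma>]) force+
  show ?thesis unfolding comparable_def
  proof (intro allI impI)
    fix \<eta> :: real assume \<eta>: "0 < \<eta>"
    obtain \<rho> where \<rho>: "0 < \<rho>"
      "\<And>p x. p \<in> K \<Longrightarrow> dist p x < \<rho> \<Longrightarrow> x \<in> U \<and> \<sigma> x \<le> (1 + \<eta>) * \<sigma> p \<and> \<sigma> p \<le> (1 + \<eta>) * \<sigma> x"
      "\<And>p z. p \<in> K \<Longrightarrow> dist (g p) z < \<rho> \<Longrightarrow> z \<in> g ` U \<and> \<sigma> p \<le> (1 + \<eta>) * \<sigma> (h z)"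
      using uniform_distortion[OF K_cpt K_ne KU \<eta>] by blast
    have "uniformly_continuous_on K g"
      by (rule compact_uniformly_continuous[OF continuous_on_subset[OF continuous_g KU] K_cpt])
    from this[unfolded uniformly_continuous_on_def, rule_format, of "\<rho> / 2"] \<rho>(1)
    obtain \<delta> where \<delta>: "0 < \<delta>" "\<And>x y. x \<in> K \<Longrightarrow> y \<in> K \<Longrightarrow> dist y x < \<delta> \<Longrightarrow> dist (g y) (g x) < \<rho> / 2"
      by auto
    define D where "D = diameter K + 1"
    have D: "0 < D" "\<And>x y. x \<in> K \<Longrightarrow> y \<in> K \<Longrightarrow> dist x y < D"
      using diameter_ge_0[OF compact_imp_bounded[OF K_cpt]] diameter_bounded_bound[OF compact_imp_bounded[OF K_cpt]]
      by (force simp: D_def)+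
    have "0 < min (\<rho> / 2) \<delta> / D" using \<rho> \<delta> D by simp
    then obtain n where n: "\<And>w. w \<in> words n \<Longrightarrow> word_ratio w < min (\<rho> / 2) \<delta> / D"
      by (rule small_words) blast
    obtain x0 where x0: "x0 \<in> K" using K_ne by auto
    define A where "A w = word_map w ` K" for w
    define p where "p w = word_map w x0" for w
    define t where "t = word_ratio"
    have sim_w: "similarity (word_map w) (t w)" if "w \<in> words n" for w
      using similarity_word_map[OF that] by (simp add: t_def)
    have t: "0 < t w" if "w \<in> words n" for w using sim_w[OF that] by (simp add: similarity_def)
    have A: "compact (A w)" "A w \<noteq> {}" "A w \<subseteq> K" "p w \<in> A w" if "w \<in> words n" for w
      using that sim_w[OF that] x0 K_ne word_map_sub[OF that]
      by (auto simp: A_def p_def intro!: compact_continuous_image similarity_continuous K_cpt)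
    have pK: "p w \<in> K" if "w \<in> words n" for w using A[OF that] by auto
    have \<sigma>p: "0 < \<sigma> (p w)" if "w \<in> words n" for w using pK[OF that] KU \<sigma>_pos by auto
    have A_diam: "dist (p w) y < min (\<rho> / 2) \<delta>" if w: "w \<in> words n" and y: "y \<in> A w" for w y
    proof -
      obtain k where k: "k \<in> K" "y = word_map w k" using y by (auto simp: A_def)
      have "dist (p w) y = t w * dist x0 k" using sim_w[OF w] by (simp add: k p_def similarity_def)
      also have "\<dots> \<le> t w * D" using D(2)[OF x0 k(1)] t[OF w] by (intro mult_left_mono) auto
      also have "\<dots> < min (\<rho> / 2) \<delta>" using n[OF w] D(1) by (simp only: t_def pos_less_divide_eq)
      finally show ?thesis .
    qed
    have near: "dist (p w) y < \<rho> / 2" "dist (g (p w)) (g y) < \<rho> / 2" if w: "w \<in> words n" and y: "y \<in> A w" for w y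
      using A_diam[OF w y] \<delta>(2)[of y "p w"] A(3)[OF w] pK[OF w] y by auto
    have "disjoint_family_on (\<lambda>w. g ` A w) (words n)"
      unfolding disjoint_family_on_def
    proof (intro ballI impI)
      fix v w assume vw: "v \<in> words n" "w \<in> words n" "v \<noteq> w"
      have "A v \<inter> A w = {}" using word_map_disjoint[of n] vw by (auto simp: disjoint_family_on_def A_def)
      moreover have "inj_on g U" by (rule inj_on_inverseI) (rule h_g)
      ultimately show "g ` A v \<inter> g ` A w = {}"
        using inj_on_image_Int[of g U "A v" "A w"] A(3)[OF vw(1)] A(3)[OF vw(2)] KU by auto
    qed
    moreover have "compact (g ` A w)" "g ` A w \<noteq> {}" if "w \<in> words n" for w
      using A[OF that] KU by (auto intro!: compact_continuous_image continuous_on_subset[OF continuous_g])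
    moreover have "words n \<noteq> {}" using sum_word_ratio[of n] by auto
    ultimately obtain e1 where e1: "0 < e1"
      "\<And>e. 0 < e \<Longrightarrow> e \<le> e1 \<Longrightarrow> parallel_volume (\<Union>w\<in>words n. g ` A w) e = (\<Sum>w\<in>words n. parallel_volume (g ` A w) e)"
      using parallel_volume_disjoint_UN[OF finite_words, of n "\<lambda>w. g ` A w"] by metis
    have UA: "(\<Union>w\<in>words n. g ` A w) = g ` K"
      using word_map_cover[of n] by (simp only: A_def image_UN[symmetric])
    have small: "\<forall>\<^sub>F e in at_right (0::real). \<forall>w\<in>words n. v w * e < \<rho> / 2" for v :: "nat list \<Rightarrow> real"
    proof (rule eventually_ball_finite[OF finite_words], rule ballI)
      fix w
      have "((\<lambda>e. v w * e) \<longlongrightarrow> v w * 0) (at_right 0)" by (intro tendsto_intros)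
      then show "\<forall>\<^sub>F e in at_right 0. v w * e < \<rho> / 2" by (rule order_tendstoD) (use \<rho>(1) in simp)
    qed
    have "\<forall>\<^sub>F e in at_right (0::real). e \<le> e1 \<and> e < \<rho> / 2 \<and> (\<forall>w\<in>words n. (1 + \<eta>) / \<sigma> (p w) * e < \<rho> / 2)
        \<and> (\<forall>w\<in>words n. 1 / ((1 + \<eta>) * \<sigma> (p w)) * e < \<rho> / 2)"
      using small[of "\<lambda>w. (1 + \<eta>) / \<sigma> (p w)"] small[of "\<lambda>w. 1 / ((1 + \<eta>) * \<sigma> (p w))"]
        eventually_at_right_real[OF e1(1)] eventually_at_right_real[OF half_gt_zero[OF \<rho>(1)]]
      by eventually_elim auto
    then obtain e2 where e2: "0 < e2" "\<And>e. 0 < e \<Longrightarrow> e < e2 \<Longrightarrow> e \<le> e1 \<and> e < \<rho> / 2 \<and>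
        (\<forall>w\<in>words n. (1 + \<eta>) / \<sigma> (p w) * e < \<rho> / 2) \<and> (\<forall>w\<in>words n. 1 / ((1 + \<eta>) * \<sigma> (p w)) * e < \<rho> / 2)"
      unfolding eventually_at_right_field by blast
    define b where "b w = (\<sigma> (p w) * t w / (1 + \<eta>)) ^ ?d" for w
    define u where "u w = 1 / ((1 + \<eta>) * (\<sigma> (p w) * t w))" for w
    define b' where "b' w = ((1 + \<eta>) * (\<sigma> (p w) * t w)) ^ ?d" for w
    define u' where "u' w = (1 + \<eta>) / (\<sigma> (p w) * t w)" for w
    have vA: "parallel_volume (A w) e = t w ^ ?d * V (e / t w)" if "w \<in> words n" "0 < e" for w e
      unfolding A_def by (rule parallel_volume_similarity[OF sim_w[OF that(1)] K_cpt K_ne that(2)])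
    have piece: "b w * V (u w * e) \<le> parallel_volume (g ` A w) e \<and> parallel_volume (g ` A w) e \<le> b' w * V (u' w * e)"
      if w: "w \<in> words n" and e: "0 < e" "e < e2" for w e
    proof -
      have small: "e < \<rho> / 2" "(1 + \<eta>) / \<sigma> (p w) * e < \<rho> / 2" "1 / ((1 + \<eta>) * \<sigma> (p w)) * e < \<rho> / 2"
        using e2(2)[OF e] w by auto
      have pU: "p w \<in> U" using pK[OF w] KU by auto
      have q: "\<And>x. dist (p w) x < \<rho> \<Longrightarrow> x \<in> U \<and> \<sigma> x \<le> (1 + \<eta>) * \<sigma> (p w)"
        "\<And>z. dist (g (p w)) z < \<rho> \<Longrightarrow> z \<in> g ` U \<and> \<sigma> (p w) \<le> (1 + \<eta>) * \<sigma> (h z)"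
        using \<rho>(2,3)[OF pK[OF w]] by auto
      note bounds = parallel_volume_image_bounds[OF A(1,2)[OF w] \<eta> pU q near[OF w] e(1) small(1)]
      have "parallel_volume (g ` A w) e \<le> ((1 + \<eta>) * \<sigma> (p w)) ^ ?d * parallel_volume (A w) ((1 + \<eta>) / \<sigma> (p w) * e)"
        by (rule bounds(1)[OF _ _ _ _ small(2)])
      also have "\<dots> = ((1 + \<eta>) * \<sigma> (p w)) ^ ?d * (t w ^ ?d * V ((1 + \<eta>) / \<sigma> (p w) * e / t w))"
        using vA[OF w] e(1) \<eta> \<sigma>p[OF w] by simp
      also have "\<dots> = b' w * V (u' w * e)"
        by (simp add: b'_def u'_def power_mult_distrib mult_ac)
      finally have upper: "parallel_volume (g ` A w) e \<le> b' w * V (u' w * e)" .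
      have "parallel_volume (A w) (1 / ((1 + \<eta>) * \<sigma> (p w)) * e) \<le> ((1 + \<eta>) / \<sigma> (p w)) ^ ?d * parallel_volume (g ` A w) e"
        by (rule bounds(2)[OF _ _ _ _ small(3)])
      also have "parallel_volume (A w) (1 / ((1 + \<eta>) * \<sigma> (p w)) * e) = t w ^ ?d * V (1 / ((1 + \<eta>) * \<sigma> (p w)) * e / t w)"
        using vA[OF w] e(1) \<eta> \<sigma>p[OF w] by simp
      also have "1 / ((1 + \<eta>) * \<sigma> (p w)) * e / t w = u w * e" by (simp add: u_def mult_ac)
      finally have "(\<sigma> (p w) / (1 + \<eta>)) ^ ?d * (t w ^ ?d * V (u w * e))
          \<le> (\<sigma> (p w) / (1 + \<eta>)) ^ ?d * (((1 + \<eta>) / \<sigma> (p w)) ^ ?d * parallel_volume (g ` A w) e)"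
        using \<eta> \<sigma>p[OF w] by (intro mult_left_mono) auto
      also have "\<dots> = parallel_volume (g ` A w) e"
        using \<eta> \<sigma>p[OF w] by (simp add: mult.assoc[symmetric] power_mult_distrib[symmetric])
      also have "(\<sigma> (p w) / (1 + \<eta>)) ^ ?d * (t w ^ ?d * V (u w * e)) = b w * V (u w * e)"
        by (simp add: b_def power_mult_distrib power_divide mult_ac)
      finally show ?thesis using upper by blast
    qed
    have x_dist: "dist (p w) x < \<rho>" if "w \<in> words n" "x \<in> A w" for w x
      using near(1)[OF that] \<rho>(1) by linarith
    define S where "S = (\<Sum>w\<in>words n. (\<sigma> (p w) * t w) powr s)"
    \<comment> \<open>\<open>S\<close> is the Riemann sum; the factor \<open>c\<close> will be \<open>1 + \<eta>\<close> or its inverse.\<close>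
    have S_eq: "(\<Sum>w\<in>words n. t w powr s * ((c * \<sigma> (p w)) powr s)) = c powr s * S" if "0 < c" for c
      unfolding S_def sum_distrib_left
      using that \<sigma>p t by (intro sum.cong refl) (simp add: powr_mult less_imp_le)
    have "?Int \<le> (\<Sum>w\<in>words n. word_ratio w powr s * ((1 + \<eta>) * \<sigma> (p w)) powr s)"
    proof (rule integral_\<nu>_le[OF cont])
      fix w x assume w: "w \<in> words n" and "x \<in> word_map w ` K"
      then have x: "x \<in> A w" by (simp add: A_def)
      then have "0 < \<sigma> x" using A(3)[OF w] KU \<sigma>_pos by auto
      then show "\<sigma> x powr s \<le> ((1 + \<eta>) * \<sigma> (p w)) powr s"
        using \<rho>(2)[OF pK[OF w] x_dist[OF w x]] s_pos by (intro powr_mono2) auto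
    qed
    then have Int_le: "?Int \<le> (1 + \<eta>) powr s * S" using S_eq[of "1 + \<eta>"] \<eta> by (simp add: t_def)
    have "(\<Sum>w\<in>words n. word_ratio w powr s * (1 / (1 + \<eta>) * \<sigma> (p w)) powr s) \<le> ?Int"
    proof (rule integral_\<nu>_ge[OF cont])
      fix w x assume w: "w \<in> words n" and "x \<in> word_map w ` K"
      then have x: "x \<in> A w" by (simp add: A_def)
      have "1 / (1 + \<eta>) * \<sigma> (p w) \<le> \<sigma> x"
        using \<rho>(2)[OF pK[OF w] x_dist[OF w x]] \<eta> by (simp add: field_simps)
      then show "(1 / (1 + \<eta>) * \<sigma> (p w)) powr s \<le> \<sigma> x powr s"
        using \<sigma>p[OF w] \<eta> s_pos by (intro powr_mono2) auto
    qed
    then have "(1 / (1 + \<eta>)) powr s * S \<le> ?Int" using S_eq[of "1 / (1 + \<eta>)"] \<eta> by (simp add: t_def)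
    then have "(1 + \<eta>) powr s * ((1 / (1 + \<eta>)) powr s * S) \<le> (1 + \<eta>) powr s * ?Int"
      by (intro mult_left_mono) auto
    also have "(1 + \<eta>) powr s * ((1 / (1 + \<eta>)) powr s * S) = S"
      using \<eta> by (simp add: mult.assoc[symmetric] powr_mult[symmetric])
    finally have S_le: "S \<le> (1 + \<eta>) powr s * ?Int" .
    have pw: "x ^ ?d * x powr \<kappa> = x powr s" "x ^ ?d = x powr real ?d" if "0 < x" for x :: real
      using that by (auto simp: \<kappa>_eq powr_realpow[symmetric] powr_add[symmetric])
    have sum_u: "(\<Sum>w\<in>words n. b w * u w powr - \<kappa>) = (1 + \<eta>) powr (\<kappa> - real ?d) * S"
      unfolding S_def sum_distrib_left
    proof (rule sum.cong[OF refl])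
      fix w assume w: "w \<in> words n"
      define x where "x = \<sigma> (p w) * t w"
      have x: "0 < x" using \<sigma>p[OF w] t[OF w] by (simp add: x_def)
      have "b w * u w powr - \<kappa> = (x ^ ?d / (1 + \<eta>) ^ ?d) * ((1 + \<eta>) powr \<kappa> * x powr \<kappa>)"
        using x \<eta> by (simp add: b_def u_def x_def[symmetric] power_divide powr_minus powr_divide powr_mult)
      also have "\<dots> = ((1 + \<eta>) powr \<kappa> / (1 + \<eta>) powr real ?d) * x powr s"
        using pw(1)[OF x] pw(2)[of "1 + \<eta>"] \<eta> by (simp add: mult_ac)
      finally show "b w * u w powr - \<kappa> = (1 + \<eta>) powr (\<kappa> - real ?d) * (\<sigma> (p w) * t w) powr s"
        by (simp add: powr_diff x_def)
    qed
    have sum_u': "(\<Sum>w\<in>words n. b' w * u' w powr - \<kappa>) = (1 + \<eta>) powr (real ?d - \<kappa>) * S"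
      unfolding S_def sum_distrib_left
    proof (rule sum.cong[OF refl])
      fix w assume w: "w \<in> words n"
      define x where "x = \<sigma> (p w) * t w"
      have x: "0 < x" using \<sigma>p[OF w] t[OF w] by (simp add: x_def)
      have "b' w * u' w powr - \<kappa> = ((1 + \<eta>) ^ ?d * x ^ ?d) * (x powr \<kappa> / (1 + \<eta>) powr \<kappa>)"
        using x \<eta> by (simp add: b'_def u'_def x_def[symmetric] power_mult_distrib powr_minus powr_divide)
      also have "\<dots> = ((1 + \<eta>) powr real ?d / (1 + \<eta>) powr \<kappa>) * x powr s"
        using pw(1)[OF x] pw(2)[of "1 + \<eta>"] \<eta> by (simp add: mult_ac)
      finally show "b' w * u' w powr - \<kappa> = (1 + \<eta>) powr (real ?d - \<kappa>) * (\<sigma> (p w) * t w) powr s"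
        by (simp add: powr_diff x_def)
    qed
    have p2: "(1 + \<eta>) ^ (2 * ?d) = (1 + \<eta>) powr (2 * real ?d)"
      using \<eta> by (simp add: powr_realpow[symmetric])
    have cond1: "?Int \<le> (1 + \<eta>) ^ (2 * ?d) * (\<Sum>w\<in>words n. b w * u w powr - \<kappa>)"
      unfolding sum_u p2 mult.assoc[symmetric] powr_add[symmetric] using Int_le by (simp add: \<kappa>_eq)
    have "(1 + \<eta>) powr (real ?d - \<kappa>) * S \<le> (1 + \<eta>) powr (real ?d - \<kappa>) * ((1 + \<eta>) powr s * ?Int)"
      using S_le by (intro mult_left_mono) auto
    then have cond2: "(\<Sum>w\<in>words n. b' w * u' w powr - \<kappa>) \<le> (1 + \<eta>) ^ (2 * ?d) * ?Int"
      unfolding sum_u' p2 mult.assoc[symmetric] powr_add[symmetric] by (simp add: \<kappa>_eq)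
    have sandwich: "(\<Sum>w\<in>words n. b w * V (u w * e)) \<le> parallel_volume (g ` K) e \<and>
        parallel_volume (g ` K) e \<le> (\<Sum>w\<in>words n. b' w * V (u' w * e))" if e: "0 < e" "e \<le> e2 / 2" for e
    proof -
      have e': "e < e2" using e e2(1) by linarith
      have "parallel_volume (g ` K) e = (\<Sum>w\<in>words n. parallel_volume (g ` A w) e)"
        using e1(2)[OF e(1)] e2(2)[OF e(1) e'] by (simp only: UA)
      then show ?thesis using piece[OF _ e(1) e'] by (auto intro!: sum_mono)
    qed
    have pos: "0 < u w \<and> 0 < u' w \<and> 0 \<le> b w \<and> 0 \<le> b' w" if "w \<in> words n" for w
      using \<sigma>p[OF that] t[OF that] \<eta> by (simp add: u_def u'_def b_def b'_def)
    show "\<exists>(A :: nat list set) b u b' u' e0. finite A \<and> 0 < e0 \<and>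
     (\<forall>w\<in>A. 0 < u w \<and> 0 < u' w \<and> 0 \<le> b w \<and> 0 \<le> b' w) \<and>
     (\<forall>e. 0 < e \<and> e \<le> e0 \<longrightarrow> (\<Sum>w\<in>A. b w * V (u w * e)) \<le> parallel_volume (g ` K) e \<and>
        parallel_volume (g ` K) e \<le> (\<Sum>w\<in>A. b' w * V (u' w * e))) \<and>
     ?Int \<le> (1 + \<eta>) ^ (2 * ?d) * (\<Sum>w\<in>A. b w * u w powr - \<kappa>) \<and>
     (\<Sum>w\<in>A. b' w * u' w powr - \<kappa>) \<le> (1 + \<eta>) ^ (2 * ?d) * ?Int"
    proof (intro exI conjI allI impI ballI)
      show "finite (words n)" by (rule finite_words)
      show "0 < e2 / 2" using e2(1) by simp
      show "?Int \<le> (1 + \<eta>) ^ (2 * ?d) * (\<Sum>w\<in>words n. b w * u w powr - \<kappa>)" by (rule cond1)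
      show "(\<Sum>w\<in>words n. b' w * u' w powr - \<kappa>) \<le> (1 + \<eta>) ^ (2 * ?d) * ?Int" by (rule cond2)
    qed (use pos sandwich in auto)
  qed
qed

lemma conformal_integral_pos:
  fixes \<phi> :: "nat \<Rightarrow> real^'d \<Rightarrow> real^'d" and g h :: "real^'d \<Rightarrow> real^'d"
  assumes "self_similar_set_vec I \<phi> r K s \<kappa>" and "conformal_diffeomorphism g h U" and KU: "K \<subseteq> U"
  shows "0 < (LINT x:K|normalised_hausdorff s K. scaling_ratio g x powr s)"
proof -
  interpret self_similar_set_vec I \<phi> r K s \<kappa> by fact
  interpret conformal_diffeomorphism g h U by fact
  have cont: "continuous_on K (\<lambda>x. \<sigma> x powr s)"
    using KU \<sigma>_pos by (intro continuous_intros continuous_on_subset[OF continuous_\<sigma>]) force+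
  obtain z where z: "z \<in> K" "\<And>x. x \<in> K \<Longrightarrow> \<sigma> z powr s \<le> \<sigma> x powr s"
    using continuous_attains_inf[OF K_cpt K_ne cont] by blast
  have "0 < \<sigma> z powr s" using z(1) KU \<sigma>_pos[of z] by auto
  also have "\<sigma> z powr s = (\<Sum>w\<in>words 0. word_ratio w powr s * \<sigma> z powr s)"
    by (simp add: words_0 word_ratio_def)
  also have "\<dots> \<le> (LINT x:K|\<nu>. \<sigma> x powr s)"
    by (rule integral_\<nu>_ge[OF cont]) (use z(2) word_map_sub in blast)
  finally show ?thesis .
qed

theorem corollary1p14:
  fixes N :: nat
    and \<phi> :: "nat \<Rightarrow> real^'d \<Rightarrow> real^'d"
    and r :: "nat \<Rightarrow> real"
    and K F U :: "(real^'d) set"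
    and g :: "real^'d \<Rightarrow> real^'d"
    and \<alpha> \<delta> :: real
  assumes "N \<ge> 2"
    and "\<And>i. i \<in> {1..N} \<Longrightarrow> contracting_similarity (\<phi> i) (r i)"
    and "invariant_set N \<phi> K"
    and "strong_separation N \<phi> K"
    and "open U"
    and "parallel_nbhd K (1/2) \<subseteq> U"
    and "diffeomorphism_onto_image g U"
    and "conformal_on g U"
    and "\<alpha> > 0"
    and "hoelder_on \<alpha> U (scaling_ratio g)"
    and "F = g ` K"
    and "\<delta> = minkowski_dim K"
  shows "\<exists>M. (has_average_minkowski_content F M \<and> M > 0 \<and>
           M = - inverse (\<Sum>i=1..N. r i powr \<delta> * ln (r i)) *
               (LINT \<epsilon>:{0<..1}|lborel. \<epsilon> powr (\<delta> - real CARD('d) - 1) * scaling_function N \<phi> r K \<epsilon>) *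
               (LINT x:K|normalised_hausdorff \<delta> K. scaling_ratio g x powr \<delta>)) \<and>
           (\<not> lattice_ratios N r \<longrightarrow> has_minkowski_content F M)"
proof -
  have r: "0 < r i \<and> r i < 1" if "i \<in> {1..N}" for i
    using assms(2)[OF that] by (simp add: contracting_similarity_def)
  obtain s where s: "0 < s" "(\<Sum>i=1..N. r i powr s) = 1"
    using similarity_dimension_exists[OF assms(1), of r] r by blast
  define \<kappa> where "\<kappa> = s - real CARD('d)"
  have inv: "K \<noteq> {}" "compact K" "K = (\<Union>i\<in>{1..N}. \<phi> i ` K)"
    using assms(3) unfolding invariant_set_def by blast+
  have ss: "self_similar_set_vec {1..N} \<phi> r K s \<kappa>"
  proof unfold_locales
    show "similarity (\<phi> i) (r i)" if "i \<in> {1..N}" for i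
      using assms(2)[OF that] by (simp add: contracting_similarity_def similarity_def)
    show "disjoint_family_on (\<lambda>i. \<phi> i ` K) {1..N}"
      using assms(4) by (auto simp: strong_separation_def disjoint_family_on_def)
    show "\<exists>i\<in>{1..N}. \<exists>j\<in>{1..N}. i \<noteq> j"
      using assms(1) by (intro bexI[of _ 1] bexI[of _ 2]) auto
  qed (use r s inv \<kappa>_def in auto)
  interpret self_similar_set_vec "{1..N}" \<phi> r K s \<kappa> by (rule ss)
  obtain h where h: "\<forall>x\<in>U. h (g x) = x" "C1_map_on h (g ` U)"
    using assms(7) unfolding diffeomorphism_onto_image_def by blast
  have cd: "conformal_diffeomorphism g h U"
    using assms(7,8) h by unfold_locales (auto simp: diffeomorphism_onto_image_def)
  have KU: "K \<subseteq> U"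
  proof
    fix x assume "x \<in> K"
    then have "x \<in> parallel_nbhd K (1/2)" by (simp add: parallel_nbhd_def)
    then show "x \<in> U" using assms(6) by blast
  qed
  interpret G: conformal_diffeomorphism g h U by (rule cd)
  have \<delta>: "\<delta> = s" using minkowski_dim_eq[OF has_minkowski_dim_K] assms(12) by simp
  define c where "c = (LINT x:K|normalised_hausdorff s K. scaling_ratio g x powr s)"
  have cmp: "comparable \<kappa> V (parallel_volume F) (2 * CARD('d)) c"
    unfolding c_def assms(11) by (rule conformal_image_comparable[OF ss cd KU])
  have c: "0 < c" unfolding c_def by (rule conformal_integral_pos[OF ss cd KU])
  have F: "compact F" "F \<noteq> {}"
    using inv KU unfolding assms(11)
    by (auto intro!: compact_continuous_image continuous_on_subset[OF G.continuous_g])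
  define A where "A = scaling_integral / mean"
  have A: "0 < A" unfolding A_def by (rule average_pos)
  obtain a b where ab: "0 < a" "\<And>e. 0 < e \<Longrightarrow> e \<le> 1 \<Longrightarrow> a \<le> e powr \<kappa> * V e \<and> e powr \<kappa> * V e \<le> b"
    using density_bounds by blast
  obtain a' b' e0 where F_bounds: "0 < a'" "0 < e0"
    "\<And>e. 0 < e \<Longrightarrow> e \<le> e0 \<Longrightarrow> a' \<le> e powr \<kappa> * parallel_volume F e \<and> e powr \<kappa> * parallel_volume F e \<le> b'"
    using comparable_density_bounds[OF cmp c ab] by metis
  have dim_F: "has_minkowski_dim F s"
    using has_minkowski_dimI[OF F_bounds(1,2), of s F b'] F_bounds(3)[unfolded \<kappa>_def] by blast
  have int_F: "log_integrable \<kappa> (parallel_volume F)"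
    by (rule log_integrable_monotone) (auto intro: parallel_volume_nonneg parallel_volume_mono[OF F])
  have "(log_average \<kappa> (parallel_volume F) \<longlongrightarrow> A * c) (at_right 0)"
    by (rule comparable_log_average[OF cmp less_imp_le[OF c] less_imp_le[OF A] log_integrable_V int_F])
       (unfold A_def, rule log_average_K)
  then have avg: "has_average_minkowski_content F (A * c)"
    unfolding has_average_minkowski_content_def
    using dim_F by (intro exI[of _ s]) (simp add: log_average_def[abs_def] log_integral_def \<kappa>_def)
  have content: "has_minkowski_content F (A * c)" if "\<not> lattice_ratios N r"
  proof -
    have "\<nexists>a. a > 0 \<and> (\<forall>i\<in>{1..N}. \<exists>k::int. ln (r i) = a * of_int k)"
      using that by (auto simp: lattice_ratios_def)
    then have "((\<lambda>e. e powr \<kappa> * V e) \<longlongrightarrow> A) (at_right 0)"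
      unfolding A_def by (rule density_limit_nonlattice)
    then have "((\<lambda>e. e powr \<kappa> * parallel_volume F e) \<longlongrightarrow> A * c) (at_right 0)"
      using comparable_limit[OF cmp] A c by simp
    then show ?thesis
      unfolding has_minkowski_content_def using dim_F by (intro exI[of _ s]) (simp add: \<kappa>_def)
  qed
  have "mean = - (\<Sum>i=1..N. r i powr s * ln (r i))"
    unfolding mean_def by (simp add: sum_negf)
  then have "A = - inverse (\<Sum>i=1..N. r i powr s * ln (r i)) * scaling_integral"
    unfolding A_def by (simp add: divide_inverse)
  also have "scaling_integral = (LINT \<epsilon>:{0<..1}|lborel. \<epsilon> powr (\<kappa> - 1) * scaling_function N \<phi> r K \<epsilon>)"
    unfolding scaling_integral_def scaling_function_def ..
  finally have "A * c = - inverse (\<Sum>i=1..N. r i powr \<delta> * ln (r i)) *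
               (LINT \<epsilon>:{0<..1}|lborel. \<epsilon> powr (\<delta> - real CARD('d) - 1) * scaling_function N \<phi> r K \<epsilon>) *
               (LINT x:K|normalised_hausdorff \<delta> K. scaling_ratio g x powr \<delta>)"
    by (simp only: \<delta> c_def \<kappa>_def)
  with avg content mult_pos_pos[OF A c] show ?thesis by blast
qed


end
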